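(* Let $d\ge1$, $2\le p<\infty$ and $s=d(2/p-1)$. Then the Fourier transform $\mathcal{F}\colon L^p(\mathbb{R}^d)\to W^p_s(\mathbb{R}^d)$ is bounded, i.e. there is a constant $C>0$ such that for every $f\in L^p(\mathbb{R}^d)$ the tempered distribution $\hat f$ belongs to $W^p_s(\mathbb{R}^d)$ and $\|\hat f\|_{W^p_s}\le C\|f\|_{L^p}$.
   Context: $\mathcal{S}$ is the Schwartz space on $\mathbb{R}^d$ and $\mathcal{S}'$ the space of tempered distributions. The Fourier transform is $\hat f(\xi)=\mathcal{F}f(\xi)=\int_{\mathbb{R}^d}f(x)e^{-2\pi i x\cdot\xi}\,dx$ on $\mathcal{S}$, extended to $\mathcal{S}'$ by $\langle\hat f,g\rangle=\langle f,\hat g\rangle$. For $s\in\mathbb{R}$ the Bessel potential is $I_sf=\mathcal{F}^{-1}\left((1+|\cdot|^2)^{s/2}\hat f\right)$, $f\in\mathcal{S}'$. For $1<p<\infty$, the Sobolev space is $W^p_s=\{f\in\mathcal{S}': I_sf\in L^p(\mathbb{R}^d)\}$ with norm $\|f\|_{W^p_s}=\|I_sf\|_{L^p}$. *)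

theory Defs
  imports "HOL-Analysis.Analysis"
begin

subsection \<open>The Schwartz space\<close>

text \<open>The list is a list of coordinate directions; for smooth functions the order of the
  directions is irrelevant, so these are exactly the derivatives indexed by multi-indices.\<close>

fun iter_partial :: "'a::euclidean_space list \<Rightarrow> ('a \<Rightarrow> complex) \<Rightarrow> 'a \<Rightarrow> complex" where
  "iter_partial [] f = f"
| "iter_partial (b # bs) f = (\<lambda>x. frechet_derivative (iter_partial bs f) (at x) b)"

definition smooth :: "('a::euclidean_space \<Rightarrow> complex) \<Rightarrow> bool" where
  "smooth f \<longleftrightarrow> (\<forall>bs. set bs \<subseteq> Basis \<longrightarrow> (\<forall>x. iter_partial bs f differentiable (at x)))"

definition schwartz :: "('a::euclidean_space \<Rightarrow> complex) set" where
  "schwartz = {f. smooth f \<and>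
     (\<forall>k bs. set bs \<subseteq> Basis \<longrightarrow> bdd_above (range (\<lambda>x. (1 + norm x) ^ k * norm (iter_partial bs f x))))}"

definition schwartz_seminorm :: "nat \<Rightarrow> 'a::euclidean_space list \<Rightarrow> ('a \<Rightarrow> complex) \<Rightarrow> real" where
  "schwartz_seminorm k bs f = (SUP x. (1 + norm x) ^ k * norm (iter_partial bs f x))"

text \<open>The locally convex topology on the Schwartz space defined by these seminorms: the open
  seminorm balls form a subbasis.\<close>

definition schwartz_topology :: "('a::euclidean_space \<Rightarrow> complex) topology" where
  "schwartz_topology = topology_generated_by
     {{g \<in> schwartz. schwartz_seminorm k bs (\<lambda>x. g x - f x) < e} | f k bs e.
        f \<in> schwartz \<and> set bs \<subseteq> Basis \<and> e > 0}"

subsection \<open>Tempered distributions\<close>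

text \<open>Functionals on the Schwartz space are represented as functions that take the value
  \<open>undefined\<close> outside \<open>schwartz\<close>, so that equality in HOL is equality of distributions.\<close>

type_synonym 'a functional = "('a \<Rightarrow> complex) \<Rightarrow> complex"

definition tempered :: "'a::euclidean_space functional set" where
  "tempered = {u \<in> extensional schwartz.
     (\<forall>f\<in>schwartz. \<forall>g\<in>schwartz. u (\<lambda>x. f x + g x) = u f + u g) \<and>
     (\<forall>c. \<forall>f\<in>schwartz. u (\<lambda>x. c * f x) = c * u f) \<and>
     continuous_map schwartz_topology euclidean u}"

definition dist_of :: "('a::euclidean_space \<Rightarrow> complex) \<Rightarrow> 'a functional" where
  "dist_of f = (\<lambda>g\<in>schwartz. LINT x|lebesgue. f x * g x)"

definition mult_dist :: "('a::euclidean_space \<Rightarrow> complex) \<Rightarrow> 'a functional \<Rightarrow> 'a functional" where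
  "mult_dist m u = (\<lambda>g\<in>schwartz. u (\<lambda>x. m x * g x))"

subsection \<open>The Fourier transform\<close>

definition fourier :: "('a::euclidean_space \<Rightarrow> complex) \<Rightarrow> 'a \<Rightarrow> complex" where
  "fourier f \<xi> = (LINT x|lebesgue. f x * cis (- 2 * pi * (x \<bullet> \<xi>)))"

definition inv_fourier :: "('a::euclidean_space \<Rightarrow> complex) \<Rightarrow> 'a \<Rightarrow> complex" where
  "inv_fourier f x = (LINT \<xi>|lebesgue. f \<xi> * cis (2 * pi * (x \<bullet> \<xi>)))"

definition fourier_dist :: "'a::euclidean_space functional \<Rightarrow> 'a functional" where
  "fourier_dist u = (\<lambda>g\<in>schwartz. u (fourier g))"

definition inv_fourier_dist :: "'a::euclidean_space functional \<Rightarrow> 'a functional" where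
  "inv_fourier_dist u = (\<lambda>g\<in>schwartz. u (inv_fourier g))"

definition bessel_potential :: "real \<Rightarrow> 'a::euclidean_space functional \<Rightarrow> 'a functional" where
  "bessel_potential s u = inv_fourier_dist
     (mult_dist (\<lambda>\<xi>. of_real ((1 + (norm \<xi>)\<^sup>2) powr (s / 2))) (fourier_dist u))"

subsection \<open>Lebesgue and Sobolev spaces\<close>

text \<open>Elements of \<open>Lp p\<close> are functions rather than classes modulo null sets.\<close>

definition Lp :: "real \<Rightarrow> ('a::euclidean_space \<Rightarrow> complex) set" where
  "Lp p = {f \<in> borel_measurable lebesgue. integrable lebesgue (\<lambda>x. norm (f x) powr p)}"

definition Lp_norm :: "real \<Rightarrow> ('a::euclidean_space \<Rightarrow> complex) \<Rightarrow> real" where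
  "Lp_norm p f = (LINT x|lebesgue. norm (f x) powr p) powr (1 / p)"

definition sobolev :: "real \<Rightarrow> real \<Rightarrow> 'a::euclidean_space functional set" where
  "sobolev p s = {u \<in> tempered. bessel_potential s u \<in> dist_of ` Lp p}"

text \<open>The choice is immaterial: a function in \<open>Lp p\<close> with \<open>1 \<le> p\<close> is determined almost
  everywhere by its distribution.\<close>

definition sobolev_norm :: "real \<Rightarrow> real \<Rightarrow> 'a::euclidean_space functional \<Rightarrow> real" where
  "sobolev_norm p s u = Lp_norm p (SOME h. h \<in> Lp p \<and> bessel_potential s u = dist_of h)"

end

theory Submission
  imports Defs "HOL-Probability.Characteristic_Functions"
begin

text \<open>On the Fourier side, \<open>I\<^sub>s\<close> applied to the transform of \<open>f\<close> is the transform of \<open>m f\<close> with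
  \<open>m = (1 + |x|\<^sup>2)\<close> to the power \<open>s / 2\<close>: inverting one Fourier transform and using that \<open>m\<close> is even, its
  value at a test function \<open>g\<close> is the integral of \<open>f m\<close> against the transform of \<open>g\<close>. So the claim is the
  Hardy--Littlewood--Paley inequality that the transform of \<open>m f\<close> has \<open>L\<^sup>p\<close> norm at most a constant times that of
  \<open>f\<close>. By duality it follows from Paley's inequality for the exponent \<open>q = p / (p - 1) \<le> 2\<close>. That one comes from
  Marcinkiewicz interpolation: with \<open>w = (1 + |x|\<^sup>2)\<close> to the power \<open>d / 2\<close>, the map sending \<open>g\<close> to \<open>w\<close> times its
  transform is of strong type \<open>(2, 2)\<close> (Plancherel) and of weak type \<open>(1, 1)\<close> with respect to the
  measure with density \<open>1 / w\<^sup>2\<close>, because the set where \<open>w > t\<close> has measure of order \<open>1 / t\<close>. These estimates are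
  proved for bounded functions of bounded support and extended to \<open>L\<^sup>p\<close> by completeness.\<close>

subsection \<open>Schwartz functions\<close>

text \<open>The hypothesis on \<open>s\<close> makes the Bessel multiplier equal to w^(2/p-1), and
  (2/p-1)q = q-2. So the dual estimate carries exactly the weight w^(q-2) = w^q w^(-2), and Paley's
  inequality bounds the L^q norm of w times the transform for the measure w^(-2) dx. Its weak
  endpoint is elementary: the transform of g is at most the L^1 norm of g, so a large product forces
  w itself to be large. Duality avoids dual norms. A transform h is paired with conj(h) |h|^(p-2),
  the transform is moved to the other factor, and Young's inequality leaves half of the left-hand
  side on the right. Absorbing that half requires finiteness, hence the bounded functions of bounded
  support and a further cut-off to balls. Two obligations come from the definitions. The transform
  of f must be continuous for the seminorm topology, which calls for explicit seminorm bounds on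
  transforms of Schwartz functions. And \<open>sobolev_norm\<close> evaluates a representing
  function picked by choice, so a function must be shown to be determined almost everywhere by its
  distribution.\<close>

lemma iter_partial_append: "iter_partial (as @ bs) f = iter_partial as (iter_partial bs f)"
  by (induction as) auto

lemma iter_partial_closed:
  assumes W: "\<And>w. w \<in> W \<Longrightarrow> \<exists>D. (\<forall>x. (w has_derivative D x) (at x)) \<and> (\<forall>b\<in>Basis. (\<lambda>x. D x b) \<in> W)"
    and "w \<in> W" "set bs \<subseteq> Basis"
  shows "iter_partial bs w \<in> W"
  using assms(3)
proof (induction bs)
  case (Cons b bs)
  then have "iter_partial bs w \<in> W" "b \<in> Basis" by auto
  with W[of "iter_partial bs w"] obtain D where D: "\<And>x. (iter_partial bs w has_derivative D x) (at x)"
      "(\<lambda>x. D x b) \<in> W" by blast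
  have "D x = frechet_derivative (iter_partial bs w) (at x)" for x
    using D(1) by (rule frechet_derivative_at)
  with D(2) show ?case by simp
qed (use assms in simp)

text \<open>Iterated derivatives never have to be computed: it suffices to exhibit a family closed
  under single partial derivatives whose members decay rapidly. Sums of products with multipliers,
  reflections, Gaussians and Fourier transforms are all treated in this way.\<close>

lemma schwartz_coinduct:
  assumes W: "\<And>w. w \<in> W \<Longrightarrow> \<exists>D. (\<forall>x. (w has_derivative D x) (at x)) \<and> (\<forall>b\<in>Basis. (\<lambda>x. D x b) \<in> W)"
    and decay: "\<And>w k. w \<in> W \<Longrightarrow> \<exists>C. \<forall>x. (1 + norm x) ^ k * norm (w x) \<le> C"
  shows "W \<subseteq> schwartz"
proof
  fix w assume w: "w \<in> W"
  have it: "iter_partial bs w \<in> W" if "set bs \<subseteq> Basis" for bs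
    using iter_partial_closed[of W, OF W w that] .
  have "iter_partial bs w differentiable at x" if "set bs \<subseteq> Basis" for bs x
    using W[OF it[OF that]] by (auto simp: differentiable_def)
  moreover have "bdd_above (range (\<lambda>x. (1 + norm x) ^ k * norm (iter_partial bs w x)))"
    if "set bs \<subseteq> Basis" for k bs
    using decay[OF it[OF that], of k] by (auto simp: bdd_above_def)
  ultimately show "w \<in> schwartz"
    by (auto simp: schwartz_def smooth_def)
qed

lemma schwartz_iter_partial:
  assumes "f \<in> schwartz" "set bs \<subseteq> Basis"
  shows "iter_partial bs f \<in> schwartz"
  using assms by (auto simp: schwartz_def smooth_def simp flip: iter_partial_append)

lemma schwartz_partial:
  assumes "f \<in> schwartz" "b \<in> Basis"
  shows "(\<lambda>x. frechet_derivative f (at x) b) \<in> schwartz"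
  using schwartz_iter_partial[OF assms(1), of "[b]"] assms(2) by simp

lemma schwartz_has_derivative:
  assumes "f \<in> schwartz"
  shows "(f has_derivative frechet_derivative f (at x)) (at x)"
proof -
  have "f differentiable (at x)"
    using assms by (auto simp: schwartz_def smooth_def dest: spec[of _ "[]"])
  then show ?thesis using frechet_derivative_works by blast
qed

lemma schwartz_decay:
  assumes "f \<in> schwartz"
  obtains C where "C \<ge> 0" "\<And>x. (1 + norm x) ^ k * norm (f x) \<le> C"
proof -
  have "bdd_above (range (\<lambda>x. (1 + norm x) ^ k * norm (f x)))"
    using assms by (force simp: schwartz_def dest: spec[of _ k] spec[of _ "[]"])
  then obtain C where C: "\<And>x. (1 + norm x) ^ k * norm (f x) \<le> C"
    by (auto simp: bdd_above_def)
  moreover have "0 \<le> C"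
    using C[of 0] by (smt (verit) mult_nonneg_nonneg norm_ge_zero zero_le_power)
  ultimately show ?thesis using that by blast
qed

lemma schwartz_continuous: "f \<in> schwartz \<Longrightarrow> continuous_on A f"
  by (meson schwartz_has_derivative has_derivative_continuous continuous_at_imp_continuous_on)

lemma schwartz_borel_measurable [measurable (raw)]:
  "f \<in> schwartz \<Longrightarrow> f \<in> borel_measurable borel"
  using borel_measurable_continuous_onI schwartz_continuous by blast

text \<open>Smooth multipliers of polynomial growth, generated syntactically so that closure under
  differentiation and the growth bound follow by induction. \<open>powr\<close> supplies the Bessel
  multipliers, \<open>inner\<close> the factors from differentiating a Fourier integral,
  \<open>gauss\<close> the kernels of the uniqueness proof.\<close>

inductive_set tame :: "('a::euclidean_space \<Rightarrow> complex) set" where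
  const: "(\<lambda>x. c) \<in> tame"
| inner: "(\<lambda>x. of_real (x \<bullet> v)) \<in> tame"
| powr: "(\<lambda>x. of_real ((1 + (norm x)\<^sup>2) powr a)) \<in> tame"
| gauss: "c \<ge> 0 \<Longrightarrow> (\<lambda>x. of_real (exp (- c * (norm (x - y))\<^sup>2))) \<in> tame"
| add: "f \<in> tame \<Longrightarrow> g \<in> tame \<Longrightarrow> (\<lambda>x. f x + g x) \<in> tame"
| mult: "f \<in> tame \<Longrightarrow> g \<in> tame \<Longrightarrow> (\<lambda>x. f x * g x) \<in> tame"

lemma has_derivative_norm_power2:
  fixes y :: "'a::real_inner"
  shows "((\<lambda>x. (norm (x - y))\<^sup>2) has_derivative (\<lambda>h. 2 * (x \<bullet> h - y \<bullet> h))) (at x within S)"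
  unfolding power2_norm_eq_inner
  by (auto intro!: derivative_eq_intros simp: inner_commute algebra_simps)

lemma tame_derivative:
  assumes "f \<in> tame"
  shows "\<exists>D. (\<forall>x. (f has_derivative D x) (at x)) \<and> (\<forall>b. (\<lambda>x. D x b) \<in> tame)"
  using assms
proof induction
  case (const c)
  show ?case
    by (intro exI[of _ "\<lambda>x h. 0"]) (auto intro: tame.intros)
next
  case (inner v)
  show ?case
    by (intro exI[of _ "\<lambda>x h. of_real (h \<bullet> v)"])
       (auto intro!: tame.intros derivative_eq_intros)
next
  case (powr a)
  have pos: "0 < 1 + (norm x)\<^sup>2" for x :: 'a
    by (smt (verit) zero_le_power2)
  have "((\<lambda>x. of_real ((1 + (norm x)\<^sup>2) powr a) :: complex) has_derivative
     (\<lambda>h. of_real (2 * (x \<bullet> h) * (a * (1 + (norm x)\<^sup>2) powr (a - 1))))) (at x)" for x :: 'a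
    using has_derivative_norm_power2[of 0 x UNIV] pos[of x]
    by (intro has_derivative_of_real DERIV_compose_FDERIV[of "\<lambda>u. u powr a"])
       (auto intro!: derivative_eq_intros)
  moreover have "(\<lambda>x. of_real (2 * (x \<bullet> b) * (a * (1 + (norm x)\<^sup>2) powr (a - 1)))) \<in> tame" for b :: 'a
    using tame.mult[OF tame.mult[OF tame.const[of 2] tame.inner[of b]] tame.mult[OF tame.const[of "of_real a"] tame.powr[of "a - 1"]]]
    by simp
  ultimately show ?case by (intro exI[of _ "\<lambda>x h. of_real (2 * (x \<bullet> h) * (a * (1 + (norm x)\<^sup>2) powr (a - 1)))"]) blast
next
  case (gauss c y)
  let ?D = "\<lambda>x h. of_real (2 * (x \<bullet> h - y \<bullet> h) * (- c * exp (- c * (norm (x - y))\<^sup>2))) :: complex"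
  have "((\<lambda>x. of_real (exp (- c * (norm (x - y))\<^sup>2)) :: complex) has_derivative ?D x) (at x)" for x :: 'a
    by (intro has_derivative_of_real DERIV_compose_FDERIV[of "\<lambda>u. exp (- c * u)"] has_derivative_norm_power2)
       (auto intro!: derivative_eq_intros)
  moreover have "(\<lambda>x. ?D x b) \<in> tame" for b :: 'a
    using tame.mult[OF tame.mult[OF tame.const[of 2] tame.add[OF tame.inner[of b] tame.const[of "- of_real (y \<bullet> b)"]]]
        tame.mult[OF tame.const[of "- of_real c"] tame.gauss[OF gauss, of y]]]
    by simp
  ultimately show ?case by (intro exI[of _ ?D]) blast
next
  case (add f g)
  then obtain D E where "\<And>x. (f has_derivative D x) (at x)" "\<And>b. (\<lambda>x. D x b) \<in> tame"
    "\<And>x. (g has_derivative E x) (at x)" "\<And>b. (\<lambda>x. E x b) \<in> tame" by blast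
  then show ?case
    by (intro exI[of _ "\<lambda>x h. D x h + E x h"]) (auto intro!: tame.intros derivative_intros)
next
  case (mult f g)
  then obtain D E where "\<And>x. (f has_derivative D x) (at x)" "\<And>b. (\<lambda>x. D x b) \<in> tame"
    "\<And>x. (g has_derivative E x) (at x)" "\<And>b. (\<lambda>x. E x b) \<in> tame" by blast
  with mult show ?case
    by (intro exI[of _ "\<lambda>x h. f x * E x h + D x h * g x"]) (auto intro!: tame.intros derivative_intros)
qed

lemma tame_bound:
  assumes "f \<in> tame"
  shows "\<exists>k C. \<forall>x. norm (f x) \<le> C * (1 + norm x) ^ k"
  using assms
proof induction
  case (const c)
  show ?case by (intro exI[of _ 0] exI[of _ "norm c"]) simp
next
  case (inner v)
  have "norm (of_real (x \<bullet> v) :: complex) \<le> norm v * (1 + norm x) ^ 1" for x :: 'a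
    using Cauchy_Schwarz_ineq2[of x v] by (simp add: algebra_simps) (smt (verit) norm_ge_zero)
  then show ?case by blast
next
  case (powr a)
  obtain n :: nat where n: "a \<le> real n" using real_arch_simple by blast
  have "norm (of_real ((1 + (norm x)\<^sup>2) powr a) :: complex) \<le> 1 * (1 + norm x) ^ (2 * n)" for x :: 'a
  proof -
    have "(1 + (norm x)\<^sup>2) powr a \<le> (1 + (norm x)\<^sup>2) powr n"
      using n by (intro powr_mono) auto
    also have "\<dots> = (1 + (norm x)\<^sup>2) ^ n"
      by (rule powr_realpow) (smt (verit) zero_le_power2)
    also have "\<dots> \<le> ((1 + norm x)\<^sup>2) ^ n"
      by (intro power_mono) (auto simp: power2_eq_square algebra_simps)
    finally show ?thesis by (simp add: power_mult)
  qed
  then show ?case by blast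
next
  case (gauss c y)
  then show ?case by (intro exI[of _ 0] exI[of _ 1]) auto
next
  case (add f g)
  then obtain k C l D where *: "\<And>x. norm (f x) \<le> C * (1 + norm x) ^ k" "\<And>x. norm (g x) \<le> D * (1 + norm x) ^ l"
    by blast
  have "norm (f x + g x) \<le> (\<bar>C\<bar> + \<bar>D\<bar>) * (1 + norm x) ^ (k + l)" for x
  proof -
    have "C * (1 + norm x) ^ k \<le> \<bar>C\<bar> * (1 + norm x) ^ (k + l)" "D * (1 + norm x) ^ l \<le> \<bar>D\<bar> * (1 + norm x) ^ (k + l)"
      by (intro mult_mono power_increasing; simp)+
    then show ?thesis
      using *[of x] norm_triangle_ineq[of "f x" "g x"] by (simp add: algebra_simps)
  qed
  then show ?case by blast
next
  case (mult f g)
  then obtain k C l D where *: "\<And>x. norm (f x) \<le> C * (1 + norm x) ^ k" "\<And>x. norm (g x) \<le> D * (1 + norm x) ^ l"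
    by blast
  have "norm (f x * g x) \<le> (C * D) * (1 + norm x) ^ (k + l)" for x
    using mult_mono[OF *(1)[of x] *(2)[of x]] order_trans[OF norm_ge_zero *(1)[of x]]
    by (simp add: norm_mult power_add algebra_simps)
  then show ?case by blast
qed

text \<open>Products \<open>m x * f x\<close> alone are not visibly closed under differentiation,
  since the product rule yields a sum of two of them. Finite sums are, as
  \<open>schwartz_coinduct\<close> requires.\<close>

inductive_set tame_span :: "('a::euclidean_space \<Rightarrow> complex) set \<Rightarrow> ('a \<Rightarrow> complex) set" for S where
  mult: "m \<in> tame \<Longrightarrow> f \<in> S \<Longrightarrow> (\<lambda>x. m x * f x) \<in> tame_span S"
| add: "f \<in> tame_span S \<Longrightarrow> g \<in> tame_span S \<Longrightarrow> (\<lambda>x. f x + g x) \<in> tame_span S"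

lemma tame_span_schwartz: "tame_span schwartz \<subseteq> schwartz"
proof (rule schwartz_coinduct)
  fix w :: "'a \<Rightarrow> complex" assume "w \<in> tame_span schwartz"
  then show "\<exists>D. (\<forall>x. (w has_derivative D x) (at x)) \<and> (\<forall>b\<in>Basis. (\<lambda>x. D x b) \<in> tame_span schwartz)"
  proof induction
    case (mult m f)
    obtain D where D: "\<And>x. (m has_derivative D x) (at x)" "\<And>b. (\<lambda>x. D x b) \<in> tame"
      using tame_derivative[OF mult(1)] by blast
    show ?case
      by (intro exI[of _ "\<lambda>x h. m x * frechet_derivative f (at x) h + D x h * f x"] conjI allI ballI)
         (auto intro!: tame_span.intros derivative_intros D schwartz_has_derivative mult schwartz_partial)
  next
    case (add f g)
    then obtain D E where "\<And>x. (f has_derivative D x) (at x)" "\<forall>b\<in>Basis. (\<lambda>x. D x b) \<in> tame_span schwartz"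
      "\<And>x. (g has_derivative E x) (at x)" "\<forall>b\<in>Basis. (\<lambda>x. E x b) \<in> tame_span schwartz" by blast
    then show ?case
      by (intro exI[of _ "\<lambda>x h. D x h + E x h"]) (auto intro!: tame_span.intros derivative_intros)
  qed
next
  fix w :: "'a \<Rightarrow> complex" and k assume "w \<in> tame_span schwartz"
  then show "\<exists>C. \<forall>x. (1 + norm x) ^ k * norm (w x) \<le> C"
  proof induction
    case (mult m f)
    obtain l C where C: "\<And>x. norm (m x) \<le> C * (1 + norm x) ^ l" using tame_bound[OF mult(1)] by blast
    \<comment> \<open>The growth of order \<open>l\<close> of the multiplier is paid for by asking
      \<open>f\<close> for \<open>l\<close> extra powers of decay.\<close>
    obtain D where D: "\<And>x. (1 + norm x) ^ (l + k) * norm (f x) \<le> D"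
      using schwartz_decay[OF mult(2)] by blast
    have "0 \<le> C" using order_trans[OF norm_ge_zero C[of 0]] by simp
    have "(1 + norm x) ^ k * norm (m x * f x) \<le> C * D" for x
    proof -
      have "(1 + norm x) ^ k * norm (m x * f x) \<le> (1 + norm x) ^ k * ((C * (1 + norm x) ^ l) * norm (f x))"
        unfolding norm_mult by (intro mult_left_mono mult_right_mono C) auto
      also have "\<dots> = C * ((1 + norm x) ^ (l + k) * norm (f x))" by (simp add: power_add algebra_simps)
      also have "\<dots> \<le> C * D" by (intro mult_left_mono D \<open>0 \<le> C\<close>)
      finally show ?thesis .
    qed
    then show ?case by blast
  next
    case (add f g)
    then obtain C D where CD: "\<And>x. (1 + norm x) ^ k * norm (f x) \<le> C" "\<And>x. (1 + norm x) ^ k * norm (g x) \<le> D"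
      by blast
    have "(1 + norm x) ^ k * norm (f x + g x) \<le> C + D" for x
    proof -
      have "(1 + norm x) ^ k * norm (f x + g x) \<le> (1 + norm x) ^ k * (norm (f x) + norm (g x))"
        by (intro mult_left_mono norm_triangle_ineq) auto
      with CD[of x] show ?thesis by (simp add: algebra_simps)
    qed
    then show ?case by blast
  qed
qed

section \<open>Closure properties of the Schwartz space and the Gaussian\<close>

lemma schwartz_tame_mult: "m \<in> tame \<Longrightarrow> f \<in> schwartz \<Longrightarrow> (\<lambda>x. m x * f x) \<in> schwartz"
  using tame_span_schwartz tame_span.mult by blast

lemma schwartz_cmult: "f \<in> schwartz \<Longrightarrow> (\<lambda>x. c * f x) \<in> schwartz"
  by (intro schwartz_tame_mult tame.const)

lemma schwartz_add: 
  assumes "f \<in> schwartz" "g \<in> schwartz"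
  shows "(\<lambda>x. f x + g x) \<in> schwartz"
proof -
  have "(\<lambda>x. 1 * f x + 1 * g x) \<in> tame_span schwartz"
    using assms by (intro tame_span.intros tame.const)
  then show ?thesis using tame_span_schwartz by auto
qed

lemma schwartz_diff: "f \<in> schwartz \<Longrightarrow> g \<in> schwartz \<Longrightarrow> (\<lambda>x. f x - g x) \<in> schwartz"
  using schwartz_add[of f, OF _ schwartz_cmult[of g "-1"]] by simp

lemma schwartz_reflect:
  assumes "f \<in> schwartz"
  shows "(\<lambda>x. f (- x)) \<in> schwartz"
proof -
  have "{\<lambda>x::'a. f (- x) | f. f \<in> schwartz} \<subseteq> schwartz"
  proof (rule schwartz_coinduct, safe)
    fix f :: "'a \<Rightarrow> complex" assume f: "f \<in> schwartz"
    have "((\<lambda>x. f (- x)) has_derivative (\<lambda>h. frechet_derivative f (at (- x)) (- h))) (at x)" for x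
      by (rule has_derivative_compose[of uminus uminus])
         (auto intro!: derivative_eq_intros schwartz_has_derivative f)
    \<comment> \<open>The sign from the chain rule is absorbed: the derivative of the reflected
      function is the reflection of \<open>- 1\<close> times a partial derivative, so it stays in
      the family.\<close>
    moreover have "frechet_derivative f (at (- x)) (- b) = - 1 * frechet_derivative f (at (- x)) b" for x b
      using linear_neg[OF has_derivative_linear[OF schwartz_has_derivative[OF f]]] by simp
    moreover have "(\<lambda>x. - 1 * frechet_derivative f (at x) b) \<in> schwartz" if "b \<in> Basis" for b
      by (intro schwartz_cmult schwartz_partial f that)
    ultimately show "\<exists>D. (\<forall>x. ((\<lambda>x. f (- x)) has_derivative D x) (at x)) \<and>
        (\<forall>b\<in>Basis. (\<lambda>x. D x b) \<in> {\<lambda>x. f (- x) | f. f \<in> schwartz})"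
      by (intro exI[of _ "\<lambda>x h. frechet_derivative f (at (- x)) (- h)"]) force
    fix k
    show "\<exists>C. \<forall>x. (1 + norm x) ^ k * norm (f (- x)) \<le> C"
      by (metis schwartz_decay[OF f] norm_minus_cancel)
  qed
  with assms show ?thesis by blast
qed

text \<open>\<open>schwartz_tame_mult\<close> cannot give this, because it presupposes a Schwartz
  factor. The coinductive family consists of all tame multiples of the Gaussian; differentiating the
  Gaussian only produces another linear factor.\<close>

lemma schwartz_gaussian: "(\<lambda>x. of_real (exp (- (norm x)\<^sup>2))) \<in> schwartz"
proof -
  let ?G = "\<lambda>x::'a. of_real (exp (- (norm x)\<^sup>2)) :: complex"
  have "{\<lambda>x. m x * ?G x | m. m \<in> tame} \<subseteq> schwartz"
  proof (rule schwartz_coinduct, safe)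
    fix m :: "'a \<Rightarrow> complex" assume m: "m \<in> tame"
    have G: "?G \<in> tame" using tame.gauss[of 1 0] by simp
    obtain D where D: "\<And>x. (m has_derivative D x) (at x)" "\<And>b. (\<lambda>x. D x b) \<in> tame"
      using tame_derivative[OF m] by blast
    have "(?G has_derivative (\<lambda>h. of_real (2 * (x \<bullet> h)) * (- ?G x))) (at x)" for x
      using has_derivative_norm_power2[of 0 x UNIV]
      by (intro has_derivative_eq_rhs[OF has_derivative_of_real[OF DERIV_compose_FDERIV[of "\<lambda>u. exp (- u)"]]])
         (auto intro!: derivative_eq_intros)
    then have "((\<lambda>x. m x * ?G x) has_derivative (\<lambda>h. m x * (of_real (2 * (x \<bullet> h)) * (- ?G x)) + D x h * ?G x)) (at x)" for x
      by (intro has_derivative_mult D)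
    moreover have "(\<lambda>x. m x * (of_real (2 * (x \<bullet> b)) * (- ?G x)) + D x b * ?G x) \<in> {\<lambda>x. m x * ?G x | m. m \<in> tame}" for b
    proof -
      have "(\<lambda>x. (- 2) * (m x * of_real (x \<bullet> b)) + D x b) \<in> tame"
        by (intro tame.intros D m)
      then show ?thesis by (force simp: algebra_simps)
    qed
    ultimately show "\<exists>E. (\<forall>x. ((\<lambda>x. m x * ?G x) has_derivative E x) (at x)) \<and>
        (\<forall>b\<in>Basis. (\<lambda>x. E x b) \<in> {\<lambda>x. m x * ?G x | m. m \<in> tame})"
      by (intro exI[of _ "\<lambda>x h. m x * (of_real (2 * (x \<bullet> h)) * (- ?G x)) + D x h * ?G x"] conjI allI ballI)
    fix k
    obtain l C where C: "\<And>x. norm (m x) \<le> C * (1 + norm x) ^ l" using tame_bound[OF m] by blast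
    have "0 \<le> C" using order_trans[OF norm_ge_zero C[of 0]] by simp
    have "(1 + norm x) ^ k * norm (m x * ?G x) \<le> C * (2 ^ (l + k) * (fact (l + k) * exp 1))" for x
    proof -
      let ?y = "1 + (norm x)\<^sup>2"
      have "1 + norm x \<le> 2 * ?y"
      proof -
        have "0 \<le> (norm x - 1)\<^sup>2" by simp
        then have "2 * norm x \<le> 1 + (norm x)\<^sup>2" by (simp add: power2_diff)
        then show ?thesis using zero_le_power2[of "norm x"] by argo
      qed
      then have "(1 + norm x) ^ (l + k) \<le> (2 * ?y) ^ (l + k)"
        by (intro power_mono) auto
      also have "\<dots> = 2 ^ (l + k) * ?y ^ (l + k)" by (rule power_mult_distrib)
      \<comment> \<open>A single term of the exponential series is at most its sum.\<close>
      also have "?y ^ (l + k) \<le> fact (l + k) * exp ?y"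
      proof -
        have "?y ^ (l + k) / fact (l + k) \<le> exp ?y"
          using sum_le_suminf[OF summable_exp_generic[of ?y], of "{l + k}"]
          by (simp add: exp_def divide_inverse mult.commute)
        then show ?thesis by (simp add: field_simps)
      qed
      finally have *: "(1 + norm x) ^ (l + k) \<le> 2 ^ (l + k) * (fact (l + k) * exp ?y)"
        by simp
      have "(1 + norm x) ^ k * norm (m x * ?G x) \<le> (1 + norm x) ^ k * ((C * (1 + norm x) ^ l) * exp (- (norm x)\<^sup>2))"
        unfolding norm_mult by (intro mult_mono C) (auto intro: mult_nonneg_nonneg simp: \<open>0 \<le> C\<close>)
      also have "\<dots> = C * ((1 + norm x) ^ (l + k) * exp (- (norm x)\<^sup>2))" by (simp add: power_add algebra_simps)
      also have "\<dots> \<le> C * (2 ^ (l + k) * (fact (l + k) * exp ?y) * exp (- (norm x)\<^sup>2))"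
        by (intro mult_left_mono mult_right_mono * \<open>0 \<le> C\<close>) auto
      also have "exp ?y * exp (- (norm x)\<^sup>2) = exp 1" by (simp flip: exp_add)
      then have "2 ^ (l + k) * (fact (l + k) * exp ?y) * exp (- (norm x)\<^sup>2) = 2 ^ (l + k) * (fact (l + k) * exp 1)"
        by (simp add: mult.assoc)
      finally show ?thesis .
    qed
    then show "\<exists>C. \<forall>x. (1 + norm x) ^ k * norm (m x * ?G x) \<le> C" by blast
  qed
  moreover have "(\<lambda>x. 1 * ?G x) \<in> {\<lambda>x. m x * ?G x | m. m \<in> tame}"
    by (intro CollectI exI[of _ "\<lambda>x. 1"] conjI refl tame.const)
  ultimately show ?thesis by auto
qed

subsection \<open>Integration on Euclidean space\<close>

lemma lborel_nn_integral_affine: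
  fixes f :: "'a::euclidean_space \<Rightarrow> ennreal"
  assumes "c \<noteq> 0" and [measurable]: "f \<in> borel_measurable borel"
  shows "(\<integral>\<^sup>+ x. f x \<partial>lborel) = ennreal (\<bar>c\<bar> ^ DIM('a)) * (\<integral>\<^sup>+ x. f (t + c *\<^sub>R x) \<partial>lborel)"
proof -
  have "(\<integral>\<^sup>+ x. f x \<partial>lborel) = (\<integral>\<^sup>+ x. f x \<partial>density (distr lborel borel (\<lambda>x. t + c *\<^sub>R x)) (\<lambda>_. \<bar>c\<bar> ^ DIM('a)))"
    using lborel_affine[OF assms(1), of t] by simp
  also have "\<dots> = ennreal (\<bar>c\<bar> ^ DIM('a)) * (\<integral>\<^sup>+ x. f (t + c *\<^sub>R x) \<partial>lborel)"
    by (subst nn_integral_density) (auto simp: nn_integral_distr nn_integral_cmult)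
  finally show ?thesis .
qed

lemma lborel_integral_affine:
  fixes f :: "'a::euclidean_space \<Rightarrow> 'b::{banach, second_countable_topology}"
  assumes "c \<noteq> 0" and [measurable]: "f \<in> borel_measurable borel"
  shows "(\<integral>x. f x \<partial>lborel) = \<bar>c\<bar> ^ DIM('a) *\<^sub>R (\<integral>x. f (t + c *\<^sub>R x) \<partial>lborel)"
proof -
  have "(\<integral>x. f x \<partial>lborel) = (\<integral>x. f x \<partial>density (distr lborel borel (\<lambda>x. t + c *\<^sub>R x)) (\<lambda>_. \<bar>c\<bar> ^ DIM('a)))"
    using lborel_affine[OF assms(1), of t] by simp
  also have "\<dots> = \<bar>c\<bar> ^ DIM('a) *\<^sub>R (\<integral>x. f (t + c *\<^sub>R x) \<partial>lborel)"
    by (subst integral_density) (auto simp: integral_distr)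
  finally show ?thesis .
qed

lemma lborel_integrable_affine:
  fixes f :: "'a::euclidean_space \<Rightarrow> 'b::{banach, second_countable_topology}"
  assumes "c \<noteq> 0" "integrable lborel f"
  shows "integrable lborel (\<lambda>x. f (t + c *\<^sub>R x))"
proof -
  have [measurable]: "f \<in> borel_measurable borel" using assms(2) by auto
  have "integrable (density (distr lborel borel (\<lambda>x. t + c *\<^sub>R x)) (\<lambda>_. \<bar>c\<bar> ^ DIM('a))) f"
    using lborel_affine[OF assms(1), of t] assms(2) by simp
  then have "integrable lborel (\<lambda>x. \<bar>c\<bar> ^ DIM('a) *\<^sub>R f (t + c *\<^sub>R x))"
    by (subst (asm) integrable_density) (auto simp: integrable_distr_eq)
  then have "integrable lborel (\<lambda>x. inverse (\<bar>c\<bar> ^ DIM('a)) *\<^sub>R \<bar>c\<bar> ^ DIM('a) *\<^sub>R f (t + c *\<^sub>R x))"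
    by (rule integrable_scaleR_right)
  moreover have "inverse (\<bar>c\<bar> ^ DIM('a)) * \<bar>c\<bar> ^ DIM('a) = 1"
    using assms(1) by simp
  ultimately show ?thesis by (simp only: scaleR_scaleR scaleR_one)
qed

lemma borel_measurable_lborel_pair:
  "f \<in> borel_measurable (lborel \<Otimes>\<^sub>M lborel) \<longleftrightarrow> f \<in> borel_measurable (borel \<Otimes>\<^sub>M borel)"
  by (intro arg_cong2[where f="(\<in>)"] refl measurable_cong_sets sets_pair_measure_cong) auto

lemma lborel_Fubini_nn_integral:
  assumes "case_prod f \<in> borel_measurable (borel \<Otimes>\<^sub>M borel)"
  shows "(\<integral>\<^sup>+ x. \<integral>\<^sup>+ y. f x y \<partial>lborel \<partial>lborel) = (\<integral>\<^sup>+ y. \<integral>\<^sup>+ x. f x y \<partial>lborel \<partial>lborel)"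
  using assms by (intro lborel_pair.Fubini'[symmetric]) (simp add: borel_measurable_lborel_pair)

text \<open>Fatou's lemma in the form that removes every cut-off below: the damping in Plancherel,
  the balls in the duality argument, the truncations in the extension to L^p.\<close>

lemma nn_integral_lim_le:
  fixes F :: "nat \<Rightarrow> 'a \<Rightarrow> ennreal"
  assumes [measurable]: "\<And>n. F n \<in> borel_measurable M"
    and lim: "AE x in M. (\<lambda>n. F n x) \<longlonglongrightarrow> G x"
    and le: "\<And>n. (\<integral>\<^sup>+ x. F n x \<partial>M) \<le> C"
  shows "(\<integral>\<^sup>+ x. G x \<partial>M) \<le> C"
proof -
  have "(\<integral>\<^sup>+ x. G x \<partial>M) = (\<integral>\<^sup>+ x. liminf (\<lambda>n. F n x) \<partial>M)"
    using lim by (intro nn_integral_cong_AE) (auto elim!: eventually_mono dest: lim_imp_Liminf[rotated])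
  also have "\<dots> \<le> liminf (\<lambda>n. \<integral>\<^sup>+ x. F n x \<partial>M)"
    by (intro nn_integral_liminf) auto
  also have "\<dots> \<le> limsup (\<lambda>n. \<integral>\<^sup>+ x. F n x \<partial>M)"
    by (intro Liminf_le_Limsup) auto
  also have "\<dots> \<le> C"
    by (intro Limsup_bounded) (auto intro: le always_eventually)
  finally show ?thesis .
qed

subsection \<open>The weight\<close>

text \<open>The weight w of the overview. The exponent d/2 makes the volume of its sublevel sets
  grow at most linearly in the level.\<close>

definition wt :: "'a::euclidean_space \<Rightarrow> real" where
  "wt x = (1 + (norm x)\<^sup>2) powr (DIM('a) / 2)"

lemma wt_ge_1: "1 \<le> wt x"
  unfolding wt_def by (intro ge_one_powr_ge_zero) auto

lemma wt_pos: "0 < wt x"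
  using wt_ge_1[of x] by linarith

lemma wt_measurable [measurable]: "wt \<in> borel_measurable borel"
  unfolding wt_def[abs_def] by measurable

text \<open>A value at most \<open>r\<close> confines x to the ball of radius r^(1/d), whose volume
  is that of the unit ball times \<open>r\<close>.\<close>

lemma emeasure_wt_le:
  assumes "0 \<le> r"
  shows "emeasure lborel {x::'a::euclidean_space. wt x \<le> r} \<le> ennreal (unit_ball_vol DIM('a) * r)"
proof -
  let ?d = "real DIM('a)"
  have d: "0 < ?d" by simp
  have "norm x \<le> r powr (1 / ?d)" if "wt x \<le> r" for x :: 'a
  proof -
    have "norm x = ((norm x)\<^sup>2) powr (1 / 2)"
      by (simp add: powr_half_sqrt)
    also have "\<dots> \<le> (1 + (norm x)\<^sup>2) powr (1 / 2)"
      by (intro powr_mono2) auto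
    also have "\<dots> = wt x powr (1 / ?d)"
      using d by (simp add: wt_def powr_powr)
    also have "\<dots> \<le> r powr (1 / ?d)"
      using that wt_pos[of x] by (intro powr_mono2) auto
    finally show ?thesis .
  qed
  then have "emeasure lborel {x::'a. wt x \<le> r} \<le> emeasure lborel (cball (0::'a) (r powr (1 / ?d)))"
    by (intro emeasure_mono) auto
  also have "\<dots> = ennreal (unit_ball_vol ?d * (r powr (1 / ?d)) ^ DIM('a))"
    by (rule emeasure_cball) simp
  also have "(r powr (1 / ?d)) ^ DIM('a) = r"
    using assms d by (cases "r = 0") (auto simp: powr_powr simp flip: powr_realpow)
  finally show ?thesis .
qed

lemma nn_integral_powr_to_inf:
  assumes "e < -1" "a > 0"
  shows "(\<integral>\<^sup>+ x. indicator {a..} x * ennreal (x powr e) \<partial>lborel) = ennreal (- (a powr (e + 1) / (e + 1)))"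
  using nn_integral_has_integral_lebesgue[OF _ has_integral_powr_to_inf[OF assms]]
  by (simp add: ennreal_mult' ennreal_indicator flip: minus_divide_right)

lemma nn_integral_powr_from_0:
  assumes "e > -1" "a \<ge> 0"
  shows "(\<integral>\<^sup>+ x. indicator {0..a} x * ennreal (x powr e) \<partial>lborel) = ennreal (a powr (e + 1) / (e + 1))"
  using nn_integral_has_integral_lebesgue[OF _ has_integral_powr_from_0[OF assms]]
  by (simp add: ennreal_mult' ennreal_indicator)

text \<open>Layer cake: w^(-2) is the integral of 2 r^(-3) over r >= w. After Tonelli, each r >= t
  contributes 2 r^(-3) times the volume of {w <= r}, hence at most 2 V r^(-2), where V is the volume
  of the unit ball; this integrates to 2 V / t.\<close>

lemma wt_tail:
  assumes "t > 0"
  shows "(\<integral>\<^sup>+ x. indicator {x. t < wt x} x * ennreal (wt x powr - 2) \<partial>(lborel :: 'a::euclidean_space measure))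
     \<le> ennreal (2 * unit_ball_vol DIM('a) / t)"
proof -
  let ?V = "unit_ball_vol DIM('a)"
  have V: "0 \<le> ?V" by simp
  have "(\<integral>\<^sup>+ x. indicator {x. t < wt x} x * ennreal (wt x powr - 2) \<partial>(lborel :: 'a measure)) =
     (\<integral>\<^sup>+ x. \<integral>\<^sup>+ r. indicator {t<..} (wt x) * (indicator {wt x..} r * ennreal (2 * r powr - 3)) \<partial>lborel \<partial>(lborel :: 'a measure))"
  proof (intro nn_integral_cong)
    fix x :: 'a
    have "(\<integral>\<^sup>+ r. indicator {wt x..} r * ennreal (2 * r powr - 3) \<partial>lborel)
      = 2 * (\<integral>\<^sup>+ r. indicator {wt x..} r * ennreal (r powr - 3) \<partial>lborel)"
      by (subst nn_integral_cmult[symmetric]) (auto simp: ennreal_mult mult_ac)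
    also have "\<dots> = 2 * ennreal (wt x powr - 2 / 2)"
      using nn_integral_powr_to_inf[of "-3" "wt x"] wt_pos[of x] by simp
    also have "\<dots> = ennreal (wt x powr - 2)"
      by (simp add: ennreal_mult[symmetric] flip: ennreal_numeral)
    finally show "indicator {x. t < wt x} x * ennreal (wt x powr - 2) =
      (\<integral>\<^sup>+ r. indicator {t<..} (wt x) * (indicator {wt x..} r * ennreal (2 * r powr - 3)) \<partial>lborel)"
      by (subst nn_integral_cmult) (auto simp: indicator_def)
  qed
  also have "\<dots> = (\<integral>\<^sup>+ r. \<integral>\<^sup>+ x. indicator {t<..} (wt x) * (indicator {wt x..} r * ennreal (2 * r powr - 3)) \<partial>(lborel :: 'a measure) \<partial>lborel)"
    by (rule lborel_Fubini_nn_integral) (unfold indicator_def atLeast_iff, measurable)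
  also have "\<dots> \<le> (\<integral>\<^sup>+ r. indicator {t..} r * ennreal (2 * ?V * r powr - 2) \<partial>lborel)"
  proof (intro nn_integral_mono)
    fix r :: real
    have "(\<integral>\<^sup>+ x. indicator {t<..} (wt x) * (indicator {wt x..} r * ennreal (2 * r powr - 3)) \<partial>(lborel :: 'a measure))
       \<le> (\<integral>\<^sup>+ x. (indicator {t..} r * ennreal (2 * r powr - 3)) * indicator {x. wt x \<le> r} x \<partial>(lborel :: 'a measure))"
      by (intro nn_integral_mono) (auto simp: indicator_def)
    also have "\<dots> = indicator {t..} r * ennreal (2 * r powr - 3) * emeasure lborel {x::'a. wt x \<le> r}"
      by (subst nn_integral_cmult_indicator) auto
    also have "\<dots> \<le> indicator {t..} r * ennreal (2 * ?V * r powr - 2)"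
    proof (cases "t \<le> r")
      case True
      then have r: "0 < r" using assms by simp
      have "ennreal (2 * r powr - 3) * emeasure lborel {x::'a. wt x \<le> r} \<le> ennreal (2 * r powr - 3) * ennreal (?V * r)"
        using r by (intro mult_left_mono emeasure_wt_le) auto
      also have "\<dots> = ennreal (2 * r powr - 3 * (?V * r))"
        using r V by (simp add: ennreal_mult')
      also have "2 * r powr - 3 * (?V * r) = 2 * ?V * (r powr - 3 * r powr 1)"
        using r by simp
      also have "\<dots> = 2 * ?V * r powr - 2"
        by (subst powr_add[symmetric]) simp
      finally show ?thesis using True by simp
    qed simp
    finally show "(\<integral>\<^sup>+ x. indicator {t<..} (wt x) * (indicator {wt x..} r * ennreal (2 * r powr - 3)) \<partial>(lborel :: 'a measure))
      \<le> indicator {t..} r * ennreal (2 * ?V * r powr - 2)" .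
  qed
  also have "\<dots> = ennreal (2 * ?V) * (\<integral>\<^sup>+ r. indicator {t..} r * ennreal (r powr - 2) \<partial>lborel)"
    using V by (subst nn_integral_cmult[symmetric]) (auto simp: ennreal_mult mult_ac)
  also have "\<dots> = ennreal (2 * ?V) * ennreal (t powr - 1)"
    using nn_integral_powr_to_inf[of "-2" t] assms by simp
  also have "\<dots> = ennreal (2 * ?V / t)"
    using V assms by (simp add: ennreal_mult'[symmetric] powr_minus_divide)
  finally show ?thesis .
qed

text \<open>The level 1/2 lies strictly below the lower bound 1 of \<open>wt\<close>, so the tail
  estimate already covers the whole space. The function is the common integrable majorant for
  Schwartz functions.\<close>

lemma integrable_wt: "integrable lborel (\<lambda>x::'a::euclidean_space. wt x powr - 2)"
proof (rule integrableI_bounded)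
  have "(\<integral>\<^sup>+ x. ennreal (norm (wt x powr - 2)) \<partial>(lborel :: 'a measure)) =
    (\<integral>\<^sup>+ x. indicator {x. 1 / 2 < wt x} x * ennreal (wt x powr - 2) \<partial>(lborel :: 'a measure))"
  proof (intro nn_integral_cong)
    fix x :: 'a
    show "ennreal (norm (wt x powr - 2)) = indicator {x. 1 / 2 < wt x} x * ennreal (wt x powr - 2)"
      using wt_ge_1[of x] by simp
  qed
  also have "\<dots> \<le> ennreal (2 * unit_ball_vol DIM('a) / (1 / 2))"
    by (rule wt_tail) simp
  also have "\<dots> < \<infinity>" by simp
  finally show "(\<integral>\<^sup>+ x. ennreal (norm (wt x powr - 2)) \<partial>(lborel :: 'a measure)) < \<infinity>" .
qed measurable

lemma wt_le_power: "wt (x::'a::euclidean_space) powr 2 \<le> (1 + norm x) ^ (2 * DIM('a))"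
proof -
  have "wt x powr 2 = (1 + (norm x)\<^sup>2) powr DIM('a)"
    unfolding wt_def powr_powr by simp
  also have "\<dots> = (1 + (norm x)\<^sup>2) ^ DIM('a)"
    by (rule powr_realpow) (smt (verit) zero_le_power2)
  also have "\<dots> \<le> ((1 + norm x)\<^sup>2) ^ DIM('a)"
    by (intro power_mono) (auto simp: power2_eq_square algebra_simps)
  finally show ?thesis by (simp add: power_mult)
qed

text \<open>Converts decay of order 2d, as the seminorms measure it, into domination by the
  integrable function w^(-2).\<close>

lemma decay_imp_le_wt:
  fixes x :: "'a::euclidean_space"
  assumes "(1 + norm x) ^ (2 * DIM('a)) * r \<le> C" "0 \<le> r"
  shows "r \<le> C * wt x powr - 2"
proof -
  have "wt x powr 2 * r \<le> C"
    using mult_right_mono[OF wt_le_power[of x] assms(2)] assms(1) by linarith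
  then show ?thesis
    using wt_pos[of x] by (simp add: powr_minus divide_simps mult_ac)
qed

section \<open>Bounded kernels and Fubini\<close>

lemma norm_cis_mult [simp]: "norm (cis a * z) = norm z" "norm (z * cis a) = norm z"
  by (simp_all add: norm_mult)

lemma measurable_cis [measurable]: "cis \<in> borel_measurable borel"
  by (intro borel_measurable_continuous_onI continuous_intros)

lemma integrable_mult_bounded:
  fixes f g :: "'a::euclidean_space \<Rightarrow> 'b::{real_normed_algebra, banach, second_countable_topology}"
  assumes f: "integrable lborel f" and [measurable]: "g \<in> borel_measurable borel" and g: "\<And>x. norm (g x) \<le> C"
  shows "integrable lborel (\<lambda>x. g x * f x)" "integrable lborel (\<lambda>x. f x * g x)"
proof -
  have [measurable]: "f \<in> borel_measurable borel" using f by auto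
  have int: "integrable lborel (\<lambda>x. C * norm (f x))" using f by auto
  have C: "norm (g x) * norm (f x) \<le> C * norm (f x)" for x
    by (rule mult_right_mono[OF g norm_ge_zero])
  have "norm (g x * f x) \<le> norm (C * norm (f x))" "norm (f x * g x) \<le> norm (C * norm (f x))" for x
    using C[of x] norm_mult_ineq[of "g x" "f x"] norm_mult_ineq[of "f x" "g x"]
    unfolding real_norm_def mult.commute[of "norm (f x)"] by linarith+
  then show "integrable lborel (\<lambda>x. g x * f x)" "integrable lborel (\<lambda>x. f x * g x)"
    by (intro Bochner_Integration.integrable_bound[OF int] AE_I2; measurable)+
qed

lemma lborel_integrable_prod:
  fixes f :: "'a::euclidean_space \<Rightarrow> complex" and g :: "'b::euclidean_space \<Rightarrow> complex"
  assumes f: "integrable lborel f" and g: "integrable lborel g"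
    and k: "case_prod k \<in> borel_measurable (borel \<Otimes>\<^sub>M borel)" "\<And>x y. norm (k x y) \<le> 1"
  shows "integrable (lborel \<Otimes>\<^sub>M lborel) (\<lambda>(x, y). f x * g y * k x y)"
proof (rule integrableI_bounded)
  have [measurable]: "f \<in> borel_measurable borel" "g \<in> borel_measurable borel" using f g by auto
  note k(1)[measurable]
  have "(\<lambda>(x, y). f x * g y * k x y) \<in> borel_measurable (borel \<Otimes>\<^sub>M borel)"
    by measurable
  then show "(\<lambda>(x, y). f x * g y * k x y) \<in> borel_measurable (lborel \<Otimes>\<^sub>M lborel)"
    by (simp add: borel_measurable_lborel_pair)
  have "(\<integral>\<^sup>+ z. ennreal (norm (case z of (x, y) \<Rightarrow> f x * g y * k x y)) \<partial>(lborel \<Otimes>\<^sub>M lborel))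
    \<le> (\<integral>\<^sup>+ z. (case z of (x, y) \<Rightarrow> ennreal (norm (f x)) * ennreal (norm (g y))) \<partial>(lborel \<Otimes>\<^sub>M lborel))"
    using mult_left_mono[OF k(2)]
    by (intro nn_integral_mono) (auto simp: norm_mult mult_le_cancel_left1 simp flip: ennreal_mult intro!: ennreal_leI mult_left_le)
  also have "\<dots> = (\<integral>\<^sup>+ x. \<integral>\<^sup>+ y. ennreal (norm (f x)) * ennreal (norm (g y)) \<partial>lborel \<partial>lborel)"
    by (subst lborel.nn_integral_fst[symmetric]) (auto simp: borel_measurable_lborel_pair)
  also have "\<dots> = (\<integral>\<^sup>+ x. ennreal (norm (f x)) \<partial>lborel) * (\<integral>\<^sup>+ y. ennreal (norm (g y)) \<partial>lborel)"
    by (simp add: nn_integral_cmult nn_integral_multc)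
  also have "\<dots> < \<infinity>"
    using f g by (simp add: integrable_iff_bounded ennreal_mult_less_top)
  finally show "(\<integral>\<^sup>+ z. ennreal (norm (case z of (x, y) \<Rightarrow> f x * g y * k x y)) \<partial>(lborel \<Otimes>\<^sub>M lborel)) < \<infinity>" .
qed

text \<open>Serves two kernels: the exponential, for the multiplication formula, and an unnormalised
  Gaussian, for the uniqueness of distributions.\<close>

lemma lborel_Fubini_prod:
  fixes f :: "'a::euclidean_space \<Rightarrow> complex" and g :: "'b::euclidean_space \<Rightarrow> complex"
  assumes "integrable lborel f" "integrable lborel g"
    and "case_prod k \<in> borel_measurable (borel \<Otimes>\<^sub>M borel)" "\<And>x y. norm (k x y) \<le> 1"
  shows "(\<integral>x. f x * (\<integral>y. g y * k x y \<partial>lborel) \<partial>lborel) = (\<integral>y. (\<integral>x. f x * k x y \<partial>lborel) * g y \<partial>lborel)"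
proof -
  have "(\<integral>x. f x * (\<integral>y. g y * k x y \<partial>lborel) \<partial>lborel) = (\<integral>x. (\<integral>y. f x * g y * k x y \<partial>lborel) \<partial>lborel)"
    by (simp add: mult.assoc)
  also have "\<dots> = (\<integral>y. (\<integral>x. f x * g y * k x y \<partial>lborel) \<partial>lborel)"
    by (rule lborel_pair.Fubini_integral[symmetric]) (rule lborel_integrable_prod[OF assms])
  also have "\<dots> = (\<integral>y. (\<integral>x. f x * k x y * g y \<partial>lborel) \<partial>lborel)"
    by (simp add: mult_ac)
  finally show ?thesis by simp
qed

subsection \<open>The Fourier transform of integrable functions\<close>

text \<open>The definition integrates over the completed measure, whereas the Fubini arguments run
  over \<open>lborel\<close>; for Borel functions the two integrals agree.\<close>

lemma fourier_lborel:
  assumes [measurable]: "f \<in> borel_measurable borel"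
  shows "fourier f \<xi> = (\<integral>x. f x * cis (- 2 * pi * (x \<bullet> \<xi>)) \<partial>lborel)"
  unfolding fourier_def by (rule integral_completion) measurable

lemma inv_fourier_eq: "inv_fourier f x = fourier f (- x)"
  unfolding inv_fourier_def fourier_def by (simp add: inner_commute)

lemma fourier_measurable [measurable (raw)]:
  assumes [measurable]: "f \<in> borel_measurable borel"
  shows "fourier f \<in> borel_measurable borel"
proof -
  have "(\<lambda>\<xi>. \<integral>x. f x * cis (- 2 * pi * (x \<bullet> \<xi>)) \<partial>lborel) \<in> borel_measurable borel"
    by (rule lborel.borel_measurable_lebesgue_integral) (simp add: borel_measurable_lborel_pair cong: measurable_cong_sets sets_pair_measure_cong, measurable)
  then show ?thesis by (simp add: fourier_lborel[OF assms] cong: measurable_cong)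
qed

lemma fourier_integrand_integrable:
  assumes "integrable lborel f"
  shows "integrable lborel (\<lambda>x. f x * cis (- 2 * pi * (x \<bullet> \<xi>)))"
  by (rule integrable_mult_bounded(2)[OF assms, of _ 1]) auto

lemma norm_fourier_le:
  assumes "integrable lborel f"
  shows "norm (fourier f \<xi>) \<le> (\<integral>x. norm (f x) \<partial>lborel)"
proof -
  have [measurable]: "f \<in> borel_measurable borel" using assms by auto
  show ?thesis
    unfolding fourier_lborel[OF \<open>f \<in> borel_measurable borel\<close>]
    using integral_norm_bound[of lborel "\<lambda>x. f x * cis (- 2 * pi * (x \<bullet> \<xi>))"] by simp
qed

lemma fourier_add:
  assumes "integrable lborel f" "integrable lborel g"
  shows "fourier (\<lambda>x. f x + g x) \<xi> = fourier f \<xi> + fourier g \<xi>"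
proof -
  have [measurable]: "f \<in> borel_measurable borel" "g \<in> borel_measurable borel" using assms by auto
  show ?thesis
    using assms by (simp add: fourier_lborel distrib_right fourier_integrand_integrable[simplified])
qed

lemma fourier_cmult: "fourier (\<lambda>x. c * f x) \<xi> = c * fourier f \<xi>"
  unfolding fourier_def by (simp add: mult.assoc)

lemma fourier_diff:
  assumes "integrable lborel f" "integrable lborel g"
  shows "fourier (\<lambda>x. f x - g x) \<xi> = fourier f \<xi> - fourier g \<xi>"
  using fourier_add[OF assms(1) integrable_mult_right[OF assms(2), of "-1"], of \<xi>] fourier_cmult[of "-1" g] by simp

text \<open>The kernel is symmetric in its two arguments, so Fubini moves the transform to the other
  factor. Inversion, Plancherel, duality and the passage to distributions all rest on this
  identity.\<close>

lemma fourier_mult_formula: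
  fixes f g :: "'a::euclidean_space \<Rightarrow> complex"
  assumes f: "integrable lborel f" and g: "integrable lborel g"
  shows "(\<integral>x. fourier f x * g x \<partial>lborel) = (\<integral>x. f x * fourier g x \<partial>lborel)"
proof -
  have [measurable]: "f \<in> borel_measurable borel" "g \<in> borel_measurable borel" using f g by auto
  have "(\<integral>x. f x * (\<integral>y. g y * cis (- 2 * pi * (x \<bullet> y)) \<partial>lborel) \<partial>lborel) = (\<integral>y. (\<integral>x. f x * cis (- 2 * pi * (x \<bullet> y)) \<partial>lborel) * g y \<partial>lborel)"
    by (rule lborel_Fubini_prod[OF f g]) auto
  then show ?thesis by (simp add: fourier_lborel inner_commute)
qed

subsection \<open>Gaussian kernels\<close>

lemma norm_power2_eq_sum: "(norm (x::'a::euclidean_space))\<^sup>2 = (\<Sum>b\<in>Basis. (x \<bullet> b)\<^sup>2)"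
  unfolding power2_norm_eq_inner unfolding power2_eq_square by (rule euclidean_inner)

lemma prod_exp_inner: "(\<Prod>b\<in>Basis. exp (- (x \<bullet> b)\<^sup>2 / 2)) = exp (- (norm (x::'a::euclidean_space))\<^sup>2 / 2)"
  by (simp add: norm_power2_eq_sum exp_sum[symmetric] sum_negf sum_divide_distrib)

text \<open>Written as a product over coordinates so that integrals factor into one-dimensional
  ones; \<open>gauss_eq\<close> recovers the radial form.\<close>

definition gauss :: "'a::euclidean_space \<Rightarrow> real" where
  "gauss x = (\<Prod>b\<in>Basis. std_normal_density (x \<bullet> b))"

lemma gauss_eq: "gauss (x::'a::euclidean_space) = (1 / sqrt (2 * pi)) ^ DIM('a) * exp (- (norm x)\<^sup>2 / 2)"
  unfolding gauss_def std_normal_density_def prod.distrib prod_constant prod_exp_inner ..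

lemma gauss_nonneg [simp]: "0 \<le> gauss x"
  by (simp add: gauss_eq)

lemma gauss_measurable [measurable]: "gauss \<in> borel_measurable borel"
  unfolding gauss_def[abs_def] by measurable

text \<open>Both facts come from viewing \<open>lborel\<close> as the image of a product measure:
  the exponential splits over the coordinates, and each factor is the characteristic function of the
  standard normal distribution.\<close>

lemma
  fixes t :: "'a::euclidean_space"
  shows integral_gauss_cis: "(\<integral>x. of_real (gauss x) * cis (x \<bullet> t) \<partial>lborel) = of_real (exp (- (norm t)\<^sup>2 / 2))"
    and integrable_gauss: "integrable lborel (gauss :: 'a \<Rightarrow> real)"
proof -
  interpret product_sigma_finite "\<lambda>_::'a. lborel :: real measure" by standard
  have char: "(\<integral>x. of_real (std_normal_density x) * cis (s * x) \<partial>lborel) = of_real (exp (- s\<^sup>2 / 2))" for s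
  proof -
    have "of_real (exp (- s\<^sup>2 / 2)) = (\<integral>x. iexp (s * x) \<partial>std_normal_distribution)"
      using char_std_normal_distribution by (simp add: char_def fun_eq_iff)
    also have "\<dots> = (\<integral>x. std_normal_density x *\<^sub>R iexp (s * x) \<partial>lborel)"
      by (rule integral_density) auto
    also have "\<dots> = (\<integral>x. of_real (std_normal_density x) * cis (s * x) \<partial>lborel)"
      by (simp add: scaleR_conv_of_real cis_conv_exp mult_ac)
    finally show ?thesis by simp
  qed
  have int: "integrable lborel (\<lambda>x. of_real (std_normal_density x) * cis (s * x))" for s
    by (rule integrable_mult_bounded(2)[of _ _ 1]) (auto intro!: integrable_of_real)
  have cis_sum: "cis (\<Sum>b\<in>B. g b) = (\<Prod>b\<in>B. cis (g b))" if "finite B" for B and g :: "'a \<Rightarrow> real"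
    using that by induction (auto simp: cis_mult[symmetric])
  have *: "of_real (gauss x) * cis (x \<bullet> t) = (\<Prod>b\<in>Basis. of_real (std_normal_density (x \<bullet> b)) * cis ((t \<bullet> b) * (x \<bullet> b)))" for x
    by (simp add: gauss_def prod.distrib euclidean_inner[of x t] cis_sum mult.commute)
  have "(\<integral>x. of_real (gauss x) * cis (x \<bullet> t) \<partial>lborel) =
    (\<integral>x. (\<Prod>b\<in>Basis. of_real (std_normal_density (x b)) * cis ((t \<bullet> b) * x b)) \<partial>(\<Pi>\<^sub>M b\<in>(Basis::'a set). lborel))"
    unfolding * by (subst lborel_eq, subst integral_distr) (auto simp: inner_sum_left inner_Basis if_distrib cong: if_cong)
  also have "\<dots> = (\<Prod>b\<in>(Basis::'a set). of_real (exp (- (t \<bullet> b)\<^sup>2 / 2)))"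
    by (subst product_integral_prod) (auto simp: int char)
  also have "\<dots> = of_real (exp (- (norm t)\<^sup>2 / 2))"
    unfolding of_real_prod[symmetric] prod_exp_inner ..
  finally show *: "(\<integral>x. of_real (gauss x) * cis (x \<bullet> t) \<partial>lborel) = of_real (exp (- (norm t)\<^sup>2 / 2))" .
  have "integrable (\<Pi>\<^sub>M b\<in>(Basis::'a set). lborel) (\<lambda>x. (\<Prod>b\<in>Basis. std_normal_density (x b)))"
    by (rule product_integrable_prod) auto
  then show "integrable lborel (gauss :: 'a \<Rightarrow> real)"
    unfolding gauss_def[abs_def] by (subst lborel_eq, subst integrable_distr_eq) (auto simp: inner_sum_left inner_Basis if_distrib cong: if_cong)
qed

lemma integral_gauss: "(\<integral>x. gauss (x::'a::euclidean_space) \<partial>lborel) = 1"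
proof -
  have "complex_of_real (\<integral>x. gauss (x::'a) \<partial>lborel) = 1"
    using integral_gauss_cis[of "0::'a"] by simp
  then show ?thesis using of_real_eq_1_iff by blast
qed

text \<open>The Gaussian rescaled to keep mass one; it concentrates at the origin as
  \<open>a\<close> grows.\<close>

definition gker :: "real \<Rightarrow> 'a::euclidean_space \<Rightarrow> real" where
  "gker a x = a ^ DIM('a) * gauss (a *\<^sub>R x)"

lemma gker_measurable [measurable]: "gker a \<in> borel_measurable borel"
  unfolding gker_def[abs_def] by measurable

lemma gker_nonneg [simp]: "0 < a \<Longrightarrow> 0 \<le> gker a x"
  unfolding gker_def by simp

lemma gker_minus: "gker a (x - y) = gker a (y - x)"
  unfolding gker_def gauss_eq by (simp add: norm_minus_commute)

text \<open>The multiplier whose inverse Fourier transform is \<open>gker a\<close>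
  (\<open>integral_gmult_cis\<close>). It forces convergence of frequency integrals and tends to 1
  as \<open>a\<close> grows.\<close>

definition gmult :: "real \<Rightarrow> 'a::euclidean_space \<Rightarrow> real" where
  "gmult a \<xi> = exp (- 2 * pi\<^sup>2 * (norm \<xi>)\<^sup>2 / a\<^sup>2)"

lemma gmult_measurable [measurable]: "gmult a \<in> borel_measurable borel"
  unfolding gmult_def[abs_def] by measurable

lemma gmult_bounds [simp]: "0 \<le> gmult a x" "gmult a x \<le> 1"
  by (auto simp: gmult_def)

lemma gmult_eq_gauss:
  assumes "a > 0"
  shows "gmult a \<xi> = (sqrt (2 * pi)) ^ DIM('a) * gauss ((2 * pi / a) *\<^sub>R (\<xi>::'a::euclidean_space))"
  using assms by (simp add: gmult_def gauss_eq power_mult_distrib power_divide power2_eq_square field_simps)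

lemma integrable_gmult:
  assumes "a > 0"
  shows "integrable lborel (gmult a)"
proof -
  have "integrable lborel (\<lambda>x. gauss (0 + (2 * pi / a) *\<^sub>R x))"
    using assms by (intro lborel_integrable_affine integrable_gauss) auto
  then show ?thesis
    unfolding gmult_eq_gauss[OF assms, THEN ext] by simp
qed


text \<open>Substituting \<xi> = c x with c = a / (2 pi) undoes the dilation in
  \<open>gmult_eq_gauss\<close> and leaves the known transform of \<open>gauss\<close>. The Jacobian
  c^d and two factors sqrt(2 pi)^d combine to a^d.\<close>

lemma integral_gmult_cis:
  fixes z :: "'a::euclidean_space"
  assumes "a > 0"
  shows "(\<integral>\<xi>. of_real (gmult a \<xi>) * cis (2 * pi * (\<xi> \<bullet> z)) \<partial>lborel) = of_real (gker a z)"
proof -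
  let ?d = "DIM('a)" and ?f = "\<lambda>\<xi>. complex_of_real (gmult a \<xi>) * cis (2 * pi * (\<xi> \<bullet> z))"
  define c where "c = a / (2 * pi)"
  have c: "0 < c" "2 * pi / a * c = 1" "2 * pi * c = a" using assms by (auto simp: c_def)
  have 1: "sqrt (2 * pi) ^ ?d * sqrt (2 * pi) ^ ?d = (2 * pi) ^ ?d"
    unfolding power_mult_distrib[symmetric] by (subst real_sqrt_mult_self) simp
  have f: "?f (0 + c *\<^sub>R \<xi>) = of_real (sqrt (2 * pi) ^ ?d) * (of_real (gauss \<xi>) * cis (\<xi> \<bullet> (a *\<^sub>R z)))" for \<xi>
  proof -
    have "(2 * pi / a) *\<^sub>R (0 + c *\<^sub>R \<xi>) = \<xi>" "2 * pi * ((0 + c *\<^sub>R \<xi>) \<bullet> z) = \<xi> \<bullet> (a *\<^sub>R z)"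
      using c by (simp_all add: mult.assoc[symmetric])
    then show ?thesis
      unfolding gmult_eq_gauss[OF assms] by (simp only: of_real_mult mult.assoc)
  qed
  have "(\<integral>\<xi>. ?f \<xi> \<partial>lborel) = \<bar>c\<bar> ^ ?d *\<^sub>R (\<integral>\<xi>. ?f (0 + c *\<^sub>R \<xi>) \<partial>lborel)"
    using c(1) by (intro lborel_integral_affine) auto
  also have "\<dots> = c ^ ?d *\<^sub>R (of_real (sqrt (2 * pi) ^ ?d) * of_real (exp (- (norm (a *\<^sub>R z))\<^sup>2 / 2)))"
    unfolding f integral_mult_right_zero integral_gauss_cis using c(1) by simp
  also have "exp (- (norm (a *\<^sub>R z))\<^sup>2 / 2) = sqrt (2 * pi) ^ ?d * gauss (a *\<^sub>R z)"
    unfolding gauss_eq by (simp add: power_one_over)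
  also have "c ^ ?d *\<^sub>R (of_real (sqrt (2 * pi) ^ ?d) * of_real (sqrt (2 * pi) ^ ?d * gauss (a *\<^sub>R z)))
     = complex_of_real (c ^ ?d * (sqrt (2 * pi) ^ ?d * sqrt (2 * pi) ^ ?d) * gauss (a *\<^sub>R z))"
    by (simp add: scaleR_conv_of_real mult_ac)
  also have "c ^ ?d * (sqrt (2 * pi) ^ ?d * sqrt (2 * pi) ^ ?d) = a ^ ?d"
    unfolding 1 unfolding power_mult_distrib[symmetric] using c(3) by (simp only: mult.commute)
  finally show ?thesis by (simp add: gker_def)
qed

lemma nn_integral_gker:
  fixes y :: "'a::euclidean_space"
  assumes "a > 0"
  shows "(\<integral>\<^sup>+ x. ennreal (gker a (x - y)) \<partial>lborel) = 1" "(\<integral>\<^sup>+ x. ennreal (gker a (y - x)) \<partial>lborel) = 1"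
proof -
  have "1 = (\<integral>\<^sup>+ x. ennreal (gauss x) \<partial>(lborel::'a measure))"
    using integral_gauss integrable_gauss by (subst nn_integral_eq_integral) auto
  also have "(\<integral>\<^sup>+ x. ennreal (gauss x) \<partial>(lborel::'a measure)) = ennreal (\<bar>a\<bar> ^ DIM('a)) * (\<integral>\<^sup>+ x. ennreal (gauss (- (a *\<^sub>R y) + a *\<^sub>R x)) \<partial>lborel)"
    using assms by (intro lborel_nn_integral_affine) auto
  also have "\<dots> = (\<integral>\<^sup>+ x. ennreal (gker a (x - y)) \<partial>lborel)"
    using assms by (subst nn_integral_cmult[symmetric]) (auto simp: gker_def ennreal_mult algebra_simps)
  finally show "(\<integral>\<^sup>+ x. ennreal (gker a (x - y)) \<partial>lborel) = 1" ..
  then show "(\<integral>\<^sup>+ x. ennreal (gker a (y - x)) \<partial>lborel) = 1"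
    by (subst gker_minus)
qed

section \<open>Damped inversion and Plancherel\<close>

lemma measurable_cnj [measurable]: "cnj \<in> borel_measurable borel"
  by (intro borel_measurable_continuous_onI continuous_intros)

lemma fourier_gmult:
  fixes x y :: "'a::euclidean_space"
  assumes "a > 0"
  shows "fourier (\<lambda>\<xi>. of_real (gmult a \<xi>) * cis (2 * pi * (\<xi> \<bullet> x))) y = of_real (gker a (x - y))"
proof -
  have "fourier (\<lambda>\<xi>. of_real (gmult a \<xi>) * cis (2 * pi * (\<xi> \<bullet> x))) y =
    (\<integral>\<xi>. of_real (gmult a \<xi>) * cis (2 * pi * (\<xi> \<bullet> (x - y))) \<partial>lborel)"
    by (subst fourier_lborel) (auto simp: mult.assoc cis_mult inner_diff_right algebra_simps)
  then show ?thesis using integral_gmult_cis[OF assms] by simp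
qed

lemma gmult_cis_integrable:
  "a > 0 \<Longrightarrow> integrable lborel (\<lambda>\<xi>. of_real (gmult a \<xi>) * cis (2 * pi * (\<xi> \<bullet> x)))"
  by (rule integrable_mult_bounded(2)[of _ _ 1]) (auto intro!: integrable_of_real integrable_gmult)

text \<open>Fourier inversion with damping: the multiplication formula moves the transform onto the
  damped wave, which becomes a Gaussian bump centred at \<open>x\<close>.\<close>

lemma smoothed_inversion:
  fixes u :: "'a::euclidean_space \<Rightarrow> complex"
  assumes "integrable lborel u" "a > 0"
  shows "(\<integral>\<xi>. fourier u \<xi> * (of_real (gmult a \<xi>) * cis (2 * pi * (\<xi> \<bullet> x))) \<partial>lborel) = (\<integral>y. u y * of_real (gker a (x - y)) \<partial>lborel)"
  using fourier_mult_formula[OF assms(1) gmult_cis_integrable[OF assms(2)]]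
  by (simp add: fourier_gmult[OF assms(2)])

lemma gmult_tendsto: "(\<lambda>n. gmult (real (Suc n)) \<xi>) \<longlonglongrightarrow> 1"
proof -
  have "(\<lambda>n. exp (- 2 * pi\<^sup>2 * (norm \<xi>)\<^sup>2 * (inverse (real (Suc n)))\<^sup>2)) \<longlonglongrightarrow> exp (- 2 * pi\<^sup>2 * (norm \<xi>)\<^sup>2 * 0\<^sup>2)"
    by (intro tendsto_intros LIMSEQ_inverse_real_of_nat)
  then show ?thesis by (simp add: gmult_def divide_inverse power_inverse)
qed

text \<open>The substitution y = x - z / a freezes the kernel into the standard Gaussian and moves
  the dependence on \<open>a\<close> into the argument of \<open>H\<close>. Continuity at
  \<open>x\<close> and the majorant \<open>gauss z * M\<close> then allow dominated
  convergence.\<close>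

lemma gker_approx_identity:
  fixes H :: "'a::euclidean_space \<Rightarrow> complex"
  assumes [measurable]: "H \<in> borel_measurable borel" and bound: "\<And>y. norm (H y) \<le> M" and cont: "isCont H x"
  shows "(\<lambda>n. \<integral>y. H y * of_real (gker (real (Suc n)) (x - y)) \<partial>lborel) \<longlonglongrightarrow> H x"
proof -
  have eq: "(\<integral>y. H y * of_real (gker (real (Suc n)) (x - y)) \<partial>lborel) = (\<integral>z. of_real (gauss z) * H (x + (- inverse (real (Suc n))) *\<^sub>R z) \<partial>lborel)" for n
  proof -
    let ?a = "real (Suc n)"
    let ?c = "- inverse ?a"
    have c: "?c \<noteq> 0" "\<bar>?c\<bar> ^ DIM('a) * ?a ^ DIM('a) = 1"
      by (simp_all flip: power_mult_distrib)
    have "(\<integral>y. H y * of_real (gker ?a (x - y)) \<partial>lborel) =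
      \<bar>?c\<bar> ^ DIM('a) *\<^sub>R (\<integral>z. H (x + ?c *\<^sub>R z) * of_real (gker ?a (x - (x + ?c *\<^sub>R z))) \<partial>lborel)"
      using c(1) by (rule lborel_integral_affine) measurable
    also have "\<dots> = (\<integral>z. \<bar>?c\<bar> ^ DIM('a) *\<^sub>R (H (x + ?c *\<^sub>R z) * of_real (gker ?a (x - (x + ?c *\<^sub>R z)))) \<partial>lborel)"
      by simp
    also have "\<dots> = (\<integral>z. of_real (gauss z) * H (x + ?c *\<^sub>R z) \<partial>lborel)"
    proof (intro Bochner_Integration.integral_cong refl)
      fix z :: 'a
      have "\<bar>?c\<bar> ^ DIM('a) *\<^sub>R (H (x + ?c *\<^sub>R z) * of_real (gker ?a (x - (x + ?c *\<^sub>R z)))) =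
        of_real (\<bar>?c\<bar> ^ DIM('a) * ?a ^ DIM('a)) * (of_real (gauss z) * H (x + ?c *\<^sub>R z))"
        by (simp add: gker_def scaleR_conv_of_real del: of_nat_Suc)
      then show "\<bar>?c\<bar> ^ DIM('a) *\<^sub>R (H (x + ?c *\<^sub>R z) * of_real (gker ?a (x - (x + ?c *\<^sub>R z)))) = of_real (gauss z) * H (x + ?c *\<^sub>R z)"
        unfolding c(2) by simp
    qed
    finally show ?thesis .
  qed
  have "(\<lambda>n. \<integral>z. of_real (gauss z) * H (x + (- inverse (real (Suc n))) *\<^sub>R z) \<partial>lborel) \<longlonglongrightarrow> (\<integral>z. of_real (gauss z) * H x \<partial>(lborel::'a measure))"
  proof (rule integral_dominated_convergence[where w = "\<lambda>z::'a. gauss z * M"])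
    show "integrable lborel (\<lambda>z::'a. gauss z * M)" using integrable_gauss by auto
    show "AE z in lborel. (\<lambda>n. of_real (gauss z) * H (x + (- inverse (real (Suc n))) *\<^sub>R z)) \<longlonglongrightarrow> of_real (gauss z) * H x"
    proof (intro AE_I2 tendsto_mult_left isCont_tendsto_compose[OF cont])
      fix z :: 'a
      have "(\<lambda>n. x + (- inverse (real (Suc n))) *\<^sub>R z) \<longlonglongrightarrow> x + (- 0) *\<^sub>R z"
        by (intro tendsto_intros LIMSEQ_inverse_real_of_nat)
      then show "(\<lambda>n. x + (- inverse (real (Suc n))) *\<^sub>R z) \<longlonglongrightarrow> x" by simp
    qed
    show "AE z in lborel. norm (of_real (gauss z) * H (x + (- inverse (real (Suc n))) *\<^sub>R z)) \<le> gauss z * M" for n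
      using bound by (intro AE_I2) (simp add: norm_mult mult_left_mono)
  qed measurable
  moreover have "(\<integral>z. of_real (gauss z) * H x \<partial>(lborel::'a measure)) = H x"
    using integrable_gauss[where 'a='a] by (simp add: integral_gauss integrable_of_real)
  ultimately show ?thesis unfolding eq by (simp only:)
qed

text \<open>Both sides of \<open>smoothed_inversion\<close> at \<open>- x\<close> are sent to the
  limit: the frequency side is dominated by the integrable transform, the other side is an
  approximate identity.\<close>

lemma fourier_fourier:
  fixes f :: "'a::euclidean_space \<Rightarrow> complex"
  assumes f: "integrable lborel f" "integrable lborel (fourier f)" and bound: "\<And>y. norm (f y) \<le> M"
    and cont: "isCont f (- x)"
  shows "fourier (fourier f) x = f (- x)"
proof -
  have [measurable]: "f \<in> borel_measurable borel" using f by auto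
  have eq: "(\<integral>\<xi>. fourier f \<xi> * (of_real (gmult (real (Suc n)) \<xi>) * cis (2 * pi * (\<xi> \<bullet> - x))) \<partial>lborel) =
     (\<integral>y. f y * of_real (gker (real (Suc n)) (- x - y)) \<partial>lborel)" for n
    by (rule smoothed_inversion[OF f(1)]) simp
  have "(\<lambda>n. \<integral>\<xi>. fourier f \<xi> * (of_real (gmult (real (Suc n)) \<xi>) * cis (2 * pi * (\<xi> \<bullet> - x))) \<partial>lborel)
    \<longlonglongrightarrow> (\<integral>\<xi>. fourier f \<xi> * (of_real 1 * cis (2 * pi * (\<xi> \<bullet> - x))) \<partial>lborel)"
  proof (rule integral_dominated_convergence[where w = "\<lambda>\<xi>. norm (fourier f \<xi>)"])
    show "AE \<xi> in lborel. (\<lambda>n. fourier f \<xi> * (of_real (gmult (real (Suc n)) \<xi>) * cis (2 * pi * (\<xi> \<bullet> - x))))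
       \<longlonglongrightarrow> fourier f \<xi> * (of_real 1 * cis (2 * pi * (\<xi> \<bullet> - x)))"
      by (intro AE_I2 tendsto_mult_left tendsto_mult_right tendsto_of_real gmult_tendsto)
    show "AE \<xi> in lborel. norm (fourier f \<xi> * (of_real (gmult (real (Suc n)) \<xi>) * cis (2 * pi * (\<xi> \<bullet> - x)))) \<le> norm (fourier f \<xi>)" for n
      by (intro AE_I2) (simp add: norm_mult mult_left_le del: of_nat_Suc)
  qed (use f(2) in auto)
  moreover have "(\<lambda>n. \<integral>y. f y * of_real (gker (real (Suc n)) (- x - y)) \<partial>lborel) \<longlonglongrightarrow> f (- x)"
    by (rule gker_approx_identity[OF _ bound cont]) measurable
  ultimately have "(\<integral>\<xi>. fourier f \<xi> * (of_real 1 * cis (2 * pi * (\<xi> \<bullet> - x))) \<partial>lborel) = f (- x)"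
    unfolding eq by (rule LIMSEQ_unique)
  then show ?thesis by (simp add: fourier_lborel)
qed

text \<open>The squared modulus is damped by \<open>gmult\<close> and written as
  \<open>fourier u * v\<close>. The multiplication formula replaces it by
  \<open>u * fourier v\<close>, where \<open>fourier v\<close> is the conjugate of \<open>u\<close>
  smoothed by \<open>gker\<close>. Since \<open>gker\<close> has mass one in each variable,
  smoothing cannot increase the quadratic form, and Fatou removes the damping.\<close>

lemma nn_integral_fourier_power2_le:
  fixes u :: "'a::euclidean_space \<Rightarrow> complex"
  assumes u: "integrable lborel u"
  shows "(\<integral>\<^sup>+ \<xi>. ennreal ((norm (fourier u \<xi>))\<^sup>2) \<partial>lborel) \<le> (\<integral>\<^sup>+ x. ennreal ((norm (u x))\<^sup>2) \<partial>lborel)"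
proof (rule nn_integral_lim_le)
  have [measurable]: "u \<in> borel_measurable borel" using u by auto
  show "(\<lambda>\<xi>. ennreal ((norm (fourier u \<xi>))\<^sup>2 * gmult (real (Suc n)) \<xi>)) \<in> borel_measurable lborel" for n
    by measurable
  show "AE \<xi> in lborel. (\<lambda>n. ennreal ((norm (fourier u \<xi>))\<^sup>2 * gmult (real (Suc n)) \<xi>)) \<longlonglongrightarrow> ennreal ((norm (fourier u \<xi>))\<^sup>2)"
    using tendsto_mult_left[OF gmult_tendsto] by (intro AE_I2 tendsto_ennrealI) force
  fix n
  define a where "a = real (Suc n)"
  have a: "a > 0" by (simp add: a_def)
  let ?I = "\<integral>\<^sup>+ x. ennreal ((norm (u x))\<^sup>2) \<partial>lborel"
  define M where "M = (\<integral>x. norm (u x) \<partial>lborel)"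
  have M: "norm (fourier u \<xi>) \<le> M" for \<xi> unfolding M_def by (rule norm_fourier_le[OF u])
  define v where "v = (\<lambda>\<xi>. cnj (fourier u \<xi>) * of_real (gmult a \<xi>))"
  have v: "integrable lborel v"
    unfolding v_def by (rule integrable_mult_bounded(1)[of _ _ M]) (auto intro!: integrable_of_real integrable_gmult a M)
  have gk: "fourier v x = cnj (\<integral>y. u y * of_real (gker a (x - y)) \<partial>lborel)" for x
  proof -
    have "fourier v x = (\<integral>\<xi>. cnj (fourier u \<xi> * (of_real (gmult a \<xi>) * cis (2 * pi * (\<xi> \<bullet> x)))) \<partial>lborel)"
      using v by (subst fourier_lborel) (auto simp: v_def cis_cnj mult.assoc)
    also have "\<dots> = cnj (\<integral>\<xi>. fourier u \<xi> * (of_real (gmult a \<xi>) * cis (2 * pi * (\<xi> \<bullet> x))) \<partial>lborel)"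
      by (rule integral_bounded_linear'[OF bounded_linear_cnj bounded_linear_cnj]) (auto simp: fun_eq_iff)
    finally show ?thesis by (simp only: smoothed_inversion[OF u a])
  qed
  have n1: "ennreal (norm (fourier v x)) \<le> (\<integral>\<^sup>+ y. ennreal (norm (u y) * gker a (x - y)) \<partial>lborel)" for x
  proof -
    \<comment> \<open>A non-integrable function has integral 0 by convention, so the norm bound is
      trivial in that case.\<close>
    have "ennreal (norm (fourier v x)) \<le> (\<integral>\<^sup>+ y. ennreal (norm (u y * of_real (gker a (x - y)))) \<partial>lborel)"
      unfolding gk complex_mod_cnj by (cases "integrable lborel (\<lambda>y. u y * of_real (gker a (x - y)))")
         (auto intro!: integral_norm_bound_ennreal simp: not_integrable_integral_eq)
    also have "\<dots> = (\<integral>\<^sup>+ y. ennreal (norm (u y) * gker a (x - y)) \<partial>lborel)"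
      using a by (simp add: norm_mult)
    finally show ?thesis .
  qed
  have int: "integrable lborel (\<lambda>\<xi>. (norm (fourier u \<xi>))\<^sup>2 * gmult a \<xi>)"
    using M by (intro integrable_mult_bounded(1)[of _ _ "M\<^sup>2"]) (auto intro!: integrable_gmult a power_mono)
  have "(\<integral>\<^sup>+ \<xi>. ennreal ((norm (fourier u \<xi>))\<^sup>2 * gmult a \<xi>) \<partial>lborel) = ennreal (\<integral>\<xi>. (norm (fourier u \<xi>))\<^sup>2 * gmult a \<xi> \<partial>lborel)"
    using int by (intro nn_integral_eq_integral) auto
  also have "(\<integral>\<xi>. (norm (fourier u \<xi>))\<^sup>2 * gmult a \<xi> \<partial>lborel) = norm (complex_of_real (\<integral>\<xi>. (norm (fourier u \<xi>))\<^sup>2 * gmult a \<xi> \<partial>lborel))"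
    by (simp add: integral_nonneg_AE)
  also have "complex_of_real (\<integral>\<xi>. (norm (fourier u \<xi>))\<^sup>2 * gmult a \<xi> \<partial>lborel) = (\<integral>\<xi>. fourier u \<xi> * v \<xi> \<partial>lborel)"
    by (subst integral_complex_of_real[symmetric]) (simp only: v_def of_real_mult complex_norm_square mult.assoc)
  also have "\<dots> = (\<integral>x. u x * fourier v x \<partial>lborel)"
    by (rule fourier_mult_formula[OF u v])
  also have "ennreal (norm \<dots>) \<le> (\<integral>\<^sup>+ x. ennreal (norm (u x * fourier v x)) \<partial>lborel)"
    by (cases "integrable lborel (\<lambda>x. u x * fourier v x)") (auto intro!: integral_norm_bound_ennreal simp: not_integrable_integral_eq)
  also have "\<dots> \<le> (\<integral>\<^sup>+ x. ennreal (norm (u x)) * (\<integral>\<^sup>+ y. ennreal (norm (u y) * gker a (x - y)) \<partial>lborel) \<partial>lborel)"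
    by (intro nn_integral_mono) (simp add: norm_mult ennreal_mult mult_left_mono n1)
  also have "\<dots> = (\<integral>\<^sup>+ x. \<integral>\<^sup>+ y. ennreal (norm (u x) * (norm (u y) * gker a (x - y))) \<partial>lborel \<partial>lborel)"
    using a by (subst nn_integral_cmult[symmetric]) (auto simp: ennreal_mult)
  \<comment> \<open>The arithmetic-geometric mean inequality replaces a convolution estimate: each
    resulting term depends on \<open>x\<close> or on \<open>y\<close> alone, and the kernel
    integrates to 1 in the other variable.\<close>
  also have "\<dots> \<le> (\<integral>\<^sup>+ x. \<integral>\<^sup>+ y. ennreal ((norm (u x))\<^sup>2 / 2) * ennreal (gker a (x - y)) + ennreal ((norm (u y))\<^sup>2 / 2) * ennreal (gker a (x - y)) \<partial>lborel \<partial>lborel)"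
  proof (intro nn_integral_mono)
    fix x y :: 'a
    have "norm (u x) * norm (u y) \<le> (norm (u x))\<^sup>2 / 2 + (norm (u y))\<^sup>2 / 2"
      using sum_squares_bound[of "norm (u x)" "norm (u y)"] by (simp add: mult.assoc)
    from mult_right_mono[OF this gker_nonneg[OF a, of "x - y"]]
    show "ennreal (norm (u x) * (norm (u y) * gker a (x - y))) \<le> ennreal ((norm (u x))\<^sup>2 / 2) * ennreal (gker a (x - y)) + ennreal ((norm (u y))\<^sup>2 / 2) * ennreal (gker a (x - y))"
      using gker_nonneg[OF a, of "x - y"] by (simp add: ennreal_mult[symmetric] ennreal_plus[symmetric] ring_distribs mult.assoc del: ennreal_plus)
  qed
  also have "\<dots> = (\<integral>\<^sup>+ x. \<integral>\<^sup>+ y. ennreal ((norm (u x))\<^sup>2 / 2) * ennreal (gker a (x - y)) \<partial>lborel \<partial>lborel)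
     + (\<integral>\<^sup>+ x. \<integral>\<^sup>+ y. ennreal ((norm (u y))\<^sup>2 / 2) * ennreal (gker a (x - y)) \<partial>lborel \<partial>lborel)"
    by (simp add: nn_integral_add lborel.borel_measurable_nn_integral borel_measurable_lborel_pair)
  also have "(\<integral>\<^sup>+ x. \<integral>\<^sup>+ y. ennreal ((norm (u y))\<^sup>2 / 2) * ennreal (gker a (x - y)) \<partial>lborel \<partial>lborel) =
     (\<integral>\<^sup>+ y. \<integral>\<^sup>+ x. ennreal ((norm (u y))\<^sup>2 / 2) * ennreal (gker a (x - y)) \<partial>lborel \<partial>lborel)"
    by (rule lborel_Fubini_nn_integral) measurable
  also have "(\<integral>\<^sup>+ x. \<integral>\<^sup>+ y. ennreal ((norm (u x))\<^sup>2 / 2) * ennreal (gker a (x - y)) \<partial>lborel \<partial>lborel) + \<dots>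
    = (\<integral>\<^sup>+ x. ennreal ((norm (u x))\<^sup>2 / 2) \<partial>lborel) + (\<integral>\<^sup>+ x. ennreal ((norm (u x))\<^sup>2 / 2) \<partial>lborel)"
    by (simp add: nn_integral_cmult nn_integral_gker[OF a])
  also have "\<dots> = ?I"
    by (subst nn_integral_add[symmetric]) (auto simp flip: ennreal_plus)
  finally show "(\<integral>\<^sup>+ \<xi>. ennreal ((norm (fourier u \<xi>))\<^sup>2 * gmult (real (Suc n)) \<xi>) \<partial>lborel) \<le> ?I"
    by (simp only: a_def)
qed

subsection \<open>The Fourier transform of Schwartz functions\<close>

lemma schwartz_seminorm_bound:
  assumes "f \<in> schwartz" "set bs \<subseteq> Basis"
  shows "(1 + norm x) ^ k * norm (iter_partial bs f x) \<le> schwartz_seminorm k bs f"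
  using assms unfolding schwartz_seminorm_def schwartz_def by (intro cSUP_upper) auto

lemma schwartz_seminorm_nonneg:
  assumes "f \<in> schwartz" "set bs \<subseteq> Basis"
  shows "0 \<le> schwartz_seminorm k bs f"
  by (rule order_trans[OF _ schwartz_seminorm_bound[OF assms, of 0]]) auto

lemma schwartz_norm_le_wt:
  assumes "f \<in> schwartz"
  shows "norm (f (x::'a::euclidean_space)) \<le> schwartz_seminorm (2 * DIM('a)) [] f * wt x powr - 2"
  using schwartz_seminorm_bound[OF assms, of "[]" x] by (intro decay_imp_le_wt) auto

lemma schwartz_integrable:
  fixes f :: "'a::euclidean_space \<Rightarrow> complex"
  assumes f: "f \<in> schwartz"
  shows "integrable lborel f"
proof (rule Bochner_Integration.integrable_bound)
  show "integrable lborel (\<lambda>x::'a. schwartz_seminorm (2 * DIM('a)) [] f * wt x powr - 2)"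
    by (intro integrable_mult_right integrable_wt)
  show "AE x in lborel. norm (f x) \<le> norm (schwartz_seminorm (2 * DIM('a)) [] f * wt x powr - 2)"
    unfolding real_norm_def by (intro AE_I2 order_trans[OF schwartz_norm_le_wt[OF f] abs_ge_self])
qed (use f in \<open>simp add: schwartz_borel_measurable\<close>)

text \<open>The type argument carries the dimension, the only datum on which the constant
  depends.\<close>

definition wtint :: "'a::euclidean_space itself \<Rightarrow> real" where
  "wtint _ = (\<integral>x. wt (x::'a) powr - 2 \<partial>lborel)"

lemma wtint_nonneg [simp]: "0 \<le> wtint TYPE('a::euclidean_space)"
  unfolding wtint_def by (intro integral_nonneg_AE) auto

lemma norm_fourier_le_wtint:
  fixes f :: "'a::euclidean_space \<Rightarrow> complex"
  assumes f: "integrable lborel f" and le: "\<And>x. norm (f x) \<le> C * wt x powr - 2"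
  shows "norm (fourier f \<xi>) \<le> C * wtint TYPE('a)"
proof -
  have "norm (fourier f \<xi>) \<le> (\<integral>x. norm (f x) \<partial>lborel)"
    by (rule norm_fourier_le[OF f])
  also have "\<dots> \<le> (\<integral>x. C * wt (x::'a) powr - 2 \<partial>lborel)"
    by (intro integral_mono integrable_norm f integrable_mult_right integrable_wt le)
  finally show ?thesis by (simp add: wtint_def)
qed

lemma norm_fourier_schwartz_le:
  assumes "f \<in> schwartz"
  shows "norm (fourier f (\<xi>::'a::euclidean_space)) \<le> schwartz_seminorm (2 * DIM('a)) [] f * wtint TYPE('a)"
  by (rule norm_fourier_le_wtint[OF schwartz_integrable[OF assms] schwartz_norm_le_wt[OF assms]])

lemma norm_cis_taylor: "norm (cis t - 1 - \<i> * of_real t) \<le> t\<^sup>2 / 2"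
  using iexp_approx1[of t 1] by (simp add: cis_conv_exp diff_diff_eq power2_eq_square)

text \<open>Differentiation under the integral with an explicit error: the second-order remainder of
  \<open>cis\<close> is at most a constant times |x|^2 |h|^2, and |x|^2 times \<open>f\<close> is
  integrable, so the difference quotient misses its limit by a multiple of |h|.\<close>

lemma schwartz_fourier_has_derivative:
  fixes f :: "'a::euclidean_space \<Rightarrow> complex"
  assumes f: "f \<in> schwartz"
  shows "(fourier f has_derivative (\<lambda>h. fourier (\<lambda>x. (- 2 * pi * \<i>) * of_real (x \<bullet> h) * f x) \<xi>)) (at \<xi>)"
proof (rule has_derivativeI_sandwich[where e=1])
  let ?D = "\<lambda>h. fourier (\<lambda>x. (- 2 * pi * \<i>) * of_real (x \<bullet> h) * f x) \<xi>"
  have S: "(\<lambda>x. (- 2 * pi * \<i>) * of_real (x \<bullet> h) * f x) \<in> schwartz" for h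
    by (intro schwartz_tame_mult f tame.intros)
  have [measurable]: "f \<in> borel_measurable borel" using f by measurable
  have "linear ?D"
  proof (rule linearI)
    fix h k :: 'a and r :: real
    show "?D (h + k) = ?D h + ?D k"
      using fourier_add[OF schwartz_integrable[OF S[of h]] schwartz_integrable[OF S[of k]], of \<xi>]
      by (simp add: inner_add_right algebra_simps)
    show "?D (r *\<^sub>R h) = r *\<^sub>R ?D h"
      using fourier_cmult[of "of_real r" "\<lambda>x. (- 2 * pi * \<i>) * of_real (x \<bullet> h) * f x" \<xi>]
      by (simp add: scaleR_conv_of_real mult_ac)
  qed
  then show "bounded_linear ?D" by (rule linear_conv_bounded_linear[THEN iffD1])
  define K where "K = (\<integral>x. (1 + (norm x)\<^sup>2) * norm (f x) \<partial>lborel)"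
  \<comment> \<open>The factor 1 + |x|^2 dominates |x|^2 and is itself a tame multiplier, which
    yields integrability at once.\<close>
  have "(\<lambda>x. of_real ((1 + (norm x)\<^sup>2) powr 1) * f x) \<in> schwartz"
    by (intro schwartz_tame_mult f tame.intros)
  then have "integrable lborel (\<lambda>x. norm (of_real ((1 + (norm x)\<^sup>2) powr 1) * f x))"
    by (intro integrable_norm schwartz_integrable)
  then have Kint: "integrable lborel (\<lambda>x. (1 + (norm x)\<^sup>2) * norm (f x))"
    unfolding norm_mult norm_of_real by simp
  show "norm (fourier f y - fourier f \<xi> - ?D (y - \<xi>)) / norm (y - \<xi>) \<le> 2 * pi\<^sup>2 * K * norm (y - \<xi>)"
    if "y \<noteq> \<xi>" for y
  proof -
    let ?h = "y - \<xi>"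
    define R where "R = (\<lambda>x. f x * cis (- 2 * pi * (x \<bullet> \<xi>)) * (cis (- 2 * pi * (x \<bullet> ?h)) - 1 - \<i> * of_real (- 2 * pi * (x \<bullet> ?h))))"
    have i: "integrable lborel (\<lambda>x. f x * cis (- 2 * pi * (x \<bullet> y)))" "integrable lborel (\<lambda>x. f x * cis (- 2 * pi * (x \<bullet> \<xi>)))"
      "integrable lborel (\<lambda>x. (- 2 * pi * \<i>) * of_real (x \<bullet> ?h) * f x * cis (- 2 * pi * (x \<bullet> \<xi>)))"
      by (intro fourier_integrand_integrable schwartz_integrable f S)+
    have R: "R = (\<lambda>x. f x * cis (- 2 * pi * (x \<bullet> y)) - f x * cis (- 2 * pi * (x \<bullet> \<xi>)) -
        (- 2 * pi * \<i>) * of_real (x \<bullet> ?h) * f x * cis (- 2 * pi * (x \<bullet> \<xi>)))"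
    proof
      fix x
      have "cis (- 2 * pi * (x \<bullet> y)) = cis (- 2 * pi * (x \<bullet> \<xi>)) * cis (- 2 * pi * (x \<bullet> ?h))"
        unfolding cis_mult by (rule arg_cong[of _ _ cis]) (simp add: inner_diff_right algebra_simps)
      then show "R x = f x * cis (- 2 * pi * (x \<bullet> y)) - f x * cis (- 2 * pi * (x \<bullet> \<xi>)) -
        (- 2 * pi * \<i>) * of_real (x \<bullet> ?h) * f x * cis (- 2 * pi * (x \<bullet> \<xi>))"
        unfolding R_def by (simp add: algebra_simps)
    qed
    have Ri: "integrable lborel R" unfolding R using i by (intro Bochner_Integration.integrable_diff)
    have "fourier f y - fourier f \<xi> - ?D ?h = (\<integral>x. R x \<partial>lborel)"
      unfolding R using i by (simp add: fourier_lborel)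
    also have "norm \<dots> \<le> (\<integral>x. norm (R x) \<partial>lborel)" by simp
    also have "\<dots> \<le> (\<integral>x. 2 * pi\<^sup>2 * (norm ?h)\<^sup>2 * ((1 + (norm x)\<^sup>2) * norm (f x)) \<partial>lborel)"
    proof (intro integral_mono integrable_mult_right Kint)
      fix x :: 'a
      have "norm (cis (- 2 * pi * (x \<bullet> ?h)) - 1 - \<i> * of_real (- 2 * pi * (x \<bullet> ?h))) \<le> (- 2 * pi * (x \<bullet> ?h))\<^sup>2 / 2"
        by (rule norm_cis_taylor)
      also have "\<dots> = 2 * pi\<^sup>2 * (x \<bullet> ?h)\<^sup>2"
        by (simp add: power_mult_distrib)
      also have "(x \<bullet> ?h)\<^sup>2 \<le> (norm x * norm ?h)\<^sup>2"
        using Cauchy_Schwarz_ineq2[of x ?h] by (simp add: abs_le_square_iff[symmetric] abs_mult)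
      also have "\<dots> \<le> (norm ?h)\<^sup>2 * (1 + (norm x)\<^sup>2)"
        by (simp add: power_mult_distrib algebra_simps)
      finally have "norm (cis (- 2 * pi * (x \<bullet> ?h)) - 1 - \<i> * of_real (- 2 * pi * (x \<bullet> ?h))) \<le> 2 * pi\<^sup>2 * ((norm ?h)\<^sup>2 * (1 + (norm x)\<^sup>2))"
        by simp
      from mult_left_mono[OF this norm_ge_zero[of "f x"]]
      show "norm (R x) \<le> 2 * pi\<^sup>2 * (norm ?h)\<^sup>2 * ((1 + (norm x)\<^sup>2) * norm (f x))"
        unfolding R_def norm_mult norm_cis by (simp only: mult_ac mult_1)
    qed (use Ri in auto)
    also have "\<dots> = 2 * pi\<^sup>2 * (norm ?h)\<^sup>2 * K"
      by (simp only: K_def integral_mult_right_zero)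
    also have "\<dots> = 2 * pi\<^sup>2 * K * norm ?h * norm ?h"
      by (simp only: power2_eq_square mult_ac)
    finally show ?thesis using that by (simp add: divide_le_eq mult_ac)
  qed
  have "((\<lambda>y. 2 * pi\<^sup>2 * K * norm (y - \<xi>)) \<longlongrightarrow> 2 * pi\<^sup>2 * K * norm (\<xi> - \<xi>)) (at \<xi>)"
    by (intro tendsto_intros)
  then show "((\<lambda>y. 2 * pi\<^sup>2 * K * norm (y - \<xi>)) \<longlongrightarrow> 0) (at \<xi>)" by simp
qed auto

section \<open>Partial derivatives under the Fourier transform\<close>

lemma schwartz_line_derivative:
  assumes "f \<in> schwartz" "b \<in> Basis"
  shows "((\<lambda>s. f (x + s *\<^sub>R b)) has_derivative (\<lambda>h. h *\<^sub>R frechet_derivative f (at (x + s *\<^sub>R b)) b)) (at s within A)"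
proof -
  let ?D = "frechet_derivative f (at (x + s *\<^sub>R b))"
  have D: "(f has_derivative ?D) (at (x + s *\<^sub>R b))" by (rule schwartz_has_derivative[OF assms(1)])
  have "((\<lambda>s. f (x + s *\<^sub>R b)) has_derivative (\<lambda>h. ?D (h *\<^sub>R b))) (at s within A)"
    by (rule has_derivative_compose[of "\<lambda>s. x + s *\<^sub>R b" "\<lambda>h. h *\<^sub>R b" s A f, OF _ D]) (auto intro!: derivative_eq_intros)
  then show ?thesis by (simp add: linear_scale[OF has_derivative_linear[OF D]])
qed

text \<open>Mean value inequality along the segment from x to x + t b. With t <= 1 one has 1 + |x|
  <= 2 (1 + |x + s b|) on the segment, so the decay of the partial derivative there transfers to x
  at the price of a fixed power of 2.\<close>

lemma schwartz_difference_bound: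
  assumes f: "f \<in> schwartz" and b: "b \<in> Basis"
  shows "\<exists>C\<ge>0. \<forall>x t. 0 \<le> t \<and> t \<le> 1 \<longrightarrow> norm (f (x + t *\<^sub>R b) - f x) \<le> C * t * wt (x::'a::euclidean_space) powr - 2"
proof -
  let ?g = "\<lambda>x. frechet_derivative f (at x) b" and ?k = "2 * DIM('a)"
  obtain C where C: "C \<ge> 0" "\<And>x. (1 + norm x) ^ ?k * norm (?g x) \<le> C"
    using schwartz_decay[OF schwartz_partial[OF f b]] by blast
  have bound: "norm (?g (x + s *\<^sub>R b)) \<le> (2 ^ ?k * C) * wt x powr - 2" if "0 \<le> s" "s \<le> 1" for x s
  proof (rule decay_imp_le_wt)
    have "norm x \<le> norm (x + s *\<^sub>R b) + norm (s *\<^sub>R b)"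
      by (metis add_diff_cancel_right' norm_triangle_ineq4)
    moreover have "norm (s *\<^sub>R b) \<le> 1" using that b by simp
    ultimately have "1 + norm x \<le> 2 * (1 + norm (x + s *\<^sub>R b))"
      using norm_ge_zero[of "x + s *\<^sub>R b"] by argo
    then have "(1 + norm x) ^ ?k \<le> 2 ^ ?k * (1 + norm (x + s *\<^sub>R b)) ^ ?k"
      unfolding power_mult_distrib[symmetric] by (intro power_mono) auto
    then have "(1 + norm x) ^ ?k * norm (?g (x + s *\<^sub>R b)) \<le> 2 ^ ?k * (1 + norm (x + s *\<^sub>R b)) ^ ?k * norm (?g (x + s *\<^sub>R b))"
      by (rule mult_right_mono) simp
    also have "\<dots> \<le> 2 ^ ?k * C"
      unfolding mult.assoc by (intro mult_left_mono C) auto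
    finally show "(1 + norm x) ^ ?k * norm (?g (x + s *\<^sub>R b)) \<le> 2 ^ ?k * C" .
  qed simp
  show ?thesis
  proof (intro exI[of _ "2 ^ ?k * C"] conjI allI impI)
    fix x :: 'a and t :: real assume t: "0 \<le> t \<and> t \<le> 1"
    have "norm (f (x + t *\<^sub>R b) - f (x + 0 *\<^sub>R b)) \<le> (2 ^ ?k * C) * wt x powr - 2 * norm (t - 0)"
    proof (rule differentiable_bound[where S = "{0..t}"])
      fix s assume s: "s \<in> {0..t}"
      show "((\<lambda>s. f (x + s *\<^sub>R b)) has_derivative (\<lambda>h. h *\<^sub>R ?g (x + s *\<^sub>R b))) (at s within {0..t})"
        by (rule schwartz_line_derivative[OF f b])
      show "onorm (\<lambda>h. h *\<^sub>R ?g (x + s *\<^sub>R b)) \<le> (2 ^ ?k * C) * wt x powr - 2"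
        using bound[of s x] s t C by (intro onorm_bound) (auto simp: mult.commute mult_left_mono)
    qed (use t in auto)
    with t show "norm (f (x + t *\<^sub>R b) - f x) \<le> (2 ^ ?k * C) * t * wt x powr - 2"
      by (simp add: mult_ac)
  qed (use C in auto)
qed

text \<open>The mean value inequality is applied to f(x + s b) minus its linear part in s. Its
  derivative is a difference of values of the partial derivative, again a Schwartz function, and the
  previous bound supplies the second factor t.\<close>

lemma schwartz_taylor_bound:
  assumes f: "f \<in> schwartz" and b: "b \<in> Basis"
  shows "\<exists>C\<ge>0. \<forall>x t. 0 \<le> t \<and> t \<le> 1 \<longrightarrow>
    norm (f (x + t *\<^sub>R b) - f x - t *\<^sub>R frechet_derivative f (at x) b) \<le> C * t\<^sup>2 * wt (x::'a::euclidean_space) powr - 2"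
proof -
  let ?g = "\<lambda>x. frechet_derivative f (at x) b"
  obtain C where C: "C \<ge> 0" "\<And>x t. 0 \<le> t \<and> t \<le> 1 \<Longrightarrow> norm (?g (x + t *\<^sub>R b) - ?g x) \<le> C * t * wt x powr - 2"
    using schwartz_difference_bound[OF schwartz_partial[OF f b] b] by blast
  show ?thesis
  proof (intro exI[of _ C] conjI allI impI C)
    fix x :: 'a and t :: real assume t: "0 \<le> t \<and> t \<le> 1"
    have "norm ((f (x + t *\<^sub>R b) - t *\<^sub>R ?g x) - (f (x + 0 *\<^sub>R b) - 0 *\<^sub>R ?g x)) \<le> (C * t * wt x powr - 2) * norm (t - 0)"
    proof (rule differentiable_bound[where S = "{0..t}"])
      fix s assume s: "s \<in> {0..t}"
      show "((\<lambda>s. f (x + s *\<^sub>R b) - s *\<^sub>R ?g x) has_derivative (\<lambda>h. h *\<^sub>R ?g (x + s *\<^sub>R b) - h *\<^sub>R ?g x)) (at s within {0..t})"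
        by (intro has_derivative_diff schwartz_line_derivative[OF f b] has_derivative_scaleR_left has_derivative_ident)
      have "norm (?g (x + s *\<^sub>R b) - ?g x) \<le> C * s * wt x powr - 2" using s t by (intro C) auto
      also have "\<dots> \<le> C * t * wt x powr - 2" using s C by (intro mult_right_mono mult_left_mono) auto
      finally show "onorm (\<lambda>h. h *\<^sub>R ?g (x + s *\<^sub>R b) - h *\<^sub>R ?g x) \<le> C * t * wt x powr - 2"
        using t C unfolding scaleR_diff_right[symmetric] by (intro onorm_bound) (auto simp: mult.commute mult_left_mono)
    qed (use t in auto)
    with t show "norm (f (x + t *\<^sub>R b) - f x - t *\<^sub>R ?g x) \<le> C * t\<^sup>2 * wt x powr - 2"
      by (simp add: power2_eq_square algebra_simps)
  qed
qed

lemma fourier_translate: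
  assumes [measurable]: "f \<in> borel_measurable borel"
  shows "fourier (\<lambda>x. f (x + v)) \<xi> = cis (2 * pi * (v \<bullet> \<xi>)) * fourier f (\<xi>::'a::euclidean_space)"
proof -
  have "fourier f \<xi> = (\<integral>x. f (v + 1 *\<^sub>R x) * cis (- 2 * pi * ((v + 1 *\<^sub>R x) \<bullet> \<xi>)) \<partial>lborel)"
    using lborel_integral_affine[of 1 "\<lambda>x. f x * cis (- 2 * pi * (x \<bullet> \<xi>))" v] by (simp add: fourier_lborel)
  also have "\<dots> = (\<integral>x. cis (- 2 * pi * (v \<bullet> \<xi>)) * (f (x + v) * cis (- 2 * pi * (x \<bullet> \<xi>))) \<partial>lborel)"
    by (intro Bochner_Integration.integral_cong refl)
       (simp add: inner_add_left ring_distribs add.commute mult_ac cis_mult)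
  also have "\<dots> = cis (- 2 * pi * (v \<bullet> \<xi>)) * fourier (\<lambda>x. f (x + v)) \<xi>"
    by (simp add: fourier_lborel)
  finally show ?thesis by (simp add: mult.assoc[symmetric] cis_mult)
qed

text \<open>Comparing \<open>f\<close> with its translate by \<open>t b\<close> to second order in \<open>t\<close> avoids integration by parts.\<close>

lemma fourier_partial:
  fixes f :: "'a::euclidean_space \<Rightarrow> complex"
  assumes f: "f \<in> schwartz" and b: "b \<in> Basis"
  shows "fourier (\<lambda>x. frechet_derivative f (at x) b) \<xi> = (2 * pi * \<i>) * of_real (\<xi> \<bullet> b) * fourier f \<xi>"
proof -
  let ?g = "\<lambda>x. frechet_derivative f (at x) b"
  define \<theta> where "\<theta> = 2 * pi * (\<xi> \<bullet> b)"
  \<comment> \<open>The defect of the claimed identity. It does not depend on \<open>t\<close>, so a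
    bound \<open>K * t\<close> for all small positive \<open>t\<close> makes it vanish.\<close>
  define E where "E = fourier ?g \<xi> - \<i> * of_real \<theta> * fourier f \<xi>"
  obtain C where C: "C \<ge> 0" "\<And>x t. 0 \<le> t \<and> t \<le> 1 \<Longrightarrow> norm (f (x + t *\<^sub>R b) - f x - t *\<^sub>R ?g x) \<le> C * t\<^sup>2 * wt x powr - 2"
    using schwartz_taylor_bound[OF f b] by blast
  have g: "?g \<in> schwartz" by (rule schwartz_partial[OF f b])
  have [measurable]: "f \<in> borel_measurable borel" "?g \<in> borel_measurable borel"
    using f g by (auto intro: schwartz_borel_measurable)
  have if': "integrable lborel f" and ig: "integrable lborel ?g" using f g by (auto intro: schwartz_integrable)
  define K where "K = C * wtint TYPE('a) + \<theta>\<^sup>2 / 2 * norm (fourier f \<xi>)"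
  have "norm E \<le> K * t" if t: "0 < t" "t \<le> 1" for t
  proof -
    let ?r = "\<lambda>x. f (x + t *\<^sub>R b) - f x - t *\<^sub>R ?g x"
    have it: "integrable lborel (\<lambda>x. f (x + t *\<^sub>R b))"
      using lborel_integrable_affine[OF _ if', of 1 "t *\<^sub>R b"] by (simp add: add.commute)
    have ir: "integrable lborel ?r" using it if' ig by auto
    have 1: "fourier (\<lambda>x. f (x + t *\<^sub>R b)) \<xi> = cis (t * \<theta>) * fourier f \<xi>"
      by (subst fourier_translate) (auto simp: \<theta>_def inner_commute mult_ac)
    have "fourier ?r \<xi> = fourier (\<lambda>x. f (x + t *\<^sub>R b)) \<xi> - fourier f \<xi> - of_real t * fourier ?g \<xi>"
      using it if' ig by (simp add: fourier_diff scaleR_conv_of_real fourier_cmult)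
    \<comment> \<open>Both terms on the right are of order t^2: one is the Taylor error of the
      exponential, the other the transform of the Taylor error of \<open>f\<close>.\<close>
    then have "of_real t * E = (cis (t * \<theta>) - 1 - \<i> * of_real (t * \<theta>)) * fourier f \<xi> - fourier ?r \<xi>"
      unfolding 1 E_def by (simp only: of_real_mult ring_distribs) (simp add: mult_ac)
    from arg_cong[OF this, of norm]
    have "t * norm E = norm ((cis (t * \<theta>) - 1 - \<i> * of_real (t * \<theta>)) * fourier f \<xi> - fourier ?r \<xi>)"
      using t by (simp only: norm_mult norm_of_real abs_of_pos)
    also have "\<dots> \<le> norm (cis (t * \<theta>) - 1 - \<i> * of_real (t * \<theta>)) * norm (fourier f \<xi>) + norm (fourier ?r \<xi>)"
      unfolding norm_mult[symmetric] by (rule norm_triangle_ineq4)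
    also have "norm (cis (t * \<theta>) - 1 - \<i> * of_real (t * \<theta>)) * norm (fourier f \<xi>) \<le> (t * \<theta>)\<^sup>2 / 2 * norm (fourier f \<xi>)"
      by (intro mult_right_mono norm_cis_taylor) auto
    also have "norm (fourier ?r \<xi>) \<le> C * t\<^sup>2 * wtint TYPE('a)"
      using t by (intro norm_fourier_le_wtint[OF ir] C) auto
    finally have "t * norm E \<le> (K * t) * t"
      by (simp add: K_def power2_eq_square algebra_simps)
    then show ?thesis using t by (simp add: mult.commute)
  qed
  note bound = this
  have "norm E \<le> e" if "e > 0" for e
  proof -
    define t where "t = min 1 (e / (\<bar>K\<bar> + 1))"
    have t: "0 < t" "t \<le> 1" using that by (auto simp: t_def)
    have "K * t \<le> (\<bar>K\<bar> + 1) * t" using t by (intro mult_right_mono) auto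
    also have "\<dots> \<le> (\<bar>K\<bar> + 1) * (e / (\<bar>K\<bar> + 1))" by (intro mult_left_mono) (auto simp: t_def)
    also have "\<dots> = e" by simp
    finally show ?thesis using bound[OF t] by linarith
  qed
  then have "E = 0" using dense_ge[of 0 "norm E"] by auto
  then show ?thesis by (simp add: E_def \<theta>_def mult_ac)
qed

lemma fourier_partial_power:
  assumes f: "f \<in> schwartz" and b: "b \<in> Basis"
  shows "fourier (iter_partial (replicate k b) f) \<xi> = ((2 * pi * \<i>) * of_real (\<xi> \<bullet> b)) ^ k * fourier f \<xi>"
proof (induction k)
  case (Suc k)
  have "iter_partial (replicate k b) f \<in> schwartz" using b by (intro schwartz_iter_partial f) auto
  from fourier_partial[OF this b] Suc show ?case by (simp add: mult.assoc)
qed simp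

text \<open>Only pure k-fold derivatives in single coordinate directions occur, because the largest
  coordinate of \<xi> already controls its norm.\<close>

definition fourier_bound :: "nat \<Rightarrow> ('a::euclidean_space \<Rightarrow> complex) \<Rightarrow> real" where
  "fourier_bound k f = schwartz_seminorm (2 * DIM('a)) [] f
     + (\<Sum>b\<in>Basis. schwartz_seminorm (2 * DIM('a)) (replicate k b) f)"

text \<open>Transforming the k-fold derivative in the direction of the largest coordinate produces k
  factors of that coordinate, and |\<xi>| is at most d times it. The right side is kept explicit in
  finitely many seminorms because continuity of the transformed distribution depends on it.\<close>

lemma fourier_schwartz_decay:
  fixes f :: "'a::euclidean_space \<Rightarrow> complex"
  assumes f: "f \<in> schwartz"
  shows "(1 + norm \<xi>) ^ k * norm (fourier f \<xi>) \<le> (1 + real DIM('a)) ^ k * wtint TYPE('a) * fourier_bound k f"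
proof -
  let ?s = "\<lambda>bs. schwartz_seminorm (2 * DIM('a)) bs f"
  have b: "\<bar>\<xi> \<bullet> b\<bar> ^ k * norm (fourier f \<xi>) \<le> ?s (replicate k b) * wtint TYPE('a)" if "b \<in> Basis" for b
  proof -
    have S: "iter_partial (replicate k b) f \<in> schwartz" using that by (intro schwartz_iter_partial f) auto
    have "1 * \<bar>\<xi> \<bullet> b\<bar> \<le> 2 * pi * \<bar>\<xi> \<bullet> b\<bar>" using pi_gt3 by (intro mult_right_mono) auto
    then have "\<bar>\<xi> \<bullet> b\<bar> ^ k \<le> norm ((2 * pi * \<i>) * of_real (\<xi> \<bullet> b)) ^ k"
      by (intro power_mono) (auto simp: norm_mult)
    then have "\<bar>\<xi> \<bullet> b\<bar> ^ k * norm (fourier f \<xi>) \<le> norm ((2 * pi * \<i>) * of_real (\<xi> \<bullet> b)) ^ k * norm (fourier f \<xi>)"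
      by (rule mult_right_mono) simp
    also have "\<dots> = norm (fourier (iter_partial (replicate k b) f) \<xi>)"
      by (simp only: fourier_partial_power[OF f that] norm_mult norm_power)
    also have "\<dots> \<le> schwartz_seminorm (2 * DIM('a)) [] (iter_partial (replicate k b) f) * wtint TYPE('a)"
      by (rule norm_fourier_schwartz_le[OF S])
    finally show ?thesis by (simp add: schwartz_seminorm_def)
  qed
  define M where "M = Max ((\<lambda>b. \<bar>\<xi> \<bullet> b\<bar>) ` Basis)"
  have M: "\<bar>\<xi> \<bullet> b\<bar> \<le> M" if "b \<in> Basis" for b using that by (auto simp: M_def)
  have "M \<in> (\<lambda>b. \<bar>\<xi> \<bullet> b\<bar>) ` Basis" unfolding M_def by (intro Max_in) auto
  then obtain b0 where b0: "b0 \<in> Basis" "M = \<bar>\<xi> \<bullet> b0\<bar>" by blast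
  have "norm \<xi> \<le> (\<Sum>b\<in>Basis. \<bar>\<xi> \<bullet> b\<bar>)" by (rule norm_le_l1)
  also have "\<dots> \<le> DIM('a) * M" using sum_bounded_above[of Basis "\<lambda>b. \<bar>\<xi> \<bullet> b\<bar>" M] M by auto
  finally have nM: "norm \<xi> \<le> DIM('a) * M" .
  \<comment> \<open>For \<open>M\<close> up to 1 the summand 1 suffices and is matched by the
    underived seminorm; for larger \<open>M\<close> the summand \<open>M ^ k\<close> is matched by
    the k-fold derivative.\<close>
  have "(1 + norm \<xi>) ^ k \<le> (1 + real DIM('a)) ^ k * (1 + M ^ k)"
  proof (cases "M \<le> 1")
    case True
    then have "DIM('a) * M \<le> real DIM('a)" by (simp add: mult_left_le)
    with nM have "1 + norm \<xi> \<le> 1 + real DIM('a)" by linarith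
    then have "(1 + norm \<xi>) ^ k \<le> (1 + real DIM('a)) ^ k * 1"
      unfolding mult_1_right by (intro power_mono) auto
    also have "\<dots> \<le> (1 + real DIM('a)) ^ k * (1 + M ^ k)" using b0 by (intro mult_left_mono) auto
    finally show ?thesis by simp
  next
    case False
    then have "1 + norm \<xi> \<le> (1 + real DIM('a)) * M" using nM by (simp add: algebra_simps)
    then have "(1 + norm \<xi>) ^ k \<le> ((1 + real DIM('a)) * M) ^ k" by (intro power_mono) auto
    also have "\<dots> = (1 + real DIM('a)) ^ k * M ^ k" by (rule power_mult_distrib)
    also have "\<dots> \<le> (1 + real DIM('a)) ^ k * (1 + M ^ k)" by (intro mult_left_mono) auto
    finally show ?thesis by simp
  qed
  then have "(1 + norm \<xi>) ^ k * norm (fourier f \<xi>) \<le> (1 + real DIM('a)) ^ k * (1 + M ^ k) * norm (fourier f \<xi>)"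
    by (rule mult_right_mono) simp
  also have "\<dots> = (1 + real DIM('a)) ^ k * (norm (fourier f \<xi>) + M ^ k * norm (fourier f \<xi>))"
    by (simp only: ring_distribs mult.assoc mult_1)
  also have "\<dots> \<le> (1 + real DIM('a)) ^ k * (?s [] * wtint TYPE('a) + (\<Sum>b\<in>Basis. ?s (replicate k b)) * wtint TYPE('a))"
  proof (intro mult_left_mono add_mono norm_fourier_schwartz_le f)
    have "M ^ k * norm (fourier f \<xi>) \<le> ?s (replicate k b0) * wtint TYPE('a)" using b[OF b0(1)] b0(2) by simp
    also have "?s (replicate k b0) \<le> (\<Sum>b\<in>Basis. ?s (replicate k b))"
      using b0(1) by (intro member_le_sum schwartz_seminorm_nonneg f) auto
    then have "?s (replicate k b0) * wtint TYPE('a) \<le> (\<Sum>b\<in>Basis. ?s (replicate k b)) * wtint TYPE('a)"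
      by (rule mult_right_mono) simp
    finally show "M ^ k * norm (fourier f \<xi>) \<le> (\<Sum>b\<in>Basis. ?s (replicate k b)) * wtint TYPE('a)" .
  qed auto
  also have "\<dots> = (1 + real DIM('a)) ^ k * wtint TYPE('a) * fourier_bound k f"
    by (simp add: fourier_bound_def algebra_simps)
  finally show ?thesis by simp
qed

text \<open>The image of the Schwartz space is closed under partial derivatives: each is the
  transform of \<open>f\<close> times a linear factor, and that product is again Schwartz.\<close>

lemma fourier_schwartz: "f \<in> schwartz \<Longrightarrow> fourier f \<in> schwartz"
proof -
  have "fourier ` schwartz \<subseteq> (schwartz :: ('a \<Rightarrow> complex) set)"
  proof (rule schwartz_coinduct, safe)
    fix f :: "'a \<Rightarrow> complex" assume f: "f \<in> schwartz"
    have "(\<lambda>x. (- 2 * pi * \<i>) * of_real (x \<bullet> b) * f x) \<in> schwartz" for b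
      by (intro schwartz_tame_mult f tame.intros)
    then show "\<exists>D. (\<forall>x. (fourier f has_derivative D x) (at x)) \<and> (\<forall>b\<in>Basis. (\<lambda>x. D x b) \<in> fourier ` schwartz)"
      by (intro exI[of _ "\<lambda>\<xi> h. fourier (\<lambda>x. (- 2 * pi * \<i>) * of_real (x \<bullet> h) * f x) \<xi>"])
         (auto intro!: schwartz_fourier_has_derivative[OF f, simplified])
    fix k show "\<exists>C. \<forall>x. (1 + norm x) ^ k * norm (fourier f x) \<le> C"
      using fourier_schwartz_decay[OF f] by blast
  qed
  then show "f \<in> schwartz \<Longrightarrow> fourier f \<in> schwartz" by blast
qed

lemma inv_fourier_schwartz: "f \<in> schwartz \<Longrightarrow> inv_fourier f \<in> schwartz"
  using schwartz_reflect[OF fourier_schwartz] by (simp add: inv_fourier_eq[abs_def])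

lemma fourier_fourier_schwartz:
  assumes f: "f \<in> schwartz"
  shows "fourier (fourier f) x = f (- x)"
proof -
  obtain M where "\<And>y. (1 + norm y) ^ 0 * norm (f y) \<le> M" using schwartz_decay[OF f] by blast
  then show ?thesis
    using f has_derivative_continuous[OF schwartz_has_derivative[OF f]]
    by (intro fourier_fourier[of _ M] schwartz_integrable fourier_schwartz) auto
qed

subsection \<open>Locally integrable functions are determined by their distributions\<close>

text \<open>Integrability of \<open>h\<close> against w^(-2) is the growth condition used
  throughout; functions in L^p satisfy it by \<open>Lp_integrable_wt\<close>, and Schwartz functions
  are dominated by multiples of w^(-2).\<close>

lemma integrable_mult_schwartz:
  fixes h :: "'a::euclidean_space \<Rightarrow> complex"
  assumes [measurable]: "h \<in> borel_measurable borel" and h: "integrable lborel (\<lambda>x. norm (h x) * wt x powr - 2)"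
    and g: "g \<in> schwartz"
  shows "integrable lborel (\<lambda>x. h x * g x)"
proof (rule Bochner_Integration.integrable_bound)
  let ?C = "schwartz_seminorm (2 * DIM('a)) [] g"
  show "integrable lborel (\<lambda>x. ?C * (norm (h x) * wt x powr - 2))" by (intro integrable_mult_right h)
  show "AE x in lborel. norm (h x * g x) \<le> norm (?C * (norm (h x) * wt x powr - 2))"
  proof (rule AE_I2)
    fix x
    have "norm (h x * g x) \<le> norm (h x) * (?C * wt x powr - 2)"
      unfolding norm_mult by (intro mult_left_mono schwartz_norm_le_wt g) auto
    also have "\<dots> \<le> norm (?C * (norm (h x) * wt x powr - 2))"
      by (simp add: mult_ac flip: abs_mult)
    finally show "norm (h x * g x) \<le> norm (?C * (norm (h x) * wt x powr - 2))" .
  qed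
  show "(\<lambda>x. h x * g x) \<in> borel_measurable lborel"
    using schwartz_borel_measurable[OF g] by simp
qed

text \<open>Boxes are stable under intersection and generate the Borel sets, so Dynkin's argument
  spreads the vanishing to all Borel sets; uniqueness of densities finishes for the real and the
  imaginary part.\<close>

lemma AE_eq_0_if_box_integrals_0:
  fixes H :: "'a::euclidean_space \<Rightarrow> complex"
  assumes H: "integrable lborel H" and box: "\<And>l u. (\<integral>x. H x * indicator (box l u) x \<partial>lborel) = 0"
  shows "AE x in lborel. H x = 0"
proof -
  have [measurable]: "H \<in> borel_measurable borel" using H by auto
  let ?I = "\<lambda>A. set_lebesgue_integral lborel A H"
  have set_int: "set_integrable lborel A H" if "A \<in> sets borel" for A
    using H that unfolding set_integrable_def by (intro integrable_mult_indicator) auto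
  have I_box: "?I (box l u) = 0" for l u
    using box[of l u] unfolding set_lebesgue_integral_def by (simp add: scaleR_conv_of_real of_real_indicator mult.commute)
  \<comment> \<open>The complement step of the induction needs the integral over the whole space,
    which is the limit over growing boxes.\<close>
  have I_UNIV: "?I UNIV = 0"
  proof -
    have "(\<lambda>n. ?I (box (- (real n *\<^sub>R One)) (real n *\<^sub>R One))) \<longlonglongrightarrow> ?I (\<Union>n::nat. box (- (real n *\<^sub>R One)) (real n *\<^sub>R One))"
    proof (intro set_integral_cont_up set_int incseq_SucI)
      show "box (- (real n *\<^sub>R One)) (real n *\<^sub>R One) \<subseteq> box (- (real (Suc n) *\<^sub>R One)) (real (Suc n) *\<^sub>R (One::'a))" for n
        by (rule subset_box_imp) (auto simp: inner_Basis inner_sum_left)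
    qed auto
    then show ?thesis by (simp add: I_box UN_box_eq_UNIV LIMSEQ_const_iff)
  qed
  have I: "?I A = 0" if "A \<in> sets borel" for A
  proof -
    let ?G = "range (\<lambda>(a, b). box a b :: 'a set)"
    have "Int_stable ?G"
      by (auto simp: Int_stable_def box_Int_box)
    moreover have "?G \<subseteq> Pow UNIV" by simp
    moreover from that have "A \<in> sigma_sets UNIV ?G"
      by (simp add: borel_eq_box)
    ultimately show ?thesis
    proof (induction rule: sigma_sets_induct_disjoint)
      case (basic A) then show ?case using I_box by auto
    next
      case empty show ?case by (simp add: set_lebesgue_integral_def)
    next
      case (compl A)
      then have A: "A \<in> sets borel" by (simp add: borel_eq_box)
      have "?I UNIV = ?I A + ?I (UNIV - A)"
        using set_integral_Un[of A "UNIV - A" lborel H] A set_int[of A] set_int[of "UNIV - A"] by simp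
      then show ?case using compl I_UNIV by simp
    next
      case (union F)
      then have F: "F i \<in> sets borel" for i by (auto simp: borel_eq_box)
      have "?I (\<Union>i. F i) = (\<Sum>i. ?I (F i))"
        using union(1) F by (intro lebesgue_integral_countable_add set_int) (auto simp: disjoint_family_on_def)
      then show ?case using union by simp
    qed
  qed
  have "AE x in lborel. Re (H x) = (\<lambda>_. 0) x"
  proof (rule density_unique_real)
    fix A :: "'a set" assume "A \<in> sets lborel"
    then have A: "A \<in> sets borel" by simp
    have "(\<integral>x. Re (indicator A x *\<^sub>R H x) \<partial>lborel) = Re (?I A)"
      using set_int[OF A] unfolding set_lebesgue_integral_def set_integrable_def by (rule integral_Re)
    then show "(\<integral>x\<in>A. Re (H x) \<partial>lborel) = (\<integral>x\<in>A. 0 \<partial>lborel)"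
      by (simp add: I[OF A]) (simp add: set_lebesgue_integral_def)
  qed (use H in auto)
  moreover have "AE x in lborel. Im (H x) = (\<lambda>_. 0) x"
  proof (rule density_unique_real)
    fix A :: "'a set" assume "A \<in> sets lborel"
    then have A: "A \<in> sets borel" by simp
    have "(\<integral>x. Im (indicator A x *\<^sub>R H x) \<partial>lborel) = Im (?I A)"
      using set_int[OF A] unfolding set_lebesgue_integral_def set_integrable_def by (rule integral_Im)
    then show "(\<integral>x\<in>A. Im (H x) \<partial>lborel) = (\<integral>x\<in>A. 0 \<partial>lborel)"
      by (simp add: I[OF A]) (simp add: set_lebesgue_integral_def)
  qed (use H in auto)
  ultimately show ?thesis by eventually_elim (simp add: complex_eq_iff)
qed

lemma gker_eq: "gker a (z::'a::euclidean_space) = (a / sqrt (2 * pi)) ^ DIM('a) * exp (- (a\<^sup>2 / 2) * (norm z)\<^sup>2)"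
  by (simp add: gker_def gauss_eq power_mult_distrib power_divide)

text \<open>Testing with a fixed Gaussian times a narrow Gaussian kernel centred at \<open>y\<close> and integrating over \<open>y\<close> in a
  box approximates the indicator of the box.\<close>

lemma AE_eq_0_if_schwartz_integrals_0:
  fixes h :: "'a::euclidean_space \<Rightarrow> complex"
  assumes [measurable]: "h \<in> borel_measurable borel" and h: "integrable lborel (\<lambda>x. norm (h x) * wt x powr - 2)"
    and zero: "\<And>g. g \<in> schwartz \<Longrightarrow> (\<integral>x. h x * g x \<partial>lborel) = 0"
  shows "AE x in lborel. h x = 0"
proof -
  let ?G = "\<lambda>x::'a. of_real (exp (- (norm x)\<^sup>2)) :: complex"
  \<comment> \<open>The Gaussian factor makes the function integrable and never vanishes, so
    \<open>H = 0\<close> gives back \<open>h = 0\<close>.\<close>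
  define H where "H = (\<lambda>x. h x * ?G x)"
  have [measurable]: "H \<in> borel_measurable borel" unfolding H_def by measurable
  have H: "integrable lborel H"
    unfolding H_def by (rule integrable_mult_schwartz[OF _ h schwartz_gaussian]) measurable
  have "(\<integral>x. H x * indicator (box l u) x \<partial>lborel) = 0" for l u
  proof -
    let ?B = "indicator (box l u) :: 'a \<Rightarrow> complex"
    have "integrable lborel (\<lambda>x. complex_of_real (indicator (box l u) x))"
      by (intro integrable_of_real integrable_real_indicator) (auto simp: emeasure_lborel_box_eq)
    then have B: "integrable lborel ?B" by (simp add: of_real_indicator)
    have B1: "norm (?B x) \<le> 1" for x by (simp add: indicator_def)
    have bound: "norm (\<integral>y. ?B y * of_real (gker (real (Suc n)) (x - y)) \<partial>lborel) \<le> 1" for n x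
    proof -
      have "ennreal (norm (\<integral>y. ?B y * of_real (gker (real (Suc n)) (x - y)) \<partial>lborel)) \<le> (\<integral>\<^sup>+ y. ennreal (norm (?B y * of_real (gker (real (Suc n)) (x - y)))) \<partial>lborel)"
        by (cases "integrable lborel (\<lambda>y. ?B y * of_real (gker (real (Suc n)) (x - y)))")
           (auto intro!: integral_norm_bound_ennreal simp: not_integrable_integral_eq)
      also have "\<dots> \<le> (\<integral>\<^sup>+ y. ennreal (gker (real (Suc n)) (x - y)) \<partial>lborel)"
        by (intro nn_integral_mono ennreal_leI) (auto simp: norm_mult indicator_def)
      also have "\<dots> = 1" by (rule nn_integral_gker) simp
      finally show ?thesis by simp
    qed
    have "(\<integral>x. H x * (\<integral>y. ?B y * of_real (gker (real (Suc n)) (x - y)) \<partial>lborel) \<partial>lborel) = 0" for n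
    proof -
      define a where "a = real (Suc n)"
      \<comment> \<open>The normalising constant is split off so that the remaining kernel is
        bounded by 1, as \<open>lborel_Fubini_prod\<close> demands.\<close>
      define c :: complex where "c = of_real ((a / sqrt (2 * pi)) ^ DIM('a))"
      define k where "k = (\<lambda>x y::'a. complex_of_real (exp (- (a\<^sup>2 / 2) * (norm (x - y))\<^sup>2)))"
      have gk: "of_real (gker a (x - y)) = c * k x y" for x y
        by (simp add: gker_eq c_def k_def)
      have "(\<integral>x. H x * (\<integral>y. ?B y * k x y \<partial>lborel) \<partial>lborel) = (\<integral>y. (\<integral>x. H x * k x y \<partial>lborel) * ?B y \<partial>lborel)"
        by (rule lborel_Fubini_prod[OF H B]) (auto simp: k_def)
      also have "(\<lambda>y. \<integral>x. H x * k x y \<partial>lborel) = (\<lambda>y. 0)"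
      proof
        fix y
        have "(\<lambda>x. k x y * ?G x) \<in> schwartz"
          unfolding k_def by (intro schwartz_tame_mult schwartz_gaussian tame.gauss) auto
        from zero[OF this] show "(\<integral>x. H x * k x y \<partial>lborel) = 0"
          by (simp add: H_def mult_ac)
      qed
      finally have "c * (\<integral>x. H x * (\<integral>y. ?B y * k x y \<partial>lborel) \<partial>lborel) = 0" by simp
      then show ?thesis
        unfolding a_def[symmetric] gk mult.left_commute[of _ c] integral_mult_right_zero by simp
    qed
    moreover have "(\<lambda>n. \<integral>x. H x * (\<integral>y. ?B y * of_real (gker (real (Suc n)) (x - y)) \<partial>lborel) \<partial>lborel) \<longlonglongrightarrow> (\<integral>x. H x * ?B x \<partial>lborel)"
    proof (rule integral_dominated_convergence[where w = "\<lambda>x. norm (H x)"])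
      \<comment> \<open>Off the boundary, a null set, the indicator is continuous and the Gaussian
        averages converge to it.\<close>
      have "frontier (box l u) \<in> null_sets lborel"
        using negligible_convex_frontier[of "box l u"]
        by (simp add: negligible_iff_null_sets null_sets_completion_iff)
      then have "AE x in lborel. x \<notin> frontier (box l u)" by (rule AE_not_in)
      then show "AE x in lborel. (\<lambda>n. H x * (\<integral>y. ?B y * of_real (gker (real (Suc n)) (x - y)) \<partial>lborel)) \<longlonglongrightarrow> H x * ?B x"
      proof eventually_elim
        case (elim x)
        then have "isCont (indicator (box l u) :: 'a \<Rightarrow> real) x"
          by (simp add: isCont_indicator)
        then have "isCont (\<lambda>x. complex_of_real (indicator (box l u) x)) x"
          by (intro continuous_of_real)
        then have "isCont ?B x" by (simp add: of_real_indicator)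
        then show ?case
          by (intro tendsto_mult_left gker_approx_identity[OF _ B1]) auto
      qed
      show "AE x in lborel. norm (H x * (\<integral>y. ?B y * of_real (gker (real (Suc n)) (x - y)) \<partial>lborel)) \<le> norm (H x)" for n
        using bound by (intro AE_I2) (simp add: norm_mult mult_left_le)
      show "(\<lambda>x. H x * (\<integral>y. ?B y * of_real (gker (real (Suc n)) (x - y)) \<partial>lborel)) \<in> borel_measurable lborel" for n
        by (intro borel_measurable_times lborel.borel_measurable_lebesgue_integral)
           (auto simp: borel_measurable_lborel_pair cong: measurable_cong_sets sets_pair_measure_cong)
    qed (use H in auto)
    ultimately show ?thesis by (simp add: LIMSEQ_const_iff)
  qed
  from AE_eq_0_if_box_integrals_0[OF H this] show ?thesis
    by eventually_elim (simp add: H_def)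
qed

subsection \<open>Continuity on the Schwartz space\<close>

lemma schwartz_seminorm_zero [simp]:
  assumes "set bs \<subseteq> Basis"
  shows "schwartz_seminorm k bs (\<lambda>x. 0) = 0"
proof -
  have "iter_partial bs (\<lambda>x. 0) = (\<lambda>x. 0)" by (induction bs) auto
  then show ?thesis by (simp add: schwartz_seminorm_def)
qed

lemma openin_schwartz_ball:
  assumes "f \<in> schwartz" "set bs \<subseteq> Basis" "e > 0"
  shows "openin schwartz_topology {g \<in> schwartz. schwartz_seminorm k bs (\<lambda>x. g x - f x) < e}"
  unfolding schwartz_topology_def using assms by (intro topology_generated_by_Basis) blast

lemma topspace_schwartz [simp]: "topspace schwartz_topology = (schwartz :: ('a::euclidean_space \<Rightarrow> complex) set)"
proof
  show "topspace schwartz_topology \<subseteq> (schwartz :: ('a \<Rightarrow> complex) set)"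
    unfolding schwartz_topology_def topology_generated_by_topspace by auto
  show "(schwartz :: ('a \<Rightarrow> complex) set) \<subseteq> topspace schwartz_topology"
  proof
    fix f :: "'a \<Rightarrow> complex" assume f: "f \<in> schwartz"
    then have "f \<in> {g \<in> schwartz. schwartz_seminorm 0 [] (\<lambda>x. g x - f x) < 1}" by simp
    then show "f \<in> topspace schwartz_topology"
      using openin_subset[OF openin_schwartz_ball[OF f, of "[]" 1 0]] by auto
  qed
qed

text \<open>Smallness near 0 with respect to a finite set \<open>J\<close> of seminorms is carried
  to every point by linearity: the finitely many subbasic balls centred at \<open>f\<close>
  intersect in an open neighbourhood that \<open>u\<close> maps close to \<open>u f\<close>.\<close>

lemma temperedI:
  assumes ext: "u \<in> extensional schwartz"
    and add: "\<And>f g. f \<in> schwartz \<Longrightarrow> g \<in> schwartz \<Longrightarrow> u (\<lambda>x. f x + g x) = u f + u g"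
    and cmult: "\<And>c f. f \<in> schwartz \<Longrightarrow> u (\<lambda>x. c * f x) = c * u f"
    and J: "finite J" "\<And>k bs. (k, bs) \<in> J \<Longrightarrow> set bs \<subseteq> Basis"
    and cont: "\<And>e. e > 0 \<Longrightarrow> \<exists>d>0. \<forall>g\<in>schwartz. (\<forall>(k, bs)\<in>J. schwartz_seminorm k bs g < d) \<longrightarrow> norm (u g) < e"
  shows "u \<in> tempered"
proof -
  have "continuous_map schwartz_topology euclidean u"
    unfolding continuous_map_def
  proof (intro conjI allI impI)
    fix U assume U: "openin (euclidean :: complex topology) U"
    show "openin schwartz_topology {x \<in> topspace schwartz_topology. u x \<in> U}"
    proof (subst openin_subopen, intro ballI)
      fix f assume "f \<in> {x \<in> topspace schwartz_topology. u x \<in> U}"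
      then have f: "f \<in> schwartz" "u f \<in> U" by auto
      obtain e where e: "e > 0" "ball (u f) e \<subseteq> U" using U f openE by (metis open_openin)
      obtain d where d: "d > 0" "\<And>g. g \<in> schwartz \<Longrightarrow> (\<forall>(k, bs)\<in>J. schwartz_seminorm k bs g < d) \<Longrightarrow> norm (u g) < e"
        using cont[OF e(1)] by blast
      define T where "T = (\<lambda>J. {g \<in> schwartz. \<forall>(k, bs)\<in>J. schwartz_seminorm k bs (\<lambda>x. g x - f x) < d})"
      have "openin schwartz_topology (T J)"
        using J
      proof (induction J)
        case empty
        show ?case unfolding T_def using openin_topspace[of "schwartz_topology :: ('a \<Rightarrow> complex) topology"] by simp
      next
        case (insert j J)
        have "set (snd j) \<subseteq> Basis" using insert.prems[of "fst j" "snd j"] by simp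
        moreover have "T (insert j J) = {g \<in> schwartz. schwartz_seminorm (fst j) (snd j) (\<lambda>x. g x - f x) < d} \<inter> T J"
          by (auto simp: T_def)
        moreover have "openin schwartz_topology (T J)"
          using insert.prems by (intro insert.IH) auto
        ultimately show ?case
          using f d by (auto intro!: openin_Int openin_schwartz_ball)
      qed
      moreover have "f \<in> T J" using f J d by (auto simp: T_def)
      moreover have "T J \<subseteq> {x \<in> topspace schwartz_topology. u x \<in> U}"
      proof
        fix g assume g: "g \<in> T J"
        then have gS: "g \<in> schwartz" by (simp add: T_def)
        have "u (\<lambda>x. g x - f x) = u g - u f"
          using add[OF gS schwartz_cmult[OF f(1), of "-1"]] cmult[OF f(1), of "-1"] by simp
        moreover have "norm (u (\<lambda>x. g x - f x)) < e"
          using g f by (intro d schwartz_diff) (auto simp: T_def)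
        ultimately have "u g \<in> ball (u f) e" by (simp add: dist_norm norm_minus_commute)
        then show "g \<in> {x \<in> topspace schwartz_topology. u x \<in> U}" using e gS by auto
      qed
      ultimately show "\<exists>T. openin schwartz_topology T \<and> f \<in> T \<and> T \<subseteq> {x \<in> topspace schwartz_topology. u x \<in> U}" by blast
    qed
  qed auto
  then show ?thesis using ext add cmult by (simp add: tempered_def)
qed

lemma dist_of_lborel:
  assumes [measurable]: "f \<in> borel_measurable borel" and g: "g \<in> schwartz"
  shows "dist_of f g = (\<integral>x. f x * g x \<partial>lborel)"
proof -
  have [measurable]: "g \<in> borel_measurable borel" by (rule schwartz_borel_measurable[OF g])
  show ?thesis using g by (simp add: dist_of_def integral_completion)
qed

text \<open>Decay of order 2d puts \<open>fourier g\<close> below a multiple of w^(-2), against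
  which \<open>f\<close> is integrable. The multiple is \<open>fourier_bound\<close> up to a
  constant, hence a finite sum of seminorms of \<open>g\<close>, and these form
  \<open>J\<close>.\<close>

lemma fourier_dist_of_tempered:
  fixes f :: "'a::euclidean_space \<Rightarrow> complex"
  assumes [measurable]: "f \<in> borel_measurable borel" and f: "integrable lborel (\<lambda>x. norm (f x) * wt x powr - 2)"
  shows "fourier_dist (dist_of f) \<in> tempered"
proof (rule temperedI)
  have eq: "fourier_dist (dist_of f) g = (\<integral>x. f x * fourier g x \<partial>lborel)" if "g \<in> schwartz" for g
    using that by (simp add: fourier_dist_def dist_of_lborel fourier_schwartz)
  have int: "integrable lborel (\<lambda>x. f x * fourier g x)" if "g \<in> schwartz" for g
    by (rule integrable_mult_schwartz[OF _ f fourier_schwartz[OF that]]) measurable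
  show "fourier_dist (dist_of f) \<in> extensional schwartz" by (simp add: fourier_dist_def)
  show "fourier_dist (dist_of f) (\<lambda>x. g x + g' x) = fourier_dist (dist_of f) g + fourier_dist (dist_of f) g'"
    if "g \<in> schwartz" "g' \<in> schwartz" for g g'
    using that int by (simp add: eq schwartz_add fourier_add schwartz_integrable distrib_left)
  show "fourier_dist (dist_of f) (\<lambda>x. c * g x) = c * fourier_dist (dist_of f) g"
    if "g \<in> schwartz" for c g
    using that by (simp add: eq schwartz_cmult fourier_cmult mult.left_commute)
  let ?k = "2 * DIM('a)"
  define J :: "(nat \<times> 'a list) set" where "J = insert (?k, []) ((\<lambda>b. (?k, replicate ?k b)) ` Basis)"
  show "finite J" by (simp add: J_def)
  show "set bs \<subseteq> Basis" if "(k, bs) \<in> J" for k and bs :: "'a list" using that by (auto simp: J_def)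
  fix e :: real assume e: "e > 0"
  define A where "A = (1 + real DIM('a)) ^ ?k * wtint TYPE('a)"
  define I where "I = (\<integral>x. norm (f x) * wt x powr - 2 \<partial>lborel)"
  have A: "0 \<le> A" and I: "0 \<le> I" unfolding A_def I_def by (auto intro!: integral_nonneg_AE)
  have bound: "norm (fourier_dist (dist_of f) g) \<le> I * A * fourier_bound ?k g" if g: "g \<in> schwartz" for g
  proof -
    have "norm (\<integral>x. f x * fourier g x \<partial>lborel) \<le> (\<integral>x. norm (f x * fourier g x) \<partial>lborel)" by simp
    also have "\<dots> \<le> (\<integral>x. (norm (f x) * wt x powr - 2) * (A * fourier_bound ?k g) \<partial>lborel)"
    proof (intro integral_mono integrable_norm int g integrable_mult_left f)
      fix x
      have "norm (fourier g x) \<le> A * fourier_bound ?k g * wt x powr - 2"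
        using fourier_schwartz_decay[OF g, of x ?k] by (intro decay_imp_le_wt) (auto simp: A_def)
      from mult_left_mono[OF this norm_ge_zero[of "f x"]]
      show "norm (f x * fourier g x) \<le> norm (f x) * wt x powr - 2 * (A * fourier_bound ?k g)"
        by (simp add: norm_mult mult_ac)
    qed
    also have "\<dots> = I * A * fourier_bound ?k g"
      by (simp add: I_def)
    finally show ?thesis by (simp add: eq[OF g])
  qed
  \<comment> \<open>The sum has 1 + d seminorms, with d the dimension here; adding 1 to
    \<open>I * A\<close> keeps the denominator positive and the last inequality strict.\<close>
  define d where "d = e / ((I * A + 1) * (1 + real DIM('a)))"
  have d: "d > 0" using e A I by (auto simp: d_def intro!: divide_pos_pos mult_pos_pos add_nonneg_pos)
  show "\<exists>d>0. \<forall>g\<in>schwartz. (\<forall>(k, bs)\<in>J. schwartz_seminorm k bs g < d) \<longrightarrow> norm (fourier_dist (dist_of f) g) < e"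
  proof (intro exI[of _ d] conjI d ballI impI)
    fix g assume g: "g \<in> schwartz" and "\<forall>(k, bs)\<in>J. schwartz_seminorm k bs g < d"
    then have s: "schwartz_seminorm ?k [] g < d" "\<And>b. b \<in> Basis \<Longrightarrow> schwartz_seminorm ?k (replicate ?k b) g \<le> d"
      by (auto simp: J_def less_imp_le)
    have "(\<Sum>b\<in>Basis. schwartz_seminorm ?k (replicate ?k b) g) \<le> real DIM('a) * d"
      using sum_bounded_above[of Basis "\<lambda>b. schwartz_seminorm ?k (replicate ?k b) g" d] s(2) by simp
    with s(1) have fb: "fourier_bound ?k g < (1 + real DIM('a)) * d"
      by (simp add: fourier_bound_def algebra_simps)
    have "norm (fourier_dist (dist_of f) g) \<le> I * A * fourier_bound ?k g" by (rule bound[OF g])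
    also have "\<dots> \<le> I * A * ((1 + real DIM('a)) * d)" using fb I A by (intro mult_left_mono) auto
    also have "\<dots> < (I * A + 1) * ((1 + real DIM('a)) * d)" using d by (intro mult_strict_right_mono) auto
    also have "\<dots> = e" unfolding d_def using I A by (simp add: field_simps add_nonneg_eq_0_iff)
    finally show "norm (fourier_dist (dist_of f) g) < e" .
  qed
qed

subsection \<open>Interpolation: Paley's inequality\<close>

text \<open>A class on which all integrals are finite, transforms are bounded functions, and
  truncation or multiplication by powers of \<open>wt\<close> with exponent at most 0 does not lead
  outside.\<close>

definition bdd_supp :: "('a::euclidean_space \<Rightarrow> complex) \<Rightarrow> bool" where
  "bdd_supp f \<longleftrightarrow> f \<in> borel_measurable borel \<and> (\<exists>M. \<forall>x. norm (f x) \<le> M) \<and> (\<exists>R. \<forall>x. norm x > R \<longrightarrow> f x = 0)"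

lemma bdd_supp_measurable: "bdd_supp f \<Longrightarrow> f \<in> borel_measurable borel"
  by (simp add: bdd_supp_def)

lemma bdd_supp_mono:
  assumes "bdd_supp f" "g \<in> borel_measurable borel" "\<And>x. norm (g x) \<le> C * norm (f x)"
  shows "bdd_supp g"
proof -
  obtain M R where M: "\<And>x. norm (f x) \<le> M" and R: "\<And>x. norm x > R \<Longrightarrow> f x = 0"
    using assms(1) by (auto simp: bdd_supp_def)
  have "norm (g x) \<le> \<bar>C\<bar> * M" for x
  proof -
    have "norm (g x) \<le> \<bar>C\<bar> * norm (f x)"
      using assms(3)[of x] mult_right_mono[OF abs_ge_self[of C] norm_ge_zero[of "f x"]] by linarith
    also have "\<dots> \<le> \<bar>C\<bar> * M" by (intro mult_left_mono M) auto
    finally show ?thesis .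
  qed
  moreover have "g x = 0" if "norm x > R" for x using assms(3)[of x] R[OF that] by simp
  ultimately show ?thesis using assms(2) unfolding bdd_supp_def by blast
qed

lemma integrable_bounded_support:
  fixes f :: "'a::euclidean_space \<Rightarrow> 'b::{banach, second_countable_topology}"
  assumes [measurable]: "f \<in> borel_measurable borel" and M: "\<And>x. norm (f x) \<le> M" and R: "\<And>x. norm x > R \<Longrightarrow> f x = 0"
  shows "integrable lborel f"
proof (rule Bochner_Integration.integrable_bound)
  have "emeasure lborel (cball (0::'a) R) < \<infinity>" by (intro emeasure_bounded_finite) auto
  then show "integrable lborel (\<lambda>x. M * indicator (cball (0::'a) R) x)"
    by (intro integrable_mult_right integrable_real_indicator) auto
  show "AE x in lborel. norm (f x) \<le> norm (M * indicator (cball 0 R) x)"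
  proof (rule AE_I2)
    fix x
    show "norm (f x) \<le> norm (M * indicator (cball 0 R) x)"
      using M[of x] R[of x] by (cases "norm x > R") (auto simp: indicator_def)
  qed
qed simp

lemma bdd_supp_integrable: "bdd_supp f \<Longrightarrow> integrable lborel f"
  unfolding bdd_supp_def using integrable_bounded_support by blast

lemma bdd_supp_integrable_powr:
  assumes f: "bdd_supp f" and r: "r > 0"
  shows "integrable lborel (\<lambda>x. norm (f x) powr r)"
proof -
  obtain M R where M: "\<And>x. norm (f x) \<le> M" and R: "\<And>x. norm x > R \<Longrightarrow> f x = 0"
    using f by (auto simp: bdd_supp_def)
  have [measurable]: "f \<in> borel_measurable borel" by (rule bdd_supp_measurable[OF f])
  show ?thesis
    using M R r by (intro integrable_bounded_support[of _ "M powr r" R]) (auto intro: powr_mono2)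
qed

text \<open>The function is split at height \<open>l\<close>: the part above \<open>l\<close> is controlled by its \<open>L\<^sup>1\<close> norm and the tail
  of the weight, the part below by Plancherel.\<close>

lemma weak_type_bound:
  fixes g :: "'a::euclidean_space \<Rightarrow> complex"
  assumes g: "bdd_supp g" and l: "l > 0"
  defines "V \<equiv> unit_ball_vol (real DIM('a))"
  shows "(\<integral>\<^sup>+ \<xi>. ennreal (if l \<le> wt \<xi> * norm (fourier g \<xi>) / 2 then wt \<xi> powr - 2 else 0) \<partial>lborel)
     \<le> (\<integral>\<^sup>+ x. ennreal (if l \<le> norm (g x) then 4 * V / l * norm (g x) else 0)
            + ennreal (if norm (g x) \<le> l then (norm (g x))\<^sup>2 / l\<^sup>2 else 0) \<partial>lborel)"
proof -
  have [measurable]: "g \<in> borel_measurable borel" by (rule bdd_supp_measurable[OF g])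
  have V: "0 \<le> V" by (simp add: V_def)
  define g1 where "g1 = (\<lambda>x. if l < norm (g x) then g x else 0)"
  define g2 where "g2 = (\<lambda>x. if l < norm (g x) then 0 else g x)"
  have [measurable]: "g1 \<in> borel_measurable borel" "g2 \<in> borel_measurable borel"
    unfolding g1_def g2_def by measurable
  have b: "bdd_supp g1" "bdd_supp g2"
    by (rule bdd_supp_mono[OF g, of _ 1]; simp add: g1_def g2_def)+
  then have i: "integrable lborel g1" "integrable lborel g2" by (auto intro: bdd_supp_integrable)
  have split: "fourier g \<xi> = fourier g1 \<xi> + fourier g2 \<xi>" for \<xi>
  proof -
    have "g = (\<lambda>x. g1 x + g2 x)" by (auto simp: g1_def g2_def)
    then show ?thesis using fourier_add[OF i] by simp
  qed
  define A where "A = (\<integral>x. norm (g1 x) \<partial>lborel)"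
  have A: "0 \<le> A" "norm (fourier g1 \<xi>) \<le> A" for \<xi>
    unfolding A_def by (auto intro!: integral_nonneg_AE norm_fourier_le i)
  have "(\<integral>\<^sup>+ \<xi>. ennreal (if l \<le> wt \<xi> * norm (fourier g \<xi>) / 2 then wt \<xi> powr - 2 else 0) \<partial>lborel)
    \<le> (\<integral>\<^sup>+ \<xi>. ennreal (if l \<le> wt \<xi> * norm (fourier g1 \<xi>) then wt \<xi> powr - 2 else 0)
          + ennreal (if l \<le> wt \<xi> * norm (fourier g2 \<xi>) then wt \<xi> powr - 2 else 0) \<partial>lborel)"
  proof (intro nn_integral_mono)
    fix \<xi> :: 'a
    \<comment> \<open>The half in the level set pays for the splitting: a sum of at least 2 l has a
      summand of at least l.\<close>
    have "wt \<xi> * norm (fourier g \<xi>) \<le> wt \<xi> * norm (fourier g1 \<xi>) + wt \<xi> * norm (fourier g2 \<xi>)"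
      unfolding split distrib_left[symmetric] using wt_pos[of \<xi>] by (intro mult_left_mono norm_triangle_ineq) auto
    then show "ennreal (if l \<le> wt \<xi> * norm (fourier g \<xi>) / 2 then wt \<xi> powr - 2 else 0)
      \<le> ennreal (if l \<le> wt \<xi> * norm (fourier g1 \<xi>) then wt \<xi> powr - 2 else 0)
          + ennreal (if l \<le> wt \<xi> * norm (fourier g2 \<xi>) then wt \<xi> powr - 2 else 0)"
      by (auto simp: add_increasing add_increasing2)
  qed
  also have "\<dots> = (\<integral>\<^sup>+ \<xi>. ennreal (if l \<le> wt \<xi> * norm (fourier g1 \<xi>) then wt \<xi> powr - 2 else 0) \<partial>lborel)
          + (\<integral>\<^sup>+ \<xi>. ennreal (if l \<le> wt \<xi> * norm (fourier g2 \<xi>) then wt \<xi> powr - 2 else 0) \<partial>lborel)"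
    by (rule nn_integral_add) measurable
  also have "\<dots> \<le> (\<integral>\<^sup>+ x. ennreal (if l \<le> norm (g x) then 4 * V / l * norm (g x) else 0) \<partial>lborel)
            + (\<integral>\<^sup>+ x. ennreal (if norm (g x) \<le> l then (norm (g x))\<^sup>2 / l\<^sup>2 else 0) \<partial>lborel)"
  proof (rule add_mono)
    have "(\<integral>\<^sup>+ \<xi>. ennreal (if l \<le> wt \<xi> * norm (fourier g1 \<xi>) then wt \<xi> powr - 2 else 0) \<partial>lborel) \<le> ennreal (4 * V / l * A)"
    \<comment> \<open>The level \<open>l / (2 * A)\<close> used below is meaningless for
      \<open>A = 0\<close>; there the transform of \<open>g1\<close> vanishes, and
      \<open>l > 0\<close> makes the set empty.\<close>
    proof (cases "A = 0")
      case True
      then have "fourier g1 \<xi> = 0" for \<xi> using A(2)[of \<xi>] by simp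
      then show ?thesis using l by (simp add: True)
    next
      case False
      then have A0: "A > 0" using A by simp
      have "(\<integral>\<^sup>+ \<xi>. ennreal (if l \<le> wt \<xi> * norm (fourier g1 \<xi>) then wt \<xi> powr - 2 else 0) \<partial>lborel)
        \<le> (\<integral>\<^sup>+ \<xi>. indicator {\<xi>. l / (2 * A) < wt \<xi>} \<xi> * ennreal (wt \<xi> powr - 2) \<partial>(lborel :: 'a measure))"
      proof (intro nn_integral_mono)
        fix \<xi> :: 'a
        \<comment> \<open>The factor 2 gains the strict inequality that \<open>wt_tail\<close> is
          stated for; it turns its constant 2 V into 4 V.\<close>
        have "l / (2 * A) < wt \<xi>" if "l \<le> wt \<xi> * norm (fourier g1 \<xi>)"
        proof -
          have "l \<le> wt \<xi> * A" using that mult_left_mono[OF A(2)[of \<xi>], of "wt \<xi>"] wt_pos[of \<xi>] by linarith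
          also have "\<dots> < wt \<xi> * (2 * A)" using A0 wt_pos[of \<xi>] by simp
          finally show ?thesis using A0 by (simp add: divide_less_eq)
        qed
        then show "ennreal (if l \<le> wt \<xi> * norm (fourier g1 \<xi>) then wt \<xi> powr - 2 else 0)
          \<le> indicator {\<xi>. l / (2 * A) < wt \<xi>} \<xi> * ennreal (wt \<xi> powr - 2)"
          by simp
      qed
      also have "\<dots> \<le> ennreal (2 * V / (l / (2 * A)))"
        unfolding V_def using l A0 by (intro wt_tail) auto
      finally show ?thesis by (simp add: field_simps)
    qed
    also have "\<dots> = (\<integral>\<^sup>+ x. ennreal (4 * V / l * norm (g1 x)) \<partial>lborel)"
      unfolding A_def using V l i(1) by (subst nn_integral_eq_integral) auto
    also have "\<dots> \<le> (\<integral>\<^sup>+ x. ennreal (if l \<le> norm (g x) then 4 * V / l * norm (g x) else 0) \<partial>lborel)"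
      by (intro nn_integral_mono) (auto simp: g1_def)
    finally show "(\<integral>\<^sup>+ \<xi>. ennreal (if l \<le> wt \<xi> * norm (fourier g1 \<xi>) then wt \<xi> powr - 2 else 0) \<partial>lborel) \<le> \<dots>" .
    have "(\<integral>\<^sup>+ \<xi>. ennreal (if l \<le> wt \<xi> * norm (fourier g2 \<xi>) then wt \<xi> powr - 2 else 0) \<partial>lborel)
       \<le> (\<integral>\<^sup>+ \<xi>. ennreal (1 / l\<^sup>2) * ennreal ((norm (fourier g2 \<xi>))\<^sup>2) \<partial>lborel)"
    proof (intro nn_integral_mono)
      fix \<xi> :: 'a
      \<comment> \<open>Chebyshev's inequality for the square. The weight inside the product cancels
        the density w^(-2), so unweighted Plancherel applies.\<close>
      have "wt \<xi> powr - 2 \<le> 1 / l\<^sup>2 * (norm (fourier g2 \<xi>))\<^sup>2" if "l \<le> wt \<xi> * norm (fourier g2 \<xi>)"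
      proof -
        have "l\<^sup>2 \<le> (wt \<xi> * norm (fourier g2 \<xi>))\<^sup>2" using that l by (intro power_mono) auto
        then have "1 / (wt \<xi>)\<^sup>2 \<le> 1 / l\<^sup>2 * (norm (fourier g2 \<xi>))\<^sup>2"
          using l wt_pos[of \<xi>] by (simp add: power_mult_distrib divide_simps mult_ac)
        then show ?thesis using wt_pos[of \<xi>] by (simp add: powr_minus_divide)
      qed
      then show "ennreal (if l \<le> wt \<xi> * norm (fourier g2 \<xi>) then wt \<xi> powr - 2 else 0) \<le> ennreal (1 / l\<^sup>2) * ennreal ((norm (fourier g2 \<xi>))\<^sup>2)"
        by (auto simp: ennreal_mult'[symmetric] intro!: ennreal_leI)
    qed
    also have "\<dots> = ennreal (1 / l\<^sup>2) * (\<integral>\<^sup>+ \<xi>. ennreal ((norm (fourier g2 \<xi>))\<^sup>2) \<partial>lborel)"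
      by (rule nn_integral_cmult) measurable
    also have "\<dots> \<le> ennreal (1 / l\<^sup>2) * (\<integral>\<^sup>+ x. ennreal ((norm (g2 x))\<^sup>2) \<partial>lborel)"
      by (intro mult_left_mono nn_integral_fourier_power2_le i) auto
    also have "\<dots> = (\<integral>\<^sup>+ x. ennreal (1 / l\<^sup>2) * ennreal ((norm (g2 x))\<^sup>2) \<partial>lborel)"
      by (rule nn_integral_cmult[symmetric]) measurable
    also have "\<dots> \<le> (\<integral>\<^sup>+ x. ennreal (if norm (g x) \<le> l then (norm (g x))\<^sup>2 / l\<^sup>2 else 0) \<partial>lborel)"
      by (intro nn_integral_mono) (auto simp: g2_def ennreal_mult'[symmetric])
    finally show "(\<integral>\<^sup>+ \<xi>. ennreal (if l \<le> wt \<xi> * norm (fourier g2 \<xi>) then wt \<xi> powr - 2 else 0) \<partial>lborel) \<le> \<dots>" .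
  qed
  also have "\<dots> = (\<integral>\<^sup>+ x. ennreal (if l \<le> norm (g x) then 4 * V / l * norm (g x) else 0)
            + ennreal (if norm (g x) \<le> l then (norm (g x))\<^sup>2 / l\<^sup>2 else 0) \<partial>lborel)"
    by (rule nn_integral_add[symmetric]) measurable
  finally show ?thesis .
qed

text \<open>Integrates over the level \<open>l\<close> the contribution of the part above the split;
  \<open>q > 1\<close> gives convergence at 0.\<close>

lemma nn_integral_cutoff_le:
  assumes "q > 1"
  shows "(\<integral>\<^sup>+ l. ennreal (if 0 \<le> l \<and> l \<le> a then l powr (q - 2) * a else 0) \<partial>lborel) = ennreal (if 0 \<le> a then a powr q / (q - 1) else 0)"
proof (cases "0 \<le> a")
  case True
  have "(\<integral>\<^sup>+ l. ennreal (if 0 \<le> l \<and> l \<le> a then l powr (q - 2) * a else 0) \<partial>lborel)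
     = (\<integral>\<^sup>+ l. ennreal a * (indicator {0..a} l * ennreal (l powr (q - 2))) \<partial>lborel)"
    using True by (intro nn_integral_cong) (auto simp: ennreal_mult' mult.commute)
  also have "\<dots> = ennreal a * ennreal (a powr (q - 1) / (q - 1))"
    using nn_integral_powr_from_0[of "q - 2" a] assms True by (subst nn_integral_cmult) auto
  also have "\<dots> = ennreal (a powr q / (q - 1))"
  proof -
    have "a * a powr (q - 1) = a powr q" using True powr_mult_base[of a "q - 1"] by simp
    then show ?thesis using True by (simp add: ennreal_mult'[symmetric])
  qed
  finally show ?thesis using True by simp
next
  case False
  then have "(if 0 \<le> l \<and> l \<le> a then l powr (q - 2) * a else 0) = 0" for l by auto
  then show ?thesis using False by simp
qed

text \<open>The counterpart for the part below the split; \<open>q < 2\<close> gives convergence at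
  infinity. The case \<open>a = 0\<close> is separate because the tail formula needs a positive
  endpoint.\<close>

lemma nn_integral_cutoff_ge:
  assumes "q < 2" "a \<ge> 0"
  shows "(\<integral>\<^sup>+ l. ennreal (if 0 \<le> l \<and> a \<le> l then l powr (q - 3) * a\<^sup>2 else 0) \<partial>lborel) = ennreal (a powr q / (2 - q))"
proof (cases "a = 0")
  case False
  then have a: "a > 0" using assms by simp
  have "(\<integral>\<^sup>+ l. ennreal (if 0 \<le> l \<and> a \<le> l then l powr (q - 3) * a\<^sup>2 else 0) \<partial>lborel)
     = (\<integral>\<^sup>+ l. ennreal (a\<^sup>2) * (indicator {a..} l * ennreal (l powr (q - 3))) \<partial>lborel)"
    using a by (intro nn_integral_cong) (auto simp: ennreal_mult' mult.commute)
  also have "\<dots> = ennreal (a\<^sup>2) * ennreal (- (a powr (q - 2) / (q - 2)))"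
    using nn_integral_powr_to_inf[of "q - 3" a] assms a by (subst nn_integral_cmult) auto
  also have "\<dots> = ennreal (a powr q / (2 - q))"
  proof -
    have "a\<^sup>2 * a powr (q - 2) = a powr 2 * a powr (q - 2)" using a by simp
    also have "\<dots> = a powr q" unfolding powr_add[symmetric] by simp
    finally have "a\<^sup>2 * a powr (q - 2) = a powr q" .
    moreover have "- (a powr (q - 2) / (q - 2)) = a powr (q - 2) / (2 - q)"
      using assms by (simp add: field_simps)
    ultimately show ?thesis by (simp add: ennreal_mult'[symmetric])
  qed
  finally show ?thesis .
next
  case True
  then have "(\<lambda>l. ennreal (if 0 \<le> l \<and> a \<le> l then l powr (q - 3) * a\<^sup>2 else 0)) = (\<lambda>l. 0)" by auto
  then show ?thesis using True by (simp only: nn_integral_const) simp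
qed

text \<open>With s = w |fourier g| / 2 the left integrand is 2^q s^q w^(-2). Layer cake in s, the
  weak bound with the split height equal to the level, and Tonelli leave two one-dimensional
  integrals. The exponent 2 is Plancherel itself and is taken apart because the interpolation
  constant q / (2 - q) blows up there.\<close>

lemma paley_inequality:
  assumes q: "1 < q" "q \<le> 2"
  shows "\<exists>C>0. \<forall>g :: 'a::euclidean_space \<Rightarrow> complex. bdd_supp g \<longrightarrow>
    (\<integral>\<^sup>+ \<xi>. ennreal (norm (fourier g \<xi>) powr q * wt \<xi> powr (q - 2)) \<partial>lborel) \<le> ennreal C * (\<integral>\<^sup>+ x. ennreal (norm (g x) powr q) \<partial>lborel)"
proof (cases "q = 2")
  case True
  show ?thesis
  proof (intro exI[of _ 1] conjI allI impI)
    fix g :: "'a \<Rightarrow> complex" assume g: "bdd_supp g"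
    have "norm (fourier g \<xi>) powr q * wt \<xi> powr (q - 2) = (norm (fourier g \<xi>))\<^sup>2" "norm (g \<xi>) powr q = (norm (g \<xi>))\<^sup>2" for \<xi>
      using wt_pos[of \<xi>] unfolding True by simp_all
    then show "(\<integral>\<^sup>+ \<xi>. ennreal (norm (fourier g \<xi>) powr q * wt \<xi> powr (q - 2)) \<partial>lborel) \<le> ennreal 1 * (\<integral>\<^sup>+ x. ennreal (norm (g x) powr q) \<partial>lborel)"
      using nn_integral_fourier_power2_le[OF bdd_supp_integrable[OF g]] by (simp only: ennreal_1 mult_1)
  qed simp
next
  case False
  then have q2: "q < 2" using q by simp
  define V where "V = unit_ball_vol (real DIM('a))"
  have V: "0 < V" by (simp add: V_def)
  \<comment> \<open>The power of 2 comes from the half in \<open>s\<close>; the summands come from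
    \<open>nn_integral_cutoff_le\<close> and \<open>nn_integral_cutoff_ge\<close> with the factors
    \<open>4 * V * q\<close> and \<open>q\<close>.\<close>
  define C where "C = 2 powr q * (4 * V * q / (q - 1) + q / (2 - q))"
  have "0 < C" unfolding C_def using V q q2 by (intro mult_pos_pos add_pos_pos divide_pos_pos) auto
  moreover have "(\<integral>\<^sup>+ \<xi>. ennreal (norm (fourier g \<xi>) powr q * wt \<xi> powr (q - 2)) \<partial>lborel) \<le> ennreal C * (\<integral>\<^sup>+ x. ennreal (norm (g x) powr q) \<partial>lborel)"
    if g: "bdd_supp g" for g :: "'a \<Rightarrow> complex"
  proof -
    have [measurable]: "g \<in> borel_measurable borel" by (rule bdd_supp_measurable[OF g])
    define s where "s = (\<lambda>\<xi>. wt \<xi> * norm (fourier g \<xi>) / 2)"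
    have s: "0 \<le> s \<xi>" for \<xi> using wt_pos[of \<xi>] by (simp add: s_def)
    have [measurable]: "s \<in> borel_measurable borel" unfolding s_def by measurable
    \<comment> \<open>The right side of \<open>weak_type_bound\<close> at height \<open>l\<close>,
      multiplied by the layer-cake density q l^(q-1).\<close>
    define F where "F = (\<lambda>l (x::'a). ennreal (4 * V * q) * ennreal (if 0 \<le> l \<and> l \<le> norm (g x) then l powr (q - 2) * norm (g x) else 0)
        + ennreal q * ennreal (if 0 \<le> l \<and> norm (g x) \<le> l then l powr (q - 3) * (norm (g x))\<^sup>2 else 0))"
    have "(\<integral>\<^sup>+ \<xi>. ennreal (norm (fourier g \<xi>) powr q * wt \<xi> powr (q - 2)) \<partial>lborel) =
      (\<integral>\<^sup>+ \<xi>. ennreal (2 powr q) * ennreal (s \<xi> powr q * wt \<xi> powr - 2) \<partial>lborel)"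
    proof (intro nn_integral_cong)
      fix \<xi> :: 'a
      have "norm (fourier g \<xi>) powr q * wt \<xi> powr (q - 2) = norm (fourier g \<xi>) powr q * (wt \<xi> powr q * wt \<xi> powr - 2)"
        by (simp add: powr_add[symmetric])
      also have "\<dots> = (2 * s \<xi>) powr q * wt \<xi> powr - 2"
        using wt_pos[of \<xi>] by (simp add: s_def powr_mult mult_ac)
      also have "\<dots> = 2 powr q * (s \<xi> powr q * wt \<xi> powr - 2)"
        using s[of \<xi>] by (simp add: powr_mult)
      finally show "ennreal (norm (fourier g \<xi>) powr q * wt \<xi> powr (q - 2)) = ennreal (2 powr q) * ennreal (s \<xi> powr q * wt \<xi> powr - 2)"
        by (simp add: ennreal_mult'[symmetric])
    qed
    also have "\<dots> = ennreal (2 powr q) * (\<integral>\<^sup>+ \<xi>. ennreal (s \<xi> powr q * wt \<xi> powr - 2) \<partial>lborel)"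
      by (rule nn_integral_cmult) measurable
    also have "(\<integral>\<^sup>+ \<xi>. ennreal (s \<xi> powr q * wt \<xi> powr - 2) \<partial>lborel) =
      (\<integral>\<^sup>+ \<xi>. \<integral>\<^sup>+ l. ennreal (if 0 \<le> l \<and> l \<le> s \<xi> then q * l powr (q - 1) * wt \<xi> powr - 2 else 0) \<partial>lborel \<partial>lborel)"
    proof (intro nn_integral_cong)
      fix \<xi> :: 'a
      have "(\<integral>\<^sup>+ l. ennreal (if 0 \<le> l \<and> l \<le> s \<xi> then q * l powr (q - 1) * wt \<xi> powr - 2 else 0) \<partial>lborel)
        = (\<integral>\<^sup>+ l. ennreal (q * wt \<xi> powr - 2) * (indicator {0..s \<xi>} l * ennreal (l powr (q - 1))) \<partial>lborel)"
        using q by (intro nn_integral_cong) (auto simp: ennreal_mult'[symmetric] mult_ac)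
      also have "\<dots> = ennreal (q * wt \<xi> powr - 2) * ennreal (s \<xi> powr q / q)"
        using nn_integral_powr_from_0[of "q - 1" "s \<xi>"] q s by (subst nn_integral_cmult) auto
      also have "\<dots> = ennreal (s \<xi> powr q * wt \<xi> powr - 2)"
        using q by (simp add: ennreal_mult'[symmetric])
      finally show "ennreal (s \<xi> powr q * wt \<xi> powr - 2) = (\<integral>\<^sup>+ l. ennreal (if 0 \<le> l \<and> l \<le> s \<xi> then q * l powr (q - 1) * wt \<xi> powr - 2 else 0) \<partial>lborel)" ..
    qed
    also have "\<dots> = (\<integral>\<^sup>+ l. \<integral>\<^sup>+ \<xi>. ennreal (if 0 \<le> l \<and> l \<le> s \<xi> then q * l powr (q - 1) * wt \<xi> powr - 2 else 0) \<partial>lborel \<partial>lborel)"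
      by (rule lborel_Fubini_nn_integral) measurable
    also have "\<dots> \<le> (\<integral>\<^sup>+ l. \<integral>\<^sup>+ x. F l x \<partial>lborel \<partial>lborel)"
    proof (rule nn_integral_mono)
      fix l :: real
      show "(\<integral>\<^sup>+ \<xi>. ennreal (if 0 \<le> l \<and> l \<le> s \<xi> then q * l powr (q - 1) * wt \<xi> powr - 2 else 0) \<partial>lborel) \<le> (\<integral>\<^sup>+ x. F l x \<partial>lborel)"
      proof (cases "l > 0")
        \<comment> \<open>At \<open>l = 0\<close> the integrand vanishes because
          \<open>0 powr (q - 1)\<close> is 0.\<close>
        case False
        then have "(if 0 \<le> l \<and> l \<le> s \<xi> then q * l powr (q - 1) * wt \<xi> powr - 2 else 0) = 0" for \<xi> by auto
        then show ?thesis by simp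
      next
        case True
        have "(\<integral>\<^sup>+ \<xi>. ennreal (if 0 \<le> l \<and> l \<le> s \<xi> then q * l powr (q - 1) * wt \<xi> powr - 2 else 0) \<partial>lborel)
          = (\<integral>\<^sup>+ \<xi>. ennreal (q * l powr (q - 1)) * ennreal (if l \<le> s \<xi> then wt \<xi> powr - 2 else 0) \<partial>lborel)"
          using True q by (intro nn_integral_cong) (auto simp: ennreal_mult'[symmetric])
        also have "\<dots> = ennreal (q * l powr (q - 1)) * (\<integral>\<^sup>+ \<xi>. ennreal (if l \<le> s \<xi> then wt \<xi> powr - 2 else 0) \<partial>lborel)"
          by (rule nn_integral_cmult) measurable
        also have "\<dots> \<le> ennreal (q * l powr (q - 1)) * (\<integral>\<^sup>+ x. ennreal (if l \<le> norm (g x) then 4 * V / l * norm (g x) else 0)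
            + ennreal (if norm (g x) \<le> l then (norm (g x))\<^sup>2 / l\<^sup>2 else 0) \<partial>lborel)"
          unfolding s_def V_def by (intro mult_left_mono weak_type_bound g True) auto
        also have "\<dots> = (\<integral>\<^sup>+ x. ennreal (q * l powr (q - 1)) * (ennreal (if l \<le> norm (g x) then 4 * V / l * norm (g x) else 0)
            + ennreal (if norm (g x) \<le> l then (norm (g x))\<^sup>2 / l\<^sup>2 else 0)) \<partial>lborel)"
          by (rule nn_integral_cmult[symmetric]) measurable
        also have "\<dots> = (\<integral>\<^sup>+ x. F l x \<partial>lborel)"
        proof (intro nn_integral_cong)
          fix x :: 'a
          have 1: "l powr (q - 1) / l = l powr (q - 2)" "l powr (q - 1) / l\<^sup>2 = l powr (q - 3)"
            using True powr_diff[of l "q - 1" 1] powr_diff[of l "q - 1" 2] by simp_all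
          have 2: "q * l powr (q - 1) * (4 * V / l * norm (g x)) = 4 * V * q * (l powr (q - 2) * norm (g x))"
            "q * l powr (q - 1) * ((norm (g x))\<^sup>2 / l\<^sup>2) = q * (l powr (q - 3) * (norm (g x))\<^sup>2)"
            unfolding 1[symmetric] by simp_all
          show "ennreal (q * l powr (q - 1)) * (ennreal (if l \<le> norm (g x) then 4 * V / l * norm (g x) else 0)
            + ennreal (if norm (g x) \<le> l then (norm (g x))\<^sup>2 / l\<^sup>2 else 0)) = F l x"
            unfolding F_def distrib_left
          proof (rule arg_cong2[where f="(+)"])
            show "ennreal (q * l powr (q - 1)) * ennreal (if l \<le> norm (g x) then 4 * V / l * norm (g x) else 0) =
              ennreal (4 * V * q) * ennreal (if 0 \<le> l \<and> l \<le> norm (g x) then l powr (q - 2) * norm (g x) else 0)"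
              using True q V 2(1) by (cases "l \<le> norm (g x)") (simp_all add: ennreal_mult'[symmetric])
            show "ennreal (q * l powr (q - 1)) * ennreal (if norm (g x) \<le> l then (norm (g x))\<^sup>2 / l\<^sup>2 else 0) =
              ennreal q * ennreal (if 0 \<le> l \<and> norm (g x) \<le> l then l powr (q - 3) * (norm (g x))\<^sup>2 else 0)"
              using True q V 2(2) by (cases "norm (g x) \<le> l") (simp_all add: ennreal_mult'[symmetric])
          qed
        qed
        finally show ?thesis .
      qed
    qed
    also have "\<dots> = (\<integral>\<^sup>+ x. \<integral>\<^sup>+ l. F l x \<partial>lborel \<partial>lborel)"
      by (rule lborel_Fubini_nn_integral) (unfold F_def, measurable)
    also have "\<dots> = (\<integral>\<^sup>+ x. ennreal (4 * V * q / (q - 1) + q / (2 - q)) * ennreal (norm (g x) powr q) \<partial>lborel)"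
    proof (intro nn_integral_cong)
      fix x :: 'a
      have "(\<integral>\<^sup>+ l. F l x \<partial>lborel) = ennreal (4 * V * q) * ennreal (norm (g x) powr q / (q - 1)) + ennreal q * ennreal (norm (g x) powr q / (2 - q))"
        unfolding F_def using q q2
        by (subst nn_integral_add) (auto simp: nn_integral_cmult nn_integral_cutoff_le nn_integral_cutoff_ge)
      also have "\<dots> = ennreal (4 * V * q / (q - 1) + q / (2 - q)) * ennreal (norm (g x) powr q)"
        using q q2 V by (simp add: ennreal_mult'[symmetric] ennreal_plus[symmetric] ring_distribs del: ennreal_plus)
      finally show "(\<integral>\<^sup>+ l. F l x \<partial>lborel) = ennreal (4 * V * q / (q - 1) + q / (2 - q)) * ennreal (norm (g x) powr q)" .
    qed
    also have "\<dots> = ennreal (4 * V * q / (q - 1) + q / (2 - q)) * (\<integral>\<^sup>+ x. ennreal (norm (g x) powr q) \<partial>lborel)"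
      by (rule nn_integral_cmult) measurable
    finally show ?thesis
      unfolding C_def by (simp add: ennreal_mult' mult.assoc mult_left_mono)
  qed
  ultimately show ?thesis by blast
qed

subsection \<open>Duality\<close>

lemma wt_powr_le_1: "e \<le> 0 \<Longrightarrow> wt x powr e \<le> 1"
  using powr_mono[of e 0 "wt x"] wt_ge_1[of x] wt_pos[of x] by simp

lemma bdd_supp_wt_mult:
  assumes f: "bdd_supp f" and e: "e \<le> 0"
  shows "bdd_supp (\<lambda>x. of_real (wt x powr e) * f x)"
proof (rule bdd_supp_mono[OF f, of _ 1])
  have [measurable]: "f \<in> borel_measurable borel" by (rule bdd_supp_measurable[OF f])
  show "(\<lambda>x. of_real (wt x powr e) * f x) \<in> borel_measurable borel" by measurable
  show "norm (of_real (wt x powr e) * f x) \<le> 1 * norm (f x)" for x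
    using wt_powr_le_1[OF e, of x] by (simp add: norm_mult mult_left_le_one_le)
qed

text \<open>The truncated p-th power integral \<open>X\<close> of the transform is written as a
  pairing with its extremal function \<open>g\<close>. Moving the transform to \<open>g\<close>,
  then Young's and Paley's inequalities, bound \<open>X\<close> by a multiple of the p-th power
  integral of \<open>f\<close> plus \<open>X / 2\<close>, and the last term is absorbed.\<close>

lemma weighted_fourier_bound:
  assumes p: "2 \<le> p"
  shows "\<exists>C>0. \<forall>f :: 'a::euclidean_space \<Rightarrow> complex. bdd_supp f \<longrightarrow>
    (\<integral>\<^sup>+ \<xi>. ennreal (norm (fourier (\<lambda>x. of_real (wt x powr (2 / p - 1)) * f x) \<xi>) powr p) \<partial>lborel)
      \<le> ennreal C * (\<integral>\<^sup>+ x. ennreal (norm (f x) powr p) \<partial>lborel)"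
proof -
  define q where "q = p / (p - 1)"
  \<comment> \<open>The fourth identity turns |g|^q into |h|^p for the test function below; the
    fifth turns the Bessel weight into Paley's.\<close>
  have q: "1 < q" "q \<le> 2" "1 / p + 1 / q = 1" "(p - 1) * q = p" "(2 / p - 1) * q = q - 2"
    using p by (auto simp: q_def field_simps)
  obtain C0 where C0: "C0 > 0" and paley: "\<And>g :: 'a \<Rightarrow> complex. bdd_supp g \<Longrightarrow>
    (\<integral>\<^sup>+ \<xi>. ennreal (norm (fourier g \<xi>) powr q * wt \<xi> powr (q - 2)) \<partial>lborel) \<le> ennreal C0 * (\<integral>\<^sup>+ x. ennreal (norm (g x) powr q) \<partial>lborel)"
    using paley_inequality[OF q(1,2)] by blast
  (* With this A the Young inequality below leaves a term in g that is half of the left-hand side. *)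
  define A where "A = (2 * C0) powr (1 / q)"
  have A: "A > 0" "A powr q = 2 * C0" using C0 q by (auto simp: A_def powr_powr)
  have e: "2 / p - 1 \<le> 0" using p by simp
  have "(\<integral>\<^sup>+ \<xi>. ennreal (norm (fourier (\<lambda>x. of_real (wt x powr (2 / p - 1)) * f x) \<xi>) powr p) \<partial>lborel)
      \<le> ennreal (2 * A powr p) * (\<integral>\<^sup>+ x. ennreal (norm (f x) powr p) \<partial>lborel)"
    if f: "bdd_supp f" for f :: "'a \<Rightarrow> complex"
  proof (rule nn_integral_lim_le)
    define u where "u = (\<lambda>x. of_real (wt x powr (2 / p - 1)) * f x)"
    have u: "bdd_supp u" unfolding u_def by (rule bdd_supp_wt_mult[OF f e])
    then have ui: "integrable lborel u" by (rule bdd_supp_integrable)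
    define h where "h = fourier u"
    define M where "M = (\<integral>x. norm (u x) \<partial>lborel)"
    have M: "norm (h \<xi>) \<le> M" for \<xi> unfolding h_def M_def by (rule norm_fourier_le[OF ui])
    have [measurable]: "u \<in> borel_measurable borel" "f \<in> borel_measurable borel"
      by (auto intro: bdd_supp_measurable f u)
    have [measurable]: "h \<in> borel_measurable borel" unfolding h_def by measurable
    have fi: "integrable lborel (\<lambda>x. norm (f x) powr p)" using p by (intro bdd_supp_integrable_powr f) auto
    define Fp where "Fp = (\<integral>x. norm (f x) powr p \<partial>lborel)"
    have Fp: "(\<integral>\<^sup>+ x. ennreal (norm (f x) powr p) \<partial>lborel) = ennreal Fp" "0 \<le> Fp"
      unfolding Fp_def using fi by (auto intro: nn_integral_eq_integral integral_nonneg_AE)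
    let ?k = "\<lambda>n x. if norm (x::'a) \<le> real n then norm (h x) powr p else 0"
    show "(\<lambda>x. ennreal (?k n x)) \<in> borel_measurable lborel" for n by measurable
    show "AE x in lborel. (\<lambda>n. ennreal (?k n x)) \<longlonglongrightarrow> ennreal (norm (fourier (\<lambda>x. of_real (wt x powr (2 / p - 1)) * f x) x) powr p)"
    proof (rule AE_I2)
      fix x :: 'a
      obtain N :: nat where "norm x \<le> real N" using real_arch_simple by blast
      then have "\<forall>\<^sub>F n in sequentially. ennreal (?k n x) = ennreal (norm (h x) powr p)"
        by (intro eventually_sequentiallyI[of N]) auto
      then show "(\<lambda>n. ennreal (?k n x)) \<longlonglongrightarrow> ennreal (norm (fourier (\<lambda>x. of_real (wt x powr (2 / p - 1)) * f x) x) powr p)"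
        unfolding h_def u_def by (rule tendsto_eventually)
    qed
    fix n :: nat
    \<comment> \<open>Finite because \<open>h\<close> is bounded and the integrand is cut off to a
      ball; otherwise subtracting \<open>X / 2\<close> would be illegitimate.\<close>
    define X where "X = (\<integral>x. ?k n x \<partial>lborel)"
    have ki: "integrable lborel (?k n)"
      using M p by (intro integrable_bounded_support[of _ "M powr p" "real n"]) (auto intro: powr_mono2)
    then have X: "(\<integral>\<^sup>+ x. ennreal (?k n x) \<partial>lborel) = ennreal X" "0 \<le> X"
      unfolding X_def by (auto intro!: nn_integral_eq_integral integral_nonneg_AE)
    \<comment> \<open>The equality case of Hoelder's inequality: both \<open>h * g\<close> and |g|^q
      equal the truncated |h|^p.\<close>
    define g where "g = (\<lambda>x. if norm x \<le> real n then cnj (h x) * of_real (norm (h x) powr (p - 2)) else 0)"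
    have [measurable]: "g \<in> borel_measurable borel" unfolding g_def by measurable
    have ng: "norm (g x) = (if norm x \<le> real n then norm (h x) powr (p - 1) else 0)" for x
      using powr_mult_base[of "norm (h x)" "p - 2"] by (simp add: g_def norm_mult)
    have "norm (g x) \<le> M powr (p - 1)" for x
      unfolding ng using M p by (auto intro: powr_mono2)
    then have g: "bdd_supp g"
      unfolding bdd_supp_def by (intro conjI exI[of _ "M powr (p - 1)"] exI[of _ "real n"]) (auto simp: g_def)
    have gq: "norm (g x) powr q = ?k n x" for x
      unfolding ng using q by (simp add: powr_powr)
    have hg: "h x * g x = of_real (?k n x)" for x
    proof -
      have "(norm (h x))\<^sup>2 * norm (h x) powr (p - 2) = norm (h x) powr p"
        using powr_mult_base[of "norm (h x)" "p - 2"] powr_mult_base[of "norm (h x)" "p - 1"]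
        by (simp add: power2_eq_square mult.assoc)
      then have "h x * (cnj (h x) * of_real (norm (h x) powr (p - 2))) = of_real (norm (h x) powr p)"
        unfolding mult.assoc[symmetric] complex_norm_square[symmetric] of_real_mult[symmetric] by (rule arg_cong)
      then show ?thesis by (simp add: g_def)
    qed
    have "complex_of_real X = (\<integral>x. h x * g x \<partial>lborel)"
      unfolding hg X_def by simp
    also have "\<dots> = (\<integral>x. u x * fourier g x \<partial>lborel)"
      unfolding h_def by (rule fourier_mult_formula[OF ui bdd_supp_integrable[OF g]])
    finally have "norm (complex_of_real X) = norm (\<integral>x. u x * fourier g x \<partial>lborel)" by simp
    then have "ennreal X = ennreal (norm (\<integral>x. u x * fourier g x \<partial>lborel))" using X by simp
    also have "\<dots> \<le> (\<integral>\<^sup>+ x. ennreal (norm (u x * fourier g x)) \<partial>lborel)"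
      by (cases "integrable lborel (\<lambda>x. u x * fourier g x)") (auto intro!: integral_norm_bound_ennreal simp: not_integrable_integral_eq)
    also have "\<dots> \<le> (\<integral>\<^sup>+ x. ennreal (A powr p) * ennreal (norm (f x) powr p)
        + ennreal (1 / (2 * C0)) * ennreal (norm (fourier g x) powr q * wt x powr (q - 2)) \<partial>lborel)"
    proof (intro nn_integral_mono)
      fix x :: 'a
      let ?a = "A * norm (f x)" and ?b = "wt x powr (2 / p - 1) * norm (fourier g x) / A"
      have "norm (u x * fourier g x) = ?a * ?b"
        using A by (simp add: u_def norm_mult)
      also have "\<dots> \<le> ?a powr p / p + ?b powr q / q"
        using p q A by (intro Youngs_inequality) auto
      also have "\<dots> \<le> ?a powr p + ?b powr q"
        using p q by (intro add_mono) (auto simp: divide_le_eq mult_le_cancel_left1)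
      also have "?a powr p = A powr p * norm (f x) powr p"
        using A by (simp add: powr_mult)
      also have "?b powr q = 1 / (2 * C0) * (norm (fourier g x) powr q * wt x powr (q - 2))"
        using A wt_pos[of x] by (simp add: powr_mult powr_divide powr_powr q(5))
      finally show "ennreal (norm (u x * fourier g x)) \<le> ennreal (A powr p) * ennreal (norm (f x) powr p)
        + ennreal (1 / (2 * C0)) * ennreal (norm (fourier g x) powr q * wt x powr (q - 2))"
        using C0 by (simp add: ennreal_mult'[symmetric] ennreal_plus[symmetric] ennreal_leI del: ennreal_plus)
    qed
    also have "\<dots> = ennreal (A powr p) * (\<integral>\<^sup>+ x. ennreal (norm (f x) powr p) \<partial>lborel)
        + ennreal (1 / (2 * C0)) * (\<integral>\<^sup>+ x. ennreal (norm (fourier g x) powr q * wt x powr (q - 2)) \<partial>lborel)"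
      by (simp add: nn_integral_add nn_integral_cmult)
    also have "\<dots> \<le> ennreal (A powr p) * ennreal Fp + ennreal (1 / (2 * C0)) * (ennreal C0 * (\<integral>\<^sup>+ x. ennreal (norm (g x) powr q) \<partial>lborel))"
      unfolding Fp by (intro add_left_mono mult_left_mono paley g) auto
    also have "\<dots> = ennreal (A powr p * Fp + X / 2)"
    proof -
      have "1 / (2 * C0) * (C0 * X) = X / 2" using C0 by simp
      then show ?thesis
        unfolding gq X(1) using C0 X(2) Fp(2) by (simp add: ennreal_mult'[symmetric] ennreal_plus[symmetric] del: ennreal_plus)
    qed
    finally have "X \<le> A powr p * Fp + X / 2"
      using X(2) Fp(2) by (subst (asm) ennreal_le_iff) auto
    then have "X \<le> 2 * A powr p * Fp" by simp
    then show "(\<integral>\<^sup>+ x. ennreal (?k n x) \<partial>lborel) \<le> ennreal (2 * A powr p) * (\<integral>\<^sup>+ x. ennreal (norm (f x) powr p) \<partial>lborel)"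
      unfolding X Fp(1) using Fp(2) by (simp add: ennreal_mult'[symmetric] ennreal_leI)
  qed
  moreover have "2 * A powr p > 0" using A by simp
  ultimately show ?thesis by blast
qed

subsection \<open>Extension to all of the Lebesgue space\<close>

lemma powr_ge_self:
  assumes "0 \<le> (a::real)" "1 \<le> p"
  shows "a \<le> 1 + a powr p"
proof (cases "a \<le> 1")
  case True
  then show ?thesis by (rule order_trans) simp
next
  case False
  then show ?thesis using powr_mono[of 1 p a] assms by simp
qed

text \<open>From |f| <= 1 + |f|^p and w^(-2) <= 1, the product is at most w^(-2) + |f|^p.\<close>

lemma Lp_integrable_wt:
  fixes f :: "'a::euclidean_space \<Rightarrow> complex"
  assumes [measurable]: "f \<in> borel_measurable borel" and f: "integrable lborel (\<lambda>x. norm (f x) powr p)" and p: "1 \<le> p"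
  shows "integrable lborel (\<lambda>x. norm (f x) * wt x powr - 2)"
proof (rule Bochner_Integration.integrable_bound)
  show "integrable lborel (\<lambda>x::'a. wt x powr - 2 + norm (f x) powr p)"
    by (intro Bochner_Integration.integrable_add integrable_wt f)
  show "AE x in lborel. norm (norm (f x) * wt x powr - 2) \<le> norm (wt x powr - 2 + norm (f x) powr p)"
  proof (rule AE_I2)
    fix x
    have "norm (f x) * wt x powr - 2 \<le> (1 + norm (f x) powr p) * wt x powr - 2"
      using p by (intro mult_right_mono powr_ge_self) auto
    also have "\<dots> \<le> wt x powr - 2 + norm (f x) powr p"
      using wt_powr_le_1[of "-2" x] by (simp add: distrib_right mult_left_le)
    finally show "norm (norm (f x) * wt x powr - 2) \<le> norm (wt x powr - 2 + norm (f x) powr p)"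
      by simp
  qed
qed measurable

text \<open>A hands-on Riesz-Fischer argument. A fast subsequence of truncations has weighted
  transforms that converge almost everywhere and have a common majorant, so the limit
  \<open>h\<close> can be identified by pairing with Schwartz functions; Fatou transfers the norm
  bound.\<close>

lemma Lp_extension:
  fixes f :: "'a::euclidean_space \<Rightarrow> complex"
  assumes p: "1 \<le> p" and C: "0 < C" and e: "e \<le> 0"
    and bound: "\<And>f :: 'a \<Rightarrow> complex. bdd_supp f \<Longrightarrow>
    (\<integral>\<^sup>+ \<xi>. ennreal (norm (fourier (\<lambda>x. of_real (wt x powr e) * f x) \<xi>) powr p) \<partial>lborel)
      \<le> ennreal C * (\<integral>\<^sup>+ x. ennreal (norm (f x) powr p) \<partial>lborel)"
    and [measurable]: "f \<in> borel_measurable borel" and f: "integrable lborel (\<lambda>x. norm (f x) powr p)"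
  shows "\<exists>h \<in> borel_measurable borel. integrable lborel (\<lambda>x. norm (h x) powr p) \<and>
    (\<integral>x. norm (h x) powr p \<partial>lborel) \<le> C * (\<integral>x. norm (f x) powr p \<partial>lborel) \<and>
    (\<forall>g\<in>schwartz. (\<integral>x. h x * g x \<partial>lborel) = (\<integral>x. f x * (of_real (wt x powr e) * fourier g x) \<partial>lborel))"
proof -
  \<comment> \<open>Cutting off in both space and height gives \<open>bdd_supp\<close>. Each value
    is either \<open>f x\<close> or 0 and is eventually \<open>f x\<close>.\<close>
  define T where "T = (\<lambda>(k::nat) x. if norm x \<le> real k \<and> norm (f x) \<le> real k then f x else 0)"
  have [measurable]: "T k \<in> borel_measurable borel" for k unfolding T_def by measurable
  have T: "bdd_supp (T k)" for k
    unfolding bdd_supp_def by (intro conjI exI[of _ "real k"]) (auto simp: T_def)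
  have T_le: "norm (T k x) \<le> norm (f x)" "norm (f x - T k x) \<le> norm (f x)" for k x by (auto simp: T_def)
  have T_eventually: "\<exists>K. \<forall>k\<ge>K. T k x = f x" for x
  proof -
    obtain K :: nat where "max (norm x) (norm (f x)) \<le> real K" using real_arch_simple by blast
    then show ?thesis by (intro exI[of _ K]) (auto simp: T_def)
  qed
  have conv: "(\<lambda>k. \<integral>x. norm (f x - T k x) powr p \<partial>lborel) \<longlonglongrightarrow> (\<integral>x. 0 \<partial>(lborel::'a measure))"
  proof (rule integral_dominated_convergence[where w = "\<lambda>x. norm (f x) powr p"])
    show "AE x in lborel. (\<lambda>k. norm (f x - T k x) powr p) \<longlonglongrightarrow> 0"
    proof (intro AE_I2 tendsto_eventually)
      fix x
      obtain K where "\<forall>k\<ge>K. T k x = f x" using T_eventually by blast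
      then show "\<forall>\<^sub>F k in sequentially. norm (f x - T k x) powr p = 0"
        by (intro eventually_sequentiallyI[of K]) auto
    qed
    show "AE x in lborel. norm (norm (f x - T k x) powr p) \<le> norm (f x) powr p" for k
      using T_le p by (intro AE_I2) (auto intro: powr_mono2)
  qed (use f in auto)
  (* The rate is chosen so that the series S below, which dominates the increments H (Suc n) - H n, is integrable. *)
  define \<delta> where "\<delta> = (\<lambda>n::nat. (1 / 2) ^ n * (2 powr - p) ^ n)"
  have \<delta>: "0 < \<delta> n" for n by (simp add: \<delta>_def)
  have "\<exists>k\<ge>n. (\<integral>x. norm (f x - T k x) powr p \<partial>lborel) < \<delta> n" for n
  proof -
    have "\<forall>\<^sub>F k in sequentially. (\<integral>x. norm (f x - T k x) powr p \<partial>lborel) < \<delta> n"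
      using conv \<delta>[of n] by (intro order_tendstoD(2)) auto
    then obtain N where "\<forall>k\<ge>N. (\<integral>x. norm (f x - T k x) powr p \<partial>lborel) < \<delta> n"
      by (auto simp: eventually_sequentially)
    then show ?thesis by (intro exI[of _ "max n N"]) auto
  qed
  then obtain k where k: "\<And>n. k n \<ge> n" "\<And>n. (\<integral>x. norm (f x - T (k n) x) powr p \<partial>lborel) < \<delta> n"
    by metis
  have Tint: "integrable lborel (\<lambda>x. norm (f x - T j x) powr p)" for j
    using T_le p by (intro Bochner_Integration.integrable_bound[OF f] AE_I2) (auto intro: powr_mono2)
  have kn: "(\<integral>\<^sup>+ x. ennreal (norm (f x - T (k n) x) powr p) \<partial>lborel) \<le> ennreal (\<delta> n)" for n
    using k(2)[of n] Tint[of "k n"] by (subst nn_integral_eq_integral) (auto intro!: ennreal_leI)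
  define F where "F = (\<lambda>n x. T (k n) x)"
  have [measurable]: "F n \<in> borel_measurable borel" for n unfolding F_def by measurable
  have F: "bdd_supp (F n)" for n unfolding F_def by (rule T)
  define H where "H = (\<lambda>n. fourier (\<lambda>x. of_real (wt x powr e) * F n x))"
  have [measurable]: "H n \<in> borel_measurable borel" for n unfolding H_def by measurable
  have Hi: "integrable lborel (\<lambda>x. of_real (wt x powr e) * F n x)" for n
    by (intro bdd_supp_integrable bdd_supp_wt_mult F e)
  have diff: "(\<integral>\<^sup>+ \<xi>. ennreal (norm (H (Suc n) \<xi> - H n \<xi>) powr p) \<partial>lborel) \<le> ennreal (2 * C * \<delta> n)" for n
  proof -
    have D: "bdd_supp (\<lambda>x. F (Suc n) x - F n x)"
      \<comment> \<open>A difference of two truncations is dominated by the truncation with the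
        larger parameter.\<close>
      by (rule bdd_supp_mono[OF T[of "max (k (Suc n)) (k n)"], of _ 1]) (measurable, auto simp: F_def T_def)
    have "H (Suc n) \<xi> - H n \<xi> = fourier (\<lambda>x. of_real (wt x powr e) * (F (Suc n) x - F n x)) \<xi>" for \<xi>
      unfolding H_def by (simp add: fourier_diff[OF Hi Hi, symmetric] right_diff_distrib)
    then have "(\<integral>\<^sup>+ \<xi>. ennreal (norm (H (Suc n) \<xi> - H n \<xi>) powr p) \<partial>lborel) \<le> ennreal C * (\<integral>\<^sup>+ x. ennreal (norm (F (Suc n) x - F n x) powr p) \<partial>lborel)"
      using bound[OF D] by simp
    \<comment> \<open>No constant is lost here: each truncation equals \<open>f\<close> or 0
      pointwise, so a nonzero difference is \<open>f\<close> up to sign and is counted on the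
      right.\<close>
    also have "\<dots> \<le> ennreal C * (\<integral>\<^sup>+ x. ennreal (norm (f x - F (Suc n) x) powr p) + ennreal (norm (f x - F n x) powr p) \<partial>lborel)"
      by (intro mult_left_mono nn_integral_mono) (auto simp: F_def T_def)
    also have "\<dots> = ennreal C * ((\<integral>\<^sup>+ x. ennreal (norm (f x - F (Suc n) x) powr p) \<partial>lborel) + (\<integral>\<^sup>+ x. ennreal (norm (f x - F n x) powr p) \<partial>lborel))"
      by (simp add: nn_integral_add)
    also have "\<dots> \<le> ennreal C * (ennreal (\<delta> (Suc n)) + ennreal (\<delta> n))"
      unfolding F_def by (intro mult_left_mono add_mono kn) auto
    also have "\<dots> \<le> ennreal (2 * C * \<delta> n)"
    proof -
      have "\<delta> (Suc n) = \<delta> n * (1 / 2 * 2 powr - p)" by (simp add: \<delta>_def)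
      also have "\<dots> \<le> \<delta> n * 1"
        using \<delta>[of n] powr_mono[of "- p" 0 2] p by (intro mult_left_mono) auto
      finally have "\<delta> (Suc n) + \<delta> n \<le> 2 * \<delta> n" by simp
      then have "C * (\<delta> (Suc n) + \<delta> n) \<le> 2 * C * \<delta> n" using C by (simp add: mult.commute mult.left_commute)
      then show ?thesis
        using C \<delta>[of n] \<delta>[of "Suc n"] by (simp add: ennreal_mult'[symmetric] ennreal_plus[symmetric] ennreal_leI del: ennreal_plus)
    qed
    finally show ?thesis .
  qed
  \<comment> \<open>The factor 2^(p n) is removed by taking a p-th root: finiteness of
    \<open>S x\<close> makes the increments decay like 2^(-n).\<close>
  define S where "S = (\<lambda>x. \<Sum>n. ennreal ((2 powr p) ^ n * norm (H (Suc n) x - H n x) powr p))"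
  have [measurable]: "S \<in> borel_measurable borel" unfolding S_def by measurable
  have "(\<integral>\<^sup>+ x. S x \<partial>lborel) = (\<Sum>n. \<integral>\<^sup>+ x. ennreal ((2 powr p) ^ n * norm (H (Suc n) x - H n x) powr p) \<partial>lborel)"
    unfolding S_def by (rule nn_integral_suminf) measurable
  also have "\<dots> \<le> (\<Sum>n. ennreal (2 * C * (1 / 2) ^ n))"
  proof (intro suminf_le summableI)
    fix n
    have "(\<integral>\<^sup>+ x. ennreal ((2 powr p) ^ n * norm (H (Suc n) x - H n x) powr p) \<partial>lborel)
      = ennreal ((2 powr p) ^ n) * (\<integral>\<^sup>+ x. ennreal (norm (H (Suc n) x - H n x) powr p) \<partial>lborel)"
      by (subst nn_integral_cmult[symmetric]) (auto simp: ennreal_mult')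
    also have "\<dots> \<le> ennreal ((2 powr p) ^ n) * ennreal (2 * C * \<delta> n)"
      by (intro mult_left_mono diff) auto
    also have "\<dots> = ennreal (2 * C * (1 / 2) ^ n)"
    proof -
      have "(2 powr p) ^ n * (2 powr - p) ^ n = 1"
        unfolding power_mult_distrib[symmetric] powr_add[symmetric] by simp
      moreover have "(2 powr p) ^ n * (2 * C * \<delta> n) = ((2 powr p) ^ n * (2 powr - p) ^ n) * (2 * C * (1 / 2) ^ n)"
        unfolding \<delta>_def by (simp only: mult_ac)
      ultimately have "(2 powr p) ^ n * (2 * C * \<delta> n) = 2 * C * (1 / 2) ^ n" by (simp only: mult_1)
      moreover have "ennreal ((2 powr p) ^ n) * ennreal (2 * C * \<delta> n) = ennreal ((2 powr p) ^ n * (2 * C * \<delta> n))"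
        by (rule ennreal_mult'[symmetric]) simp
      ultimately show ?thesis by (simp only:)
    qed
    finally show "(\<integral>\<^sup>+ x. ennreal ((2 powr p) ^ n * norm (H (Suc n) x - H n x) powr p) \<partial>lborel) \<le> ennreal (2 * C * (1 / 2) ^ n)" .
  qed
  also have "\<dots> < \<infinity>"
  proof -
    have "summable (\<lambda>n. 2 * C * (1 / 2) ^ n)" by (intro summable_mult summable_geometric) auto
    then have "(\<Sum>n. ennreal (2 * C * (1 / 2) ^ n)) = ennreal (\<Sum>n. 2 * C * (1 / 2) ^ n)"
      using C by (intro suminf_ennreal2) auto
    then show ?thesis by simp
  qed
  finally have S_fin: "(\<integral>\<^sup>+ x. S x \<partial>lborel) < \<infinity>" .
  \<comment> \<open>Where \<open>S\<close> is infinite this value is 0 and bounds nothing, so every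
    pointwise estimate below assumes \<open>S x\<close> finite.\<close>
  define s where "s = (\<lambda>x. enn2real (S x))"
  have [measurable]: "s \<in> borel_measurable borel" unfolding s_def by measurable
  have S_AE: "AE x in lborel. S x \<noteq> \<infinity>" using S_fin by (intro nn_integral_PInf_AE) auto
  have s0: "0 \<le> s x" for x by (simp add: s_def)
  have S_eq: "ennreal (s x) = S x" if "S x \<noteq> \<infinity>" for x
    unfolding s_def using that by (intro ennreal_enn2real) (simp add: top.not_eq_extremum)
  have s: "integrable lborel s"
  proof (rule integrableI_bounded)
    have "(\<integral>\<^sup>+ x. ennreal (norm (s x)) \<partial>lborel) = (\<integral>\<^sup>+ x. S x \<partial>lborel)"
      using S_AE S_eq s0 by (intro nn_integral_cong_AE) (auto elim!: eventually_mono)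
    then show "(\<integral>\<^sup>+ x. ennreal (norm (s x)) \<partial>lborel) < \<infinity>" using S_fin by simp
  qed measurable
  have step: "norm (H (Suc n) x - H n x) \<le> (1 + s x) * (1 / 2) ^ n" if "S x \<noteq> \<infinity>" for n x
  proof -
    have "ennreal ((2 powr p) ^ n * norm (H (Suc n) x - H n x) powr p) \<le> S x"
    proof -
      have "g n \<le> suminf g" for g :: "nat \<Rightarrow> ennreal"
        using sum_le_suminf[of g "{n}"] by simp
      then show ?thesis unfolding S_def .
    qed
    then have "ennreal ((2 powr p) ^ n * norm (H (Suc n) x - H n x) powr p) \<le> ennreal (s x)"
      by (simp only: S_eq[OF that])
    then have "(2 powr p) ^ n * norm (H (Suc n) x - H n x) powr p \<le> s x" by (simp add: s0)
    also have "(2 powr p) ^ n = (2 ^ n) powr p"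
      by (induction n) (simp_all add: powr_mult)
    finally have "(2 ^ n * norm (H (Suc n) x - H n x)) powr p \<le> s x"
      by (simp add: powr_mult)
    \<comment> \<open>The inequality a <= 1 + a^p replaces the p-th root of \<open>s x\<close>,
      which keeps the majorant linear in the integrable \<open>s\<close>.\<close>
    then have "2 ^ n * norm (H (Suc n) x - H n x) \<le> 1 + s x"
      using powr_ge_self[of "2 ^ n * norm (H (Suc n) x - H n x)" p] p by simp
    then show ?thesis by (simp add: power_one_over pos_le_divide_eq mult.commute)
  qed
  have Cauchy: "norm (H (n + j) x - H n x) \<le> 2 * (1 + s x) * (1 / 2) ^ n" if "S x \<noteq> \<infinity>" for n j x
  proof -
    \<comment> \<open>The exact geometric remainder is kept so that the induction over
      \<open>j\<close> telescopes.\<close>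
    have "norm (H (n + j) x - H n x) \<le> 2 * (1 + s x) * ((1 / 2) ^ n - (1 / 2) ^ (n + j))"
    proof (induction j)
      case (Suc j)
      have "norm (H (n + Suc j) x - H n x) \<le> norm (H (Suc (n + j)) x - H (n + j) x) + norm (H (n + j) x - H n x)"
        using norm_triangle_ineq[of "H (Suc (n + j)) x - H (n + j) x" "H (n + j) x - H n x"] by simp
      also have "\<dots> \<le> (1 + s x) * (1 / 2) ^ (n + j) + 2 * (1 + s x) * ((1 / 2) ^ n - (1 / 2) ^ (n + j))"
        by (intro add_mono step that Suc)
      also have "\<dots> = 2 * (1 + s x) * ((1 / 2) ^ n - (1 / 2) ^ (n + Suc j))"
      proof -
        have "(1 + t) * b + 2 * (1 + t) * (a - b) = 2 * (1 + t) * (a - b / 2)" for a b t :: real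
          by (simp add: algebra_simps)
        moreover have "(1 / 2 :: real) ^ (n + Suc j) = (1 / 2) ^ (n + j) / 2" by simp
        ultimately show ?thesis by (simp only:)
      qed
      finally show ?case .
    qed simp
    also have "\<dots> \<le> 2 * (1 + s x) * (1 / 2) ^ n"
      using s0[of x] by (intro mult_left_mono) auto
    finally show ?thesis .
  qed
  define h where "h = (\<lambda>x. lim (\<lambda>n. H n x))"
  have [measurable]: "h \<in> borel_measurable borel"
    unfolding h_def by (rule borel_measurable_lim_metric) measurable
  have h: "(\<lambda>n. H n x) \<longlonglongrightarrow> h x" if "S x \<noteq> \<infinity>" for x
  proof -
    have "summable (\<lambda>n. H (Suc n) x - H n x)"
    proof (rule summable_comparison_test')
      show "summable (\<lambda>n. (1 + s x) * (1 / 2) ^ n)" by (intro summable_mult summable_geometric) auto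
      show "norm (H (Suc n) x - H n x) \<le> (1 + s x) * (1 / 2) ^ n" if "n \<ge> 0" for n
        by (rule step[OF \<open>S x \<noteq> \<infinity>\<close>])
    qed
    then have "(\<lambda>n. (\<Sum>i<n. H (Suc i) x - H i x) + H 0 x) \<longlonglongrightarrow> (\<Sum>i. H (Suc i) x - H i x) + H 0 x"
      by (intro tendsto_add tendsto_const summable_LIMSEQ)
    moreover have "(\<Sum>i<n. H (Suc i) x - H i x) + H 0 x = H n x" for n
      by (induction n) (simp_all add: algebra_simps)
    ultimately have "convergent (\<lambda>n. H n x)"
      by (simp only:) (rule convergentI)
    then show ?thesis unfolding h_def by (simp add: convergent_LIMSEQ_iff)
  qed
  have "(\<integral>\<^sup>+ x. ennreal (norm (h x) powr p) \<partial>lborel) \<le> ennreal C * (\<integral>\<^sup>+ x. ennreal (norm (f x) powr p) \<partial>lborel)"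
  proof (rule nn_integral_lim_le[where F = "\<lambda>n x. ennreal (norm (H n x) powr p)"])
    show "AE x in lborel. (\<lambda>n. ennreal (norm (H n x) powr p)) \<longlonglongrightarrow> ennreal (norm (h x) powr p)"
      using S_AE
    proof eventually_elim
      case (elim x)
      show ?case
        using p by (intro tendsto_ennrealI tendsto_powr2[OF tendsto_norm[OF h[OF elim]] tendsto_const]) auto
    qed
    show "(\<integral>\<^sup>+ x. ennreal (norm (H n x) powr p) \<partial>lborel) \<le> ennreal C * (\<integral>\<^sup>+ x. ennreal (norm (f x) powr p) \<partial>lborel)" for n
    proof -
      have "(\<integral>\<^sup>+ x. ennreal (norm (H n x) powr p) \<partial>lborel) \<le> ennreal C * (\<integral>\<^sup>+ x. ennreal (norm (F n x) powr p) \<partial>lborel)"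
        unfolding H_def by (rule bound[OF F])
      also have "\<dots> \<le> ennreal C * (\<integral>\<^sup>+ x. ennreal (norm (f x) powr p) \<partial>lborel)"
        using p T_le by (intro mult_left_mono nn_integral_mono ennreal_leI powr_mono2) (auto simp: F_def)
      finally show ?thesis .
    qed
  qed measurable
  also have "\<dots> = ennreal (C * (\<integral>x. norm (f x) powr p \<partial>lborel))"
    using f C by (subst nn_integral_eq_integral) (auto simp: ennreal_mult')
  finally have le: "(\<integral>\<^sup>+ x. ennreal (norm (h x) powr p) \<partial>lborel) \<le> ennreal (C * (\<integral>x. norm (f x) powr p \<partial>lborel))" .
  then have hi: "integrable lborel (\<lambda>x. norm (h x) powr p)"
    using le_less_trans[OF le ennreal_less_top] by (intro integrableI_bounded) simp_all
  have "(\<integral>\<^sup>+ x. ennreal (norm (h x) powr p) \<partial>lborel) = ennreal (\<integral>x. norm (h x) powr p \<partial>lborel)"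
    by (rule nn_integral_eq_integral[OF hi]) simp
  moreover have "0 \<le> C * (\<integral>x. norm (f x) powr p \<partial>lborel)"
    using C by (intro mult_nonneg_nonneg integral_nonneg_AE) auto
  ultimately have "(\<integral>x. norm (h x) powr p \<partial>lborel) \<le> C * (\<integral>x. norm (f x) powr p \<partial>lborel)"
    using le by (simp only: ennreal_le_iff)
  moreover have "(\<integral>x. h x * g x \<partial>lborel) = (\<integral>x. f x * (of_real (wt x powr e) * fourier g x) \<partial>lborel)" if g: "g \<in> schwartz" for g
  proof (rule LIMSEQ_unique)
    have [measurable]: "g \<in> borel_measurable borel" by (rule schwartz_borel_measurable[OF g])
    have gi: "integrable lborel g" by (rule schwartz_integrable[OF g])
    obtain G where "G \<ge> 0" "\<And>x. (1 + norm x) ^ 0 * norm (g x) \<le> G" using schwartz_decay[OF g] by blast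
    then have G: "\<And>x. norm (g x) \<le> G" by simp
    define M where "M = (\<integral>x. norm (of_real (wt x powr e) * F 0 x) \<partial>lborel)"
    have M: "norm (H 0 x) \<le> M" for x unfolding H_def M_def by (rule norm_fourier_le[OF Hi])
    show "(\<lambda>n. \<integral>x. H n x * g x \<partial>lborel) \<longlonglongrightarrow> (\<integral>x. h x * g x \<partial>lborel)"
    \<comment> \<open>The bound |H n| <= M + 2 (1 + s) comes from comparison with
      \<open>H 0\<close>. Of the product with \<open>g\<close>, the constant part uses integrability
      of \<open>g\<close>, the part with \<open>s\<close> its boundedness by
      \<open>G\<close>.\<close>
    proof (rule integral_dominated_convergence[where w = "\<lambda>x. (M + 2) * norm (g x) + 2 * G * s x"])
      show "integrable lborel (\<lambda>x. (M + 2) * norm (g x) + 2 * G * s x)" using gi s by auto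
      show "AE x in lborel. (\<lambda>n. H n x * g x) \<longlonglongrightarrow> h x * g x"
        using S_AE by (auto elim!: eventually_mono intro!: tendsto_mult_right h)
      show "AE x in lborel. norm (H n x * g x) \<le> (M + 2) * norm (g x) + 2 * G * s x" for n
        using S_AE
      proof eventually_elim
        case (elim x)
        have "norm (H n x) \<le> norm (H 0 x) + norm (H n x - H 0 x)"
          using norm_triangle_ineq[of "H 0 x" "H n x - H 0 x"] by simp
        also have "\<dots> \<le> M + 2 * (1 + s x)" using M[of x] Cauchy[OF elim, of 0 n] by simp
        finally have "norm (H n x * g x) \<le> (M + 2 * (1 + s x)) * norm (g x)"
          unfolding norm_mult by (rule mult_right_mono) simp
        also have "\<dots> = (M + 2) * norm (g x) + 2 * s x * norm (g x)" by (simp add: algebra_simps)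
        also have "\<dots> \<le> (M + 2) * norm (g x) + 2 * s x * G"
          using s0[of x] G by (intro add_left_mono mult_left_mono) auto
        finally show ?case by (simp add: mult_ac)
      qed
    qed measurable
    have [measurable]: "fourier g \<in> borel_measurable borel" by measurable
    have i: "integrable lborel (\<lambda>x. f x * fourier g x)"
      by (rule integrable_mult_schwartz[OF _ Lp_integrable_wt[OF _ f p] fourier_schwartz[OF g]]) measurable
    have "(\<integral>x. H n x * g x \<partial>lborel) = (\<integral>x. F n x * (of_real (wt x powr e) * fourier g x) \<partial>lborel)" for n
      unfolding H_def using fourier_mult_formula[OF Hi gi, of n] by (simp add: mult_ac)
    moreover have "(\<lambda>n. \<integral>x. F n x * (of_real (wt x powr e) * fourier g x) \<partial>lborel) \<longlonglongrightarrow> (\<integral>x. f x * (of_real (wt x powr e) * fourier g x) \<partial>lborel)"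
    proof (rule integral_dominated_convergence[where w = "\<lambda>x. norm (f x * fourier g x)"])
      show "AE x in lborel. (\<lambda>n. F n x * (of_real (wt x powr e) * fourier g x)) \<longlonglongrightarrow> f x * (of_real (wt x powr e) * fourier g x)"
      proof (intro AE_I2 tendsto_mult_right tendsto_eventually)
        fix x
        obtain K where K: "\<forall>k\<ge>K. T k x = f x" using T_eventually by blast
        have "F n x = f x" if "K \<le> n" for n
          using K order_trans[OF that k(1)] by (simp add: F_def)
        then show "\<forall>\<^sub>F n in sequentially. F n x = f x"
          by (rule eventually_sequentiallyI)
      qed
      show "AE x in lborel. norm (F n x * (of_real (wt x powr e) * fourier g x)) \<le> norm (f x * fourier g x)" for n
      proof (rule AE_I2)
        fix x
        have "wt x powr e * norm (fourier g x) \<le> 1 * norm (fourier g x)"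
          by (intro mult_right_mono wt_powr_le_1 e) auto
        then show "norm (F n x * (of_real (wt x powr e) * fourier g x)) \<le> norm (f x * fourier g x)"
          unfolding norm_mult using T_le(1)[of "k n" x] by (intro mult_mono) (auto simp: F_def)
      qed
    qed (use i in auto)
    ultimately show "(\<lambda>n. \<integral>x. H n x * g x \<partial>lborel) \<longlonglongrightarrow> (\<integral>x. f x * (of_real (wt x powr e) * fourier g x) \<partial>lborel)"
      by simp
  qed
  ultimately show ?thesis using hi \<open>h \<in> borel_measurable borel\<close> by blast
qed

text \<open>Members of \<open>Lp\<close> are only Lebesgue measurable, while the estimates are
  proved for Borel functions. Changing real and imaginary parts on a null set affects neither the
  distribution nor the norm.\<close>

lemma Lp_borel_version:
  fixes f :: "'a::euclidean_space \<Rightarrow> complex"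
  assumes f: "f \<in> Lp p"
  obtains f' where "f' \<in> borel_measurable borel" "integrable lborel (\<lambda>x. norm (f' x) powr p)"
    "dist_of f = dist_of f'" "Lp_norm p f = (\<integral>x. norm (f' x) powr p \<partial>lborel) powr (1 / p)"
proof -
  have [measurable]: "f \<in> borel_measurable lebesgue" and fi: "integrable lebesgue (\<lambda>x. norm (f x) powr p)"
    using f by (auto simp: Lp_def)
  have "(\<lambda>x. Re (f x)) \<in> borel_measurable lebesgue" "(\<lambda>x. Im (f x)) \<in> borel_measurable lebesgue" by measurable
  note ReIm = this[THEN completion_ex_borel_measurable_real]
  obtain r where r: "r \<in> borel_measurable lborel" "AE x in lborel. Re (f x) = r x"
    using ReIm(1) by (elim bexE)
  obtain i where i: "i \<in> borel_measurable lborel" "AE x in lborel. Im (f x) = i x"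
    using ReIm(2) by (elim bexE)
  define f' where "f' = (\<lambda>x. Complex (r x) (i x))"
  have [measurable]: "r \<in> borel_measurable borel" "i \<in> borel_measurable borel" using r(1) i(1) by simp_all
  have "(\<lambda>x. of_real (r x) + \<i> * of_real (i x)) \<in> borel_measurable borel" by measurable
  then have f'[measurable]: "f' \<in> borel_measurable borel"
    by (simp add: f'_def[abs_def] Complex_eq)
  then have [measurable]: "f' \<in> borel_measurable lebesgue" by (intro measurable_completion) simp
  have "AE x in lborel. f x = f' x" using r(2) i(2) by eventually_elim (simp add: f'_def complex_eq_iff)
  then have AE: "AE x in lebesgue. f x = f' x" by (rule AE_completion)
  have AEp: "AE x in lebesgue. norm (f x) powr p = norm (f' x) powr p"
    using AE by eventually_elim simp
  have "integrable lebesgue (\<lambda>x. norm (f' x) powr p)"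
    by (rule integrable_cong_AE_imp[OF fi _ AEp]) measurable
  then have int: "integrable lborel (\<lambda>x. norm (f' x) powr p)"
    by (subst (asm) integrable_completion) auto
  have "(LINT x|lebesgue. norm (f x) powr p) = (LINT x|lebesgue. norm (f' x) powr p)"
    by (rule integral_cong_AE[OF _ _ AEp]) measurable
  also have "\<dots> = (\<integral>x. norm (f' x) powr p \<partial>lborel)" by (rule integral_completion) measurable
  finally have "Lp_norm p f = (\<integral>x. norm (f' x) powr p \<partial>lborel) powr (1 / p)"
    by (simp add: Lp_norm_def)
  moreover have "dist_of f = dist_of f'"
    unfolding dist_of_def
  proof (rule restrict_ext)
    fix g :: "'a \<Rightarrow> complex" assume "g \<in> schwartz"
    then have "g \<in> borel_measurable lborel" using schwartz_borel_measurable by simp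
    then have [measurable]: "g \<in> borel_measurable lebesgue" by (rule measurable_completion)
    have "AE x in lebesgue. f x * g x = f' x * g x"
      using AE by eventually_elim simp
    then show "(LINT x|lebesgue. f x * g x) = (LINT x|lebesgue. f' x * g x)"
      by (rule integral_cong_AE[rotated 2]) measurable
  qed
  ultimately show ?thesis using that f' int by blast
qed

text \<open>Distributions are undefined off \<open>schwartz\<close>, so unfolding requires the test
  function \<phi> and its iterated transforms to be Schwartz. The double transform reflects \<phi>,
  and reflecting \<open>inv_fourier g\<close> gives \<open>fourier g\<close>.\<close>

lemma bessel_potential_fourier_dist:
  fixes f :: "'a::euclidean_space \<Rightarrow> complex"
  assumes [measurable]: "f \<in> borel_measurable borel" and g: "g \<in> schwartz"
  shows "bessel_potential s (fourier_dist (dist_of f)) g =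
    (\<integral>x. f x * (of_real ((1 + (norm x)\<^sup>2) powr (s / 2)) * fourier g x) \<partial>lborel)"
proof -
  define \<phi> where "\<phi> = (\<lambda>x. of_real ((1 + (norm x)\<^sup>2) powr (s / 2)) * inv_fourier g x)"
  have \<phi>: "\<phi> \<in> schwartz"
    unfolding \<phi>_def by (intro schwartz_tame_mult inv_fourier_schwartz g tame.powr)
  have "bessel_potential s (fourier_dist (dist_of f)) g = dist_of f (fourier (fourier \<phi>))"
    using g inv_fourier_schwartz[OF g] \<phi> fourier_schwartz[OF \<phi>]
    by (simp add: bessel_potential_def inv_fourier_dist_def mult_dist_def fourier_dist_def \<phi>_def)
  also have "fourier (fourier \<phi>) = (\<lambda>x. of_real ((1 + (norm x)\<^sup>2) powr (s / 2)) * fourier g x)"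
    using fourier_fourier_schwartz[OF \<phi>] by (auto simp: \<phi>_def inv_fourier_eq)
  finally show ?thesis
    using fourier_schwartz[OF fourier_schwartz[OF \<phi>]] by (simp add: dist_of_lborel \<open>fourier (fourier \<phi>) = _\<close>)
qed

theorem theorem1p11:
  fixes p s :: real
  assumes "2 \<le> p" and "s = real CARD('d::finite) * (2 / p - 1)"
  shows "\<exists>C>0. \<forall>f \<in> (Lp p :: (real ^ 'd \<Rightarrow> complex) set).
           fourier_dist (dist_of f) \<in> sobolev p s \<and>
           sobolev_norm p s (fourier_dist (dist_of f)) \<le> C * Lp_norm p f"
proof -
  have p: "1 \<le> p" "2 / p - 1 \<le> 0" using assms(1) by auto
  obtain C where C: "C > 0" and bound: "\<And>f :: real ^ 'd \<Rightarrow> complex. bdd_supp f \<Longrightarrow>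
    (\<integral>\<^sup>+ \<xi>. ennreal (norm (fourier (\<lambda>x. of_real (wt x powr (2 / p - 1)) * f x) \<xi>) powr p) \<partial>lborel)
      \<le> ennreal C * (\<integral>\<^sup>+ x. ennreal (norm (f x) powr p) \<partial>lborel)"
    using weighted_fourier_bound[OF assms(1)] by blast
  \<comment> \<open>The value of \<open>s\<close> enters only here; the dimension of
    \<open>real ^ 'd\<close> is the cardinality of \<open>'d\<close>.\<close>
  have wt: "(1 + (norm x)\<^sup>2) powr (s / 2) = wt x powr (2 / p - 1)" for x :: "real ^ 'd"
    by (simp add: wt_def powr_powr assms(2))
  have "fourier_dist (dist_of f) \<in> sobolev p s \<and>
      sobolev_norm p s (fourier_dist (dist_of f)) \<le> C powr (1 / p) * Lp_norm p f"
    if "f \<in> Lp p" for f :: "real ^ 'd \<Rightarrow> complex"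
  proof -
    obtain f' where f'[measurable]: "f' \<in> borel_measurable borel" and f'i: "integrable lborel (\<lambda>x. norm (f' x) powr p)"
      and D: "dist_of f = dist_of f'" and N: "Lp_norm p f = (\<integral>x. norm (f' x) powr p \<partial>lborel) powr (1 / p)"
      by (rule Lp_borel_version[OF \<open>f \<in> Lp p\<close>])
    obtain h where h[measurable]: "h \<in> borel_measurable borel" and hi: "integrable lborel (\<lambda>x. norm (h x) powr p)"
      and hle: "(\<integral>x. norm (h x) powr p \<partial>lborel) \<le> C * (\<integral>x. norm (f' x) powr p \<partial>lborel)"
      and hg: "\<And>g. g \<in> schwartz \<Longrightarrow> (\<integral>x. h x * g x \<partial>lborel) = (\<integral>x. f' x * (of_real (wt x powr (2 / p - 1)) * fourier g x) \<partial>lborel)"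
      using Lp_extension[OF p(1) C p(2) bound f' f'i] by blast
    have B: "bessel_potential s (fourier_dist (dist_of f)) = dist_of h"
    proof (rule extensionalityI[of _ schwartz])
      show "bessel_potential s (fourier_dist (dist_of f)) \<in> extensional schwartz"
        by (simp add: bessel_potential_def inv_fourier_dist_def)
      show "dist_of h \<in> extensional schwartz" by (simp add: dist_of_def)
      show "bessel_potential s (fourier_dist (dist_of f)) g = dist_of h g" if "g \<in> schwartz" for g
        using that by (simp add: D bessel_potential_fourier_dist dist_of_lborel hg wt)
    qed
    have "h \<in> borel_measurable lebesgue" by (intro measurable_completion) simp
    moreover have "integrable lebesgue (\<lambda>x. norm (h x) powr p)"
      using hi by (subst integrable_completion) auto
    ultimately have hLp: "h \<in> Lp p" by (simp add: Lp_def)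
    have "fourier_dist (dist_of f) \<in> tempered"
      unfolding D by (rule fourier_dist_of_tempered[OF f' Lp_integrable_wt[OF f' f'i p(1)]])
    then have "fourier_dist (dist_of f) \<in> sobolev p s"
      using hLp B by (auto simp: sobolev_def)
    moreover have "sobolev_norm p s (fourier_dist (dist_of f)) \<le> C powr (1 / p) * Lp_norm p f"
    proof -
      \<comment> \<open>The representative inside \<open>sobolev_norm\<close> is arbitrary, so its
        norm is compared with that of \<open>h\<close> through almost everywhere equality.\<close>
      define h2 where "h2 = (SOME h. h \<in> Lp p \<and> bessel_potential s (fourier_dist (dist_of f)) = dist_of h)"
      have "h2 \<in> Lp p \<and> bessel_potential s (fourier_dist (dist_of f)) = dist_of h2"
        unfolding h2_def by (rule someI[of _ h]) (use hLp B in auto)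
      then have h2: "h2 \<in> Lp p" "dist_of h2 = dist_of h" using B by auto
      obtain h' where h'[measurable]: "h' \<in> borel_measurable borel" and h'i: "integrable lborel (\<lambda>x. norm (h' x) powr p)"
        and D': "dist_of h2 = dist_of h'" and N': "Lp_norm p h2 = (\<integral>x. norm (h' x) powr p \<partial>lborel) powr (1 / p)"
        by (rule Lp_borel_version[OF h2(1)])
      have hw: "integrable lborel (\<lambda>x. norm (h x) * wt x powr - 2)" "integrable lborel (\<lambda>x. norm (h' x) * wt x powr - 2)"
        by (intro Lp_integrable_wt[OF _ _ p(1)] h h' hi h'i)+
      \<comment> \<open>Applied to a difference of L^p functions, which satisfies the growth
        condition although its p-th power is not examined.\<close>
      have "AE x in lborel. h' x - h x = 0"
      proof (rule AE_eq_0_if_schwartz_integrals_0)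
        show "integrable lborel (\<lambda>x. norm (h' x - h x) * wt x powr - 2)"
        proof (rule Bochner_Integration.integrable_bound[OF Bochner_Integration.integrable_add[OF hw(2,1)]])
          show "AE x in lborel. norm (norm (h' x - h x) * wt x powr - 2) \<le> norm (norm (h' x) * wt x powr - 2 + norm (h x) * wt x powr - 2)"
            unfolding distrib_right[symmetric]
            by (intro AE_I2) (simp add: abs_mult mult_right_mono norm_triangle_ineq4)
        qed measurable
        fix g :: "real ^ 'd \<Rightarrow> complex" assume g: "g \<in> schwartz"
        have "dist_of h' g = dist_of h g" using D' h2(2) by simp
        then have "(\<integral>x. h' x * g x \<partial>lborel) = (\<integral>x. h x * g x \<partial>lborel)"
          by (simp only: dist_of_lborel[OF h' g] dist_of_lborel[OF h g])
        then show "(\<integral>x. (h' x - h x) * g x \<partial>lborel) = 0"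
          using integrable_mult_schwartz[OF h hw(1) g] integrable_mult_schwartz[OF h' hw(2) g]
          by (simp add: left_diff_distrib)
      qed measurable
      then have "(\<integral>x. norm (h' x) powr p \<partial>lborel) = (\<integral>x. norm (h x) powr p \<partial>lborel)"
        by (intro integral_cong_AE) (auto elim!: eventually_mono)
      then have "sobolev_norm p s (fourier_dist (dist_of f)) = (\<integral>x. norm (h x) powr p \<partial>lborel) powr (1 / p)"
        using N' by (simp add: sobolev_norm_def h2_def)
      also have "\<dots> \<le> (C * (\<integral>x. norm (f' x) powr p \<partial>lborel)) powr (1 / p)"
        using p by (intro powr_mono2 hle) (auto intro!: integral_nonneg_AE)
      also have "\<dots> = C powr (1 / p) * Lp_norm p f"
        unfolding N using C by (simp add: powr_mult integral_nonneg_AE)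
      finally show ?thesis .
    qed
    ultimately show ?thesis ..
  qed
  moreover have "C powr (1 / p) > 0" using C by simp
  ultimately show ?thesis by blast
qed

end
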